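(* Let the system $$\frac{d\varrho}{dt}=f(\varrho,\varphi,S(t),t),\qquad \frac{d\varphi}{dt}=\omega+g(\varrho,\varphi,S(t),t)\qquad(\ast)$$ satisfy the standing assumptions of the context (including the resonance condition and the asymptotic expansions), and let $\Lambda_k,\Omega_k$ be the associated averaged coefficients defined in the context. Let $n,m\in[1,q]$ be integers such that $$\Lambda_k\equiv0\ (k<n),\quad \Lambda_n\not\equiv0,\qquad \Omega_k\equiv0\ (k<m),\quad \Omega_m\not\equiv0,$$ and let $\varrho_\ast\in(0,\mathcal R)$ be such that $$\Lambda_n(\varrho_\ast,\psi)\equiv0,\qquad \ell_n(\psi):=\partial_\rho\Lambda_n(\varrho_\ast,\psi)\not\equiv0,\qquad \Omega_m(\varrho_\ast,\psi)\ne0\quad\forall\,\psi\in\mathbb R .$$ (i) If $\ell_n(\psi)<0$ for all $\psi\in\mathbb R$, then for all $\varepsilon>0$ there exist $\delta_\varepsilon\in(0,\varepsilon)$ and $t_\varepsilon>0$ such that for all $t_s\ge t_\varepsilon$ any solution $\varrho(t),\varphi(t)$ of $(\ast)$ with initial data $|\varrho(t_s)-\varrho_\ast|\le\delta_\varepsilon$, $\varphi(t_s)\in\mathbb R$ satisfies $|\varrho(t)-\varrho_\ast|<\varepsilon$ for all $t>t_s$. Moreover, $\big|\varphi(t)-\frac{\kappa}{\varkappa}S(t)\big|\to\infty$ as $t\to\infty$. (ii) If $\ell_n(\psi)>0$ for all $\psi\in\mathbb R$, then there are $\varepsilon>0$ and $t_\ast>0$ such that for all $\delta\in(0,\varepsilon)$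 there exist $t_s\ge t_\ast$ and a solution $\varrho(t),\varphi(t)$ of $(\ast)$ with initial data $|\varrho(t_s)-\varrho_\ast|\le\delta$, $\varphi(t_s)\in\mathbb R$ such that $|\varrho(t_e)-\varrho_\ast|\ge\varepsilon$ at some $t_e>t_s$.
   Context: Standing assumptions. $\omega>0$, $\mathcal R>0$, $q\in\mathbb Z_+$ (positive integers). The functions $f(\varrho,\varphi,S,t)$ and $g(\varrho,\varphi,S,t)$ are infinitely differentiable, defined for all $\varrho\in(0,\mathcal R]$, $(\varphi,S)\in\mathbb R^2$, $t>0$, and $2\pi$-periodic in $\varphi$ and in $S$. The function $S(t)$ is smooth for $t>0$ and $S'(t)\sim s_0$ as $t\to\infty$, where $s_0>0$ satisfies the resonance condition: there are coprime integers $\kappa,\varkappa$ with $\kappa s_0=\varkappa\omega$. For each fixed $\varrho,\varphi$, $\lim_{t\to\infty}f(\varrho,\varphi,S(t),t)=\lim_{t\to\infty}g(\varrho,\varphi,S(t),t)=0$. The following asymptotic expansions hold as $t\to\infty$ for all $\varrho\in(0,\mathcal R]$ and $(\varphi,S)\in\mathbb R^2$: $$f\sim\sum_{k=1}^\infty t^{-\frac kq}f_k(\varrho,\varphi,S),\quad g\sim\sum_{k=1}^\infty t^{-\frac kq}g_k(\varrho,\varphi,S),\quad S'(t)\sim s_0+\sum_{k=1}^\infty t^{-\frac kq}s_k,$$ where $f_k,g_k$ are smooth and $2\pi$-periodic in $\varphi$ and $S$, and $s_k$ are real parameters. Averaged coefficients $\Lambda_k,\Omega_k$. Put $F_k(R,\Psi,S)=f_k(R,\frac{\kappa}{\varkappa}S+\Psi,S)$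 and $G_k(R,\Psi,S)=g_k(R,\frac{\kappa}{\varkappa}S+\Psi,S)-\frac{\kappa}{\varkappa}s_k$. Smooth functions $u_k(R,\Psi,S),v_k(R,\Psi,S)$ ($2\pi$-periodic in $\Psi$, $2\pi\varkappa$-periodic in $S$) and $\Lambda_k(R,\Psi),\Omega_k(R,\Psi)$ ($2\pi$-periodic in $\Psi$), $k\ge1$, are determined recursively by requiring that, with $U=R+\sum_{k\ge1}t^{-k/q}u_k$, $V=\Psi+\sum_{k\ge1}t^{-k/q}v_k$, the coefficients of every power $t^{-k/q}$ agree in the formal identity $$\Big(\sum_{j\ge1}t^{-\frac jq}F_j\,\partial_R+\sum_{j\ge1}t^{-\frac jq}G_j\,\partial_\Psi+\big(s_0+\sum_{j\ge1}t^{-\frac jq}s_j\big)\partial_S+\partial_t\Big)\begin{pmatrix} U \\ V \end{pmatrix}=\sum_{k\ge1}t^{-\frac kq}\begin{pmatrix} \Lambda_k(U,V) \\ \Omega_k(U,V) \end{pmatrix},$$ the right-hand side being Taylor expanded about $(R,\Psi)$. At order $k$ this reads $s_0\partial_S(u_k,v_k)^T=(\Lambda_k-F_k+\tilde F_k,\ \Omega_k-G_k+\tilde G_k)^T$ with $\tilde F_k,\tilde G_k$ depending only on earlier terms ($\tilde F_1=\tilde G_1=0$), so $\Lambda_k$ and $\Omega_k$ are the averages over $S\in[0,2\pi\varkappa]$ of $F_k-\tilde F_k$ and $G_k-\tilde G_k$. (The $u_k,v_k$ are determined up to additive functions of $(R,\Psi)$; any one choice is fixed.) This construction is the one by which $(\ast)$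 is transformed, via $R=\varrho$, $\Psi=\varphi-\kappa S/\varkappa$ and a near-identity change $(R,\Psi)\mapsto(r,\psi)$, into a system $\dot r=\sum_{k=1}^N t^{-k/q}\Lambda_k(r,\psi)+\mathcal O(t^{-(N+1)/q})$, $\dot\psi=\sum_{k=1}^N t^{-k/q}\Omega_k(r,\psi)+\mathcal O(t^{-(N+1)/q})$. Here $\partial_\rho$ denotes the derivative in the first argument.
   Formalization: The asymptotic expansions of f and g are taken with remainders uniform in (φ,S) and uniform for ϱ in compact subsets of (0,R]; with purely pointwise expansions the claim fails (narrow bumps in φ, moving and growing with time, push solutions away). *)

theory Defs
  imports "HOL-Analysis.Analysis" "HOL-Library.Landau_Symbols"
    "HOL-Computational_Algebra.Formal_Power_Series"
begin

text \<open>The derivative is taken within the domain, so that one-sided derivatives are used at the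
  closed end of \<open>{0<..\<R>}\<close>. The domains below are convex with non-empty interior, where the
  derivative within the set is unique.\<close>

primrec Ck_on :: "nat \<Rightarrow> ('a::real_normed_vector \<Rightarrow> 'b::real_normed_vector) \<Rightarrow> 'a set \<Rightarrow> bool" where
  "Ck_on 0 f D \<longleftrightarrow> continuous_on D f"
| "Ck_on (Suc k) f D \<longleftrightarrow>
     (\<exists>f'. (\<forall>x\<in>D. (f has_derivative f' x) (at x within D)) \<and> (\<forall>v. Ck_on k (\<lambda>x. f' x v) D))"

definition smooth_on :: "('a::real_normed_vector \<Rightarrow> 'b::real_normed_vector) \<Rightarrow> 'a set \<Rightarrow> bool" where
  "smooth_on f D \<longleftrightarrow> (\<forall>k. Ck_on k f D)"

definition smooth_periodic_rhs :: "real \<Rightarrow> (real \<Rightarrow> real \<Rightarrow> real \<Rightarrow> real \<Rightarrow> real) \<Rightarrow> bool" where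
  "smooth_periodic_rhs \<R> f \<longleftrightarrow>
     smooth_on (\<lambda>(\<rho>, \<phi>, S, t). f \<rho> \<phi> S t) ({0<..\<R>} \<times> UNIV \<times> UNIV \<times> {0<..}) \<and>
     (\<forall>\<rho>\<in>{0<..\<R>}. \<forall>\<phi> S. \<forall>t>0.
        f \<rho> (\<phi> + 2 * pi) S t = f \<rho> \<phi> S t \<and> f \<rho> \<phi> (S + 2 * pi) t = f \<rho> \<phi> S t)"

definition smooth_periodic3 :: "real \<Rightarrow> real \<Rightarrow> real \<Rightarrow> (real \<Rightarrow> real \<Rightarrow> real \<Rightarrow> real) \<Rightarrow> bool" where
  "smooth_periodic3 \<R> p2 p3 h \<longleftrightarrow>
     smooth_on (\<lambda>(x, y, z). h x y z) ({0<..\<R>} \<times> UNIV \<times> UNIV) \<and>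
     (\<forall>x\<in>{0<..\<R>}. \<forall>y z. h x (y + p2) z = h x y z \<and> h x y (z + p3) = h x y z)"

definition smooth_periodic2 :: "real \<Rightarrow> (real \<Rightarrow> real \<Rightarrow> real) \<Rightarrow> bool" where
  "smooth_periodic2 \<R> h \<longleftrightarrow>
     smooth_on (\<lambda>(x, y). h x y) ({0<..\<R>} \<times> UNIV) \<and>
     (\<forall>x\<in>{0<..\<R>}. \<forall>y. h x (y + 2 * pi) = h x y)"

text \<open>The expansion \<open>f \<sim> \<Sum>k\<ge>1. t\<^sup>-\<^sup>k\<^sup>/\<^sup>q f\<^sub>k\<close> as \<open>t \<rightarrow> \<infinity>\<close> is understood uniformly in the angles
  and uniformly for \<open>\<rho>\<close> in compact subsets of \<open>(0, \<R>]\<close>.\<close>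

definition asymptotic_expansion ::
  "real \<Rightarrow> nat \<Rightarrow> (real \<Rightarrow> real \<Rightarrow> real \<Rightarrow> real \<Rightarrow> real) \<Rightarrow> (nat \<Rightarrow> real \<Rightarrow> real \<Rightarrow> real \<Rightarrow> real) \<Rightarrow> bool"
where
  "asymptotic_expansion \<R> q f fk \<longleftrightarrow>
     (\<forall>N. \<forall>a\<in>{0<..\<R>}. \<exists>C. \<forall>\<^sub>F t in at_top. \<forall>\<rho>\<in>{a..\<R>}. \<forall>\<phi> S.
        \<bar>f \<rho> \<phi> S t - (\<Sum>k = 1..N. t powr (- (real k / real q)) * fk k \<rho> \<phi> S)\<bar>
          \<le> C * t powr (- (real (N + 1) / real q)))"

text \<open>Formal series in powers of \<open>t\<^sup>-\<^sup>1\<^sup>/\<^sup>q\<close> are formal power series with \<open>fps_X\<close> in the role of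
  \<open>t\<^sup>-\<^sup>1\<^sup>/\<^sup>q\<close>. Families \<open>fk\<close>, \<open>gk\<close>, \<open>u\<close>, \<open>v\<close>, \<open>\<Lambda>\<close>, \<open>\<Omega>\<close> are indexed from 1 (the value at
  index 0 is irrelevant), whereas \<open>s 0\<close> is the limit frequency.\<close>

definition fps_tail :: "(nat \<Rightarrow> real) \<Rightarrow> real fps" where
  "fps_tail a = Abs_fps (\<lambda>k. if k = 0 then 0 else a k)"

definition resonant_F ::
  "int \<Rightarrow> int \<Rightarrow> (nat \<Rightarrow> real \<Rightarrow> real \<Rightarrow> real \<Rightarrow> real) \<Rightarrow> nat \<Rightarrow> real \<Rightarrow> real \<Rightarrow> real \<Rightarrow> real" where
  "resonant_F \<kappa> \<nu> fk k R \<Psi> S = fk k R (of_int \<kappa> / of_int \<nu> * S + \<Psi>) S"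

definition resonant_G ::
  "int \<Rightarrow> int \<Rightarrow> (nat \<Rightarrow> real) \<Rightarrow> (nat \<Rightarrow> real \<Rightarrow> real \<Rightarrow> real \<Rightarrow> real)
     \<Rightarrow> nat \<Rightarrow> real \<Rightarrow> real \<Rightarrow> real \<Rightarrow> real" where
  "resonant_G \<kappa> \<nu> s gk k R \<Psi> S =
     gk k R (of_int \<kappa> / of_int \<nu> * S + \<Psi>) S - of_int \<kappa> / of_int \<nu> * s k"

text \<open>The derivative along the system of the formal series with coefficient functions \<open>W k\<close>
  (here \<open>k = 0\<close> does count). Since \<open>d/dt t\<^sup>-\<^sup>1\<^sup>/\<^sup>q = - (1/q) t\<^sup>-\<^sup>(\<^sup>q\<^sup>+\<^sup>1\<^sup>)\<^sup>/\<^sup>q\<close>, the operator \<open>\<partial>\<^sub>t\<close> acts as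
  \<open>- (1/q) X\<^sup>q\<^sup>+\<^sup>1 d/dX\<close>.\<close>

definition formal_derivative ::
  "nat \<Rightarrow> (nat \<Rightarrow> real) \<Rightarrow> (nat \<Rightarrow> real \<Rightarrow> real \<Rightarrow> real \<Rightarrow> real) \<Rightarrow> (nat \<Rightarrow> real \<Rightarrow> real \<Rightarrow> real \<Rightarrow> real)
     \<Rightarrow> (nat \<Rightarrow> real \<Rightarrow> real \<Rightarrow> real \<Rightarrow> real) \<Rightarrow> real \<Rightarrow> real \<Rightarrow> real \<Rightarrow> real fps" where
  "formal_derivative q s F G W R \<Psi> S =
     fps_tail (\<lambda>j. F j R \<Psi> S) * Abs_fps (\<lambda>k. deriv (\<lambda>x. W k x \<Psi> S) R)
   + fps_tail (\<lambda>j. G j R \<Psi> S) * Abs_fps (\<lambda>k. deriv (\<lambda>x. W k R x S) \<Psi>)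
   + Abs_fps s * Abs_fps (\<lambda>k. deriv (\<lambda>x. W k R \<Psi> x) S)
   - fps_const (1 / real q) * fps_X ^ (q + 1) * fps_deriv (Abs_fps (\<lambda>k. W k R \<Psi> S))"

text \<open>The series \<open>\<Sum>k\<ge>1. X\<^sup>k L\<^sub>k(R + a, \<Psi> + b)\<close>, Taylor expanded about \<open>(R, \<Psi>)\<close>, for increments
  \<open>a\<close>, \<open>b\<close> without constant term; hence \<open>a\<^sup>i b\<^sup>j\<close> contributes to the coefficient of \<open>X\<^sup>K\<^sup>-\<^sup>k\<close> only
  if \<open>i + j \<le> K - k\<close>, and the finite sums below lose nothing.\<close>

definition taylor_composition ::
  "(nat \<Rightarrow> real \<Rightarrow> real \<Rightarrow> real) \<Rightarrow> real \<Rightarrow> real \<Rightarrow> real fps \<Rightarrow> real fps \<Rightarrow> real fps" where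
  "taylor_composition L R \<Psi> a b = Abs_fps (\<lambda>K. \<Sum>k = 1..K. \<Sum>i\<le>K - k. \<Sum>j\<le>K - k.
     (deriv ^^ i) (\<lambda>x. (deriv ^^ j) (\<lambda>y. L k x y) \<Psi>) R / (fact i * fact j)
       * fps_nth (a ^ i * b ^ j) (K - k))"

text \<open>The identity is imposed on the open interval \<open>0 < R < \<R>\<close>, where two-sided partial
  derivatives make sense; by continuity it extends to \<open>R = \<R>\<close>.\<close>

definition averaged_coefficients ::
  "real \<Rightarrow> nat \<Rightarrow> int \<Rightarrow> int \<Rightarrow> (nat \<Rightarrow> real)
     \<Rightarrow> (nat \<Rightarrow> real \<Rightarrow> real \<Rightarrow> real \<Rightarrow> real) \<Rightarrow> (nat \<Rightarrow> real \<Rightarrow> real \<Rightarrow> real \<Rightarrow> real)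
     \<Rightarrow> (nat \<Rightarrow> real \<Rightarrow> real \<Rightarrow> real \<Rightarrow> real) \<Rightarrow> (nat \<Rightarrow> real \<Rightarrow> real \<Rightarrow> real \<Rightarrow> real)
     \<Rightarrow> (nat \<Rightarrow> real \<Rightarrow> real \<Rightarrow> real) \<Rightarrow> (nat \<Rightarrow> real \<Rightarrow> real \<Rightarrow> real) \<Rightarrow> bool" where
  "averaged_coefficients \<R> q \<kappa> \<nu> s fk gk u v \<Lambda> \<Omega> \<longleftrightarrow>
     (\<forall>k\<ge>1. smooth_periodic3 \<R> (2 * pi) (2 * pi * of_int \<nu>) (u k)
          \<and> smooth_periodic3 \<R> (2 * pi) (2 * pi * of_int \<nu>) (v k)
          \<and> smooth_periodic2 \<R> (\<Lambda> k) \<and> smooth_periodic2 \<R> (\<Omega> k)) \<and>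
     (let U = (\<lambda>k R \<Psi> S. if k = 0 then R else u k R \<Psi> S);
          V = (\<lambda>k R \<Psi> S. if k = 0 then \<Psi> else v k R \<Psi> S);
          D = formal_derivative q s (resonant_F \<kappa> \<nu> fk) (resonant_G \<kappa> \<nu> s gk)
      in \<forall>R\<in>{0<..<\<R>}. \<forall>\<Psi> S.
           D U R \<Psi> S = taylor_composition \<Lambda> R \<Psi>
             (fps_tail (\<lambda>k. u k R \<Psi> S)) (fps_tail (\<lambda>k. v k R \<Psi> S)) \<and>
           D V R \<Psi> S = taylor_composition \<Omega> R \<Psi>
             (fps_tail (\<lambda>k. u k R \<Psi> S)) (fps_tail (\<lambda>k. v k R \<Psi> S)))"

definition solution_from ::
  "real \<Rightarrow> real \<Rightarrow> (real \<Rightarrow> real \<Rightarrow> real \<Rightarrow> real \<Rightarrow> real) \<Rightarrow> (real \<Rightarrow> real \<Rightarrow> real \<Rightarrow> real \<Rightarrow> real)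
     \<Rightarrow> (real \<Rightarrow> real) \<Rightarrow> real \<Rightarrow> real set \<Rightarrow> (real \<Rightarrow> real) \<Rightarrow> (real \<Rightarrow> real) \<Rightarrow> bool" where
  "solution_from \<R> \<omega> f g S ts I \<rho> \<phi> \<longleftrightarrow>
     is_interval I \<and> ts \<in> I \<and> I \<subseteq> {ts..} \<and>
     (\<forall>t\<in>I. \<rho> t \<in> {0<..\<R>} \<and>
        (\<rho> has_real_derivative f (\<rho> t) (\<phi> t) (S t) t) (at t within I) \<and>
        (\<phi> has_real_derivative \<omega> + g (\<rho> t) (\<phi> t) (S t) t) (at t within I))"

definition maximal_solution_from ::
  "real \<Rightarrow> real \<Rightarrow> (real \<Rightarrow> real \<Rightarrow> real \<Rightarrow> real \<Rightarrow> real) \<Rightarrow> (real \<Rightarrow> real \<Rightarrow> real \<Rightarrow> real \<Rightarrow> real)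
     \<Rightarrow> (real \<Rightarrow> real) \<Rightarrow> real \<Rightarrow> real set \<Rightarrow> (real \<Rightarrow> real) \<Rightarrow> (real \<Rightarrow> real) \<Rightarrow> bool" where
  "maximal_solution_from \<R> \<omega> f g S ts I \<rho> \<phi> \<longleftrightarrow>
     solution_from \<R> \<omega> f g S ts I \<rho> \<phi> \<and>
     (\<nexists>J \<rho>' \<phi>'. I \<subset> J \<and> solution_from \<R> \<omega> f g S ts J \<rho>' \<phi>' \<and>
        (\<forall>t\<in>I. \<rho>' t = \<rho> t \<and> \<phi>' t = \<phi> t))"

end

theory Submission
  imports Defs
begin

text \<open>Because \<open>\<Lambda>\<^sub>k\<close> vanishes for \<open>k < n\<close>, the coefficients of the formal identity up to order \<open>n\<close>
  contain no Taylor terms: along a solution, \<open>r = \<rho> + \<Sum>k\<le>n. t\<^sup>-\<^sup>k\<^sup>/\<^sup>q u\<^sub>k\<close> satisfies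
  \<open>r' = t\<^sup>-\<^sup>n\<^sup>/\<^sup>q (\<Lambda>\<^sub>n(\<rho>, \<Psi>) + O(t\<^sup>-\<^sup>1\<^sup>/\<^sup>q))\<close> with the original variables \<open>\<rho>\<close> and
  \<open>\<Psi> = \<phi> - \<kappa> S / \<nu>\<close> on the right, so the change of variables is never inverted; the term
  \<open>\<partial>\<^sub>t\<close> contributes only beyond order \<open>q \<ge> n\<close>. The same holds for \<open>\<Psi>\<close> with \<open>\<Omega>\<^sub>m\<close>.
  Near \<open>\<rho>s\<close> the sign of \<open>(\<rho> - \<rho>s) \<Lambda>\<^sub>n\<close> is that of \<open>l\<close>, uniformly in the angle, so for large \<open>t\<close>
  the levels \<open>r = \<rho>s \<plusminus> \<eta>\<close> are one-way barriers. As \<open>n, m \<le> q\<close>, the integrals of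
  \<open>t\<^sup>-\<^sup>n\<^sup>/\<^sup>q\<close> and \<open>t\<^sup>-\<^sup>m\<^sup>/\<^sup>q\<close> diverge: this yields the escape in the unstable case and the
  unbounded drift of \<open>\<Psi>\<close> in the stable one.\<close>

section \<open>Scalar barriers and the initial value problem\<close>

text \<open>The error in the derivative of \<open>r\<close> (called \<open>y\<close> in the lemmas)
  need not vanish at \<rho>s, so the argument does not aim at convergence: it compares signs at a
  fixed distance from \<rho>s. Drift and error carry the same factor \<open>t^(-n/q)\<close>, hence
  an error constant \<eta> that is small against this distance settles the sign for all large
  \<open>t\<close>. The barriers are levels of \<open>r\<close> and not of \<rho>, because only the
  derivative of \<open>r\<close> is averaged; that of \<rho> may oscillate with the fast phase.
  Passing between the two costs \<eta> once more, which explains the fractions of \<epsilon> and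
  \<delta> below. The estimates must be uniform in two unbounded phases; periodicity reduces this to
  compact sets. They hold only while \<rho> is in a strip, so each barrier argument works before the
  strip has been left. Existence theory enters twice: an escaping solution has to be produced, and a
  maximal solution confined to a strip has to be global.\<close>

lemma first_hit:
  fixes h :: "real \<Rightarrow> real"
  assumes cont: "continuous_on {a..b} h" and "a \<le> b" "h a < \<eta>" "\<eta> \<le> h b"
  obtains t where "t \<in> {a<..b}" "h t = \<eta>" "\<And>r. r \<in> {a..<t} \<Longrightarrow> h r < \<eta>"
proof -
  let ?E = "{t \<in> {a..b}. h t = \<eta>}"
  have "?E \<noteq> {}"
    using IVT'[of h a \<eta> b] assms by auto
  moreover have "compact ?E"
    using continuous_closed_preimage_constant[OF cont]
    by (metis (no_types, lifting) closed_atLeastAtMost compact_Icc compact_Int_closed inf.absorb2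
        mem_Collect_eq subsetI)
  ultimately obtain t where t: "t \<in> ?E" and least: "\<And>t'. t' \<in> ?E \<Longrightarrow> t \<le> t'"
    using compact_attains_inf by meson
  have "h r < \<eta>" if r: "r \<in> {a..<t}" for r
  proof (rule ccontr)
    assume "\<not> h r < \<eta>"
    then obtain t' where "a \<le> t'" "t' \<le> r" "h t' = \<eta>"
      using IVT'[of h a \<eta> r] continuous_on_subset[OF cont] \<open>h a < \<eta>\<close> r t by auto
    then show False using least[of t'] r t by auto
  qed
  moreover have "a < t" using t \<open>h a < \<eta>\<close> by (cases "a = t") auto
  ultimately show ?thesis using that t by auto
qed

text \<open>At the first time \<open>t\<close> on the level the derivative is negative, so
  \<open>y\<close> lies above \<eta> just before \<open>t\<close>, against minimality. Only the sign
  on the level itself enters, and decrease from the left suffices, so the endpoint \<open>b\<close>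
  is no exception.\<close>

lemma barrier_real:
  fixes y D :: "real \<Rightarrow> real"
  assumes "a \<le> b" "y a < \<eta>"
    and der: "\<And>t. t \<in> {a..b} \<Longrightarrow> (y has_real_derivative D t) (at t within {a..b})"
    and neg: "\<And>t. t \<in> {a..b} \<Longrightarrow> y t = \<eta> \<Longrightarrow> D t < 0"
  shows "y b < \<eta>"
proof (rule ccontr)
  assume "\<not> y b < \<eta>"
  then have "\<eta> \<le> y b" by simp
  have cont: "continuous_on {a..b} y"
    using der DERIV_continuous continuous_on_eq_continuous_within by blast
  obtain t where t: "t \<in> {a<..b}" "y t = \<eta>" and below: "\<And>r. r \<in> {a..<t} \<Longrightarrow> y r < \<eta>"
    by (rule first_hit[OF cont \<open>a \<le> b\<close> \<open>y a < \<eta>\<close> \<open>\<eta> \<le> y b\<close>]) blast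
  obtain d where "d > 0" and d: "\<And>h. h > 0 \<Longrightarrow> t - h \<in> {a..b} \<Longrightarrow> h < d \<Longrightarrow> y t < y (t - h)"
    using has_real_derivative_neg_dec_left[OF der neg, of t] t by auto
  define h where "h = min (d / 2) (t - a)"
  have h: "h > 0" "h < d" "t - h \<in> {a..<t}"
    using \<open>d > 0\<close> t by (auto simp: h_def min_def)
  then show False using d[of h] below[of "t - h"] t by auto
qed

lemma has_real_derivative_nonneg_imp_le:
  fixes y D :: "real \<Rightarrow> real"
  assumes "a \<le> b"
    and der: "\<And>t. t \<in> {a..b} \<Longrightarrow> (y has_real_derivative D t) (at t within {a..b})"
    and nonneg: "\<And>t. t \<in> {a..b} \<Longrightarrow> D t \<ge> 0"
  shows "y a \<le> y b"
proof (rule DERIV_nonneg_imp_increasing_open[OF \<open>a \<le> b\<close>])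
  show "\<exists>D. (y has_real_derivative D) (at t) \<and> 0 \<le> D" if "a < t" "t < b" for t
    using der[of t] nonneg[of t] that by (auto simp: at_within_Icc_at)
  show "continuous_on {a..b} y"
    using der DERIV_continuous continuous_on_eq_continuous_within by blast
qed

section \<open>Uniqueness and global existence for Lipschitz equations\<close>

text \<open>Gronwall in differential form: the squared distance, weighted by
  \<open>exp (- 2 * L * t)\<close>, starts at zero and cannot increase, by Cauchy-Schwarz. The inner
  product keeps the squared distance differentiable where the solutions meet.\<close>

lemma ode_unique:
  fixes x y :: "real \<Rightarrow> 'a::real_inner" and F :: "real \<Rightarrow> 'a \<Rightarrow> 'a"
  assumes "a \<le> b" "x a = y a"
    and x: "\<And>t. t \<in> {a..b} \<Longrightarrow> (x has_vector_derivative F t (x t)) (at t within {a..b})"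
    and y: "\<And>t. t \<in> {a..b} \<Longrightarrow> (y has_vector_derivative F t (y t)) (at t within {a..b})"
    and lip: "\<And>t u v. t \<in> {a..b} \<Longrightarrow> norm (F t u - F t v) \<le> L * norm (u - v)"
  shows "x b = y b"
proof -
  define w where "w t = x t - y t" for t
  define G where "G t = F t (x t) - F t (y t)" for t
  define e where "e t = exp (- 2 * L * t) * (w t \<bullet> w t)" for t
  have e: "(e has_real_derivative exp (- 2 * L * t) * (2 * (w t \<bullet> G t) - 2 * L * (w t \<bullet> w t)))
      (at t within {a..b})" if t: "t \<in> {a..b}" for t
  proof -
    have "(w has_derivative (\<lambda>h. h *\<^sub>R G t)) (at t within {a..b})"
      using has_vector_derivative_diff[OF x[OF t] y[OF t]]
      unfolding w_def G_def has_vector_derivative_def .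
    then have "((\<lambda>t. w t \<bullet> w t) has_derivative (\<lambda>h. w t \<bullet> (h *\<^sub>R G t) + (h *\<^sub>R G t) \<bullet> w t))
        (at t within {a..b})"
      by (rule has_derivative_inner) fact
    then have *: "((\<lambda>t. w t \<bullet> w t) has_real_derivative 2 * (w t \<bullet> G t)) (at t within {a..b})"
      by (rule has_derivative_imp_has_field_derivative) (simp add: inner_commute)
    show ?thesis
      unfolding e_def by (rule derivative_eq_intros * refl | simp add: algebra_simps)+
  qed
  have le: "w t \<bullet> G t \<le> L * (w t \<bullet> w t)" if t: "t \<in> {a..b}" for t
  proof -
    have "w t \<bullet> G t \<le> norm (w t) * norm (G t)" by (rule norm_cauchy_schwarz)
    also have "\<dots> \<le> norm (w t) * (L * norm (w t))"
      using lip[OF t, of "x t" "y t"] unfolding G_def w_def by (intro mult_left_mono) auto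
    finally show ?thesis by (simp add: dot_square_norm power2_eq_square algebra_simps)
  qed
  have "- e a \<le> - e b"
    by (rule has_real_derivative_nonneg_imp_le[OF \<open>a \<le> b\<close> DERIV_minus[OF e]])
      (use le in \<open>auto simp: mult_le_0_iff\<close>)
  then have "e b \<le> e a" by simp
  also have "e a = 0" using \<open>x a = y a\<close> by (simp add: e_def w_def)
  finally have "w b \<bullet> w b \<le> 0" by (simp add: e_def mult_le_0_iff)
  then have "w b \<bullet> w b = 0" by (intro antisym inner_ge_zero)
  then show ?thesis by (simp add: w_def)
qed

text \<open>The iterates are rescaled by \<open>exp (- 2 L (t - a))\<close>, which makes the Picard operator a
  contraction on the whole interval, so that no continuation argument is needed.\<close>

lemma picard_lindelof_global:
  fixes F :: "real \<Rightarrow> 'a::banach \<Rightarrow> 'a"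
  assumes "a \<le> b" "L > 0"
    and cont: "continuous_on ({a..b} \<times> UNIV) (\<lambda>(t, x). F t x)"
    and lip: "\<And>t u v. t \<in> {a..b} \<Longrightarrow> norm (F t u - F t v) \<le> L * norm (u - v)"
  obtains x where "x a = x0"
    and "\<And>t. t \<in> {a..b} \<Longrightarrow> (x has_vector_derivative F t (x t)) (at t within {a..b})"
proof -
  define K where "K z s = F s (exp (2 * L * (s - a)) *\<^sub>R apply_bcontfun z s)"
    for z :: "real \<Rightarrow>\<^sub>C 'a" and s
  have K: "continuous_on {a..b} (K z)" for z
    unfolding K_def
    by (rule continuous_on_compose2[OF cont, where f = "\<lambda>s. (s, _ s)", simplified])
      (auto intro!: continuous_intros)
  define P where "P z t = exp (- 2 * L * (t - a)) *\<^sub>R (x0 + integral {a..t} (K z))" for z t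
  \<comment> \<open>The fixed point theorem is applied in the space of bounded continuous functions
    on the whole line. \<open>clamp\<close> extends \<open>P z\<close> by its endpoint values, so
    distances are still decided on \<open>{a..b}\<close>.\<close>
  have "\<exists>g :: real \<Rightarrow>\<^sub>C 'a. \<forall>t. apply_bcontfun g t = P z (clamp a b t)" for z
  proof -
    have "continuous_on (cbox a b) (P z)"
      unfolding P_def
      unfolding cbox_interval
      by (intro continuous_intros indefinite_integral_continuous_1 integrable_continuous_real K)
    then show ?thesis by (rule continuous_on_cbox_bcontfunE) blast
  qed
  then obtain Q :: "(real \<Rightarrow>\<^sub>C 'a) \<Rightarrow> (real \<Rightarrow>\<^sub>C 'a)"
    where Q: "\<And>z t. apply_bcontfun (Q z) t = P z (clamp a b t)" by metis
  have "dist (Q z) (Q w) \<le> 1 / 2 * dist z w" for z w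
  proof (rule dist_bound)
    fix t0
    define t where "t = clamp a b t0"
    have t: "t \<in> {a..b}" using \<open>a \<le> b\<close> clamp_in_interval[of a b t0] by (simp add: t_def)
    define d where "d = dist z w"
    have "d \<ge> 0" by (simp add: d_def)
    have Kt: "continuous_on {a..t} (K z)" for z by (rule continuous_on_subset[OF K]) (use t in auto)
    \<comment> \<open>The rate \<open>2 * L\<close> of the weight is twice the Lipschitz constant,
      so the integral of \<open>L\<close> times the weight is at most half the weight: this half is
      the contraction factor.\<close>
    have "((\<lambda>s. L * exp (2 * L * (s - a)) * d) has_integral
        (exp (2 * L * (t - a)) * d / 2 - exp (2 * L * (a - a)) * d / 2)) {a..t}"
      using t by (intro fundamental_theorem_of_calculus)
        (auto intro!: derivative_eq_intros simp flip: has_real_derivative_iff_has_vector_derivative)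
    then have int: "(\<lambda>s. L * exp (2 * L * (s - a)) * d) integrable_on {a..t}"
      and val: "integral {a..t} (\<lambda>s. L * exp (2 * L * (s - a)) * d) \<le> exp (2 * L * (t - a)) * d / 2"
      using \<open>d \<ge> 0\<close> has_integral_integrable by (blast, subst integral_unique) auto
    have "norm (integral {a..t} (\<lambda>s. K z s - K w s))
        \<le> integral {a..t} (\<lambda>s. L * exp (2 * L * (s - a)) * d)"
    proof (rule Henstock_Kurzweil_Integration.integral_norm_bound_integral[OF _ int])
      show "(\<lambda>s. K z s - K w s) integrable_on {a..t}"
        by (intro integrable_continuous_real continuous_intros Kt)
      fix s assume s: "s \<in> {a..t}"
      have "norm (K z s - K w s) \<le> L * norm (exp (2 * L * (s - a)) *\<^sub>R apply_bcontfun z s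
          - exp (2 * L * (s - a)) *\<^sub>R apply_bcontfun w s)"
        unfolding K_def by (rule lip) (use s t in auto)
      also have "\<dots> = L * exp (2 * L * (s - a)) * dist (apply_bcontfun z s) (apply_bcontfun w s)"
        by (simp add: dist_norm flip: scaleR_diff_right)
      also have "\<dots> \<le> L * exp (2 * L * (s - a)) * d"
        using dist_bounded[of z s w] \<open>L > 0\<close> by (auto simp: d_def intro!: mult_left_mono)
      finally show "norm (K z s - K w s) \<le> L * exp (2 * L * (s - a)) * d" .
    qed
    also note val
    also have "integral {a..t} (\<lambda>s. K z s - K w s) = integral {a..t} (K z) - integral {a..t} (K w)"
      by (intro Henstock_Kurzweil_Integration.integral_diff integrable_continuous_real Kt)
    finally have *: "norm (integral {a..t} (K z) - integral {a..t} (K w))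
        \<le> exp (2 * L * (t - a)) * d / 2" .
    have "dist (apply_bcontfun (Q z) t0) (apply_bcontfun (Q w) t0)
        = exp (- 2 * L * (t - a)) * norm (integral {a..t} (K z) - integral {a..t} (K w))"
      by (simp add: Q P_def dist_norm flip: t_def scaleR_diff_right)
    also have "\<dots> \<le> exp (- 2 * L * (t - a)) * (exp (2 * L * (t - a)) * d / 2)"
      by (intro mult_left_mono *) auto
    also have "\<dots> = 1 / 2 * d" by (simp add: exp_minus)
    finally show "dist (apply_bcontfun (Q z) t0) (apply_bcontfun (Q w) t0) \<le> 1 / 2 * dist z w"
      by (simp add: d_def)
  qed
  then obtain z where z: "Q z = z"
    using banach_fix_type[of "1 / 2" Q] by auto
  define x where "x t = x0 + integral {a..t} (K z)" for t
  have zx: "exp (2 * L * (t - a)) *\<^sub>R apply_bcontfun z t = x t" if "t \<in> {a..b}" for t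
  proof -
    have "apply_bcontfun z t = P z t"
      using Q[of z t] z that by (simp add: clamp_cancel_cbox[of t a b])
    then show ?thesis by (simp add: P_def x_def flip: exp_add)
  qed
  show ?thesis
  proof
    show "x a = x0" by (simp add: x_def)
    fix t assume t: "t \<in> {a..b}"
    have "(x has_vector_derivative 0 + K z t) (at t within {a..b})"
      unfolding x_def
      by (intro has_vector_derivative_add has_vector_derivative_const
          integral_has_vector_derivative K t)
    then show "(x has_vector_derivative F t (x t)) (at t within {a..b})"
      by (simp add: K_def zx[OF t])
  qed
qed

section \<open>Smooth periodic functions\<close>

lemma smooth_on_derivative:
  assumes "smooth_on h D"
  obtains h' where "\<And>x. x \<in> D \<Longrightarrow> (h has_derivative h' x) (at x within D)"
    and "\<And>v. continuous_on D (\<lambda>x. h' x v)"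
proof -
  have "Ck_on (Suc 0) h D" using assms unfolding smooth_on_def by blast
  then show ?thesis using that by auto
qed

lemma smooth_on_continuous: "smooth_on h D \<Longrightarrow> continuous_on D h"
  unfolding smooth_on_def by (metis Ck_on.simps(1))

text \<open>An interior point has an open box inside the domain, so the derivative within the domain
  is a full derivative there, and the partial derivative is its value on a basis vector. Continuity
  of that value for a fixed direction is part of smoothness. The versions for three and four
  variables below follow the same pattern.\<close>

lemma smooth_on_partials2:
  fixes h :: "real \<Rightarrow> real \<Rightarrow> real"
  assumes "smooth_on (\<lambda>(x, y). h x y) ({0<..\<R>} \<times> UNIV)"
  shows "x \<in> {0<..<\<R>} \<Longrightarrow>
      ((\<lambda>x. h x y) has_real_derivative deriv (\<lambda>x. h x y) x) (at x)"
    and "continuous_on ({0<..<\<R>} \<times> UNIV) (\<lambda>(x, y). deriv (\<lambda>x. h x y) x)"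
proof -
  let ?D = "{0<..\<R>} \<times> (UNIV :: real set)"
  obtain h' where h': "\<And>w. w \<in> ?D \<Longrightarrow> ((\<lambda>(x, y). h x y) has_derivative h' w) (at w within ?D)"
    and cont: "\<And>v. continuous_on ?D (\<lambda>w. h' w v)"
    using smooth_on_derivative[OF assms] by blast
  have at: "((\<lambda>x. h x y) has_real_derivative h' (x, y) (1, 0)) (at x)" if "x \<in> {0<..<\<R>}" for x y
  proof -
    have "at (x, y) within ?D = at (x, y)"
      by (rule at_within_open_subset[of _ "{0<..<\<R>} \<times> UNIV"]) (use that in \<open>auto intro!: open_Times\<close>)
    then have D: "((\<lambda>(x, y). h x y) has_derivative h' (x, y)) (at (x, y))"
      using h'[of "(x, y)"] that by auto
    interpret bounded_linear "h' (x, y)" by (rule has_derivative_bounded_linear[OF D])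
    have "((\<lambda>x. (x, y)) has_derivative (\<lambda>d. (d, 0))) (at x)"
      by (auto intro!: derivative_eq_intros simp: zero_prod_def)
    from has_derivative_compose[OF this, of "\<lambda>(x, y). h x y", OF D]
    have "((\<lambda>x. h x y) has_derivative (\<lambda>d. h' (x, y) (d, 0))) (at x)" by simp
    moreover have "(*) (h' (x, y) (1, 0)) = (\<lambda>d. h' (x, y) (d, 0))"
    proof
      show "h' (x, y) (1, 0) * d = h' (x, y) (d, 0)" for d
        using scaleR[of d "(1, 0)"] by simp
    qed
    ultimately show ?thesis by (simp add: has_field_derivative_def)
  qed
  then show "x \<in> {0<..<\<R>} \<Longrightarrow>
      ((\<lambda>x. h x y) has_real_derivative deriv (\<lambda>x. h x y) x) (at x)"
    by (metis DERIV_imp_deriv)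
  have "continuous_on ({0<..<\<R>} \<times> UNIV) (\<lambda>w. h' w (1, 0))"
    by (rule continuous_on_subset[OF cont]) auto
  then show "continuous_on ({0<..<\<R>} \<times> UNIV) (\<lambda>(x, y). deriv (\<lambda>x. h x y) x)"
    by (rule continuous_on_eq) (auto simp: DERIV_imp_deriv[OF at])
qed

lemma smooth_on_partials3:
  fixes h :: "real \<Rightarrow> real \<Rightarrow> real \<Rightarrow> real"
  assumes "smooth_on (\<lambda>(x, y, z). h x y z) ({0<..\<R>} \<times> UNIV \<times> UNIV)"
  shows "x \<in> {0<..<\<R>} \<Longrightarrow> ((\<lambda>(x, y, z). h x y z) has_derivative
      (\<lambda>(d, d', d''). deriv (\<lambda>x. h x y z) x * d + deriv (\<lambda>y. h x y z) y * d'
        + deriv (\<lambda>z. h x y z) z * d'')) (at (x, y, z))"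
    and "continuous_on ({0<..<\<R>} \<times> UNIV \<times> UNIV) (\<lambda>(x, y, z). deriv (\<lambda>x. h x y z) x)"
    and "continuous_on ({0<..<\<R>} \<times> UNIV \<times> UNIV) (\<lambda>(x, y, z). deriv (\<lambda>y. h x y z) y)"
    and "continuous_on ({0<..<\<R>} \<times> UNIV \<times> UNIV) (\<lambda>(x, y, z). deriv (\<lambda>z. h x y z) z)"
proof -
  let ?D = "{0<..\<R>} \<times> (UNIV :: real set) \<times> (UNIV :: real set)"
  obtain h' where h': "\<And>w. w \<in> ?D \<Longrightarrow> ((\<lambda>(x, y, z). h x y z) has_derivative h' w) (at w within ?D)"
    and cont: "\<And>v. continuous_on ?D (\<lambda>w. h' w v)"
    using smooth_on_derivative[OF assms] by blast
  have partials: "deriv (\<lambda>x. h x y z) x = h' (x, y, z) (1, 0, 0)"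
      "deriv (\<lambda>y. h x y z) y = h' (x, y, z) (0, 1, 0)"
      "deriv (\<lambda>z. h x y z) z = h' (x, y, z) (0, 0, 1)"
    and D: "((\<lambda>(x, y, z). h x y z) has_derivative h' (x, y, z)) (at (x, y, z))"
    if "x \<in> {0<..<\<R>}" for x y z
  proof -
    have "at (x, y, z) within ?D = at (x, y, z)"
      by (rule at_within_open_subset[of _ "{0<..<\<R>} \<times> UNIV \<times> UNIV"])
        (use that in \<open>auto intro!: open_Times\<close>)
    then show D: "((\<lambda>(x, y, z). h x y z) has_derivative h' (x, y, z)) (at (x, y, z))"
      using h'[of "(x, y, z)"] that by auto
    interpret bounded_linear "h' (x, y, z)" by (rule has_derivative_bounded_linear[OF D])
    have 1: "((\<lambda>x. (x, y, z)) has_derivative (\<lambda>d. (d, 0, 0))) (at x)"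
      and 2: "((\<lambda>y. (x, y, z)) has_derivative (\<lambda>d. (0, d, 0))) (at y)"
      and 3: "((\<lambda>z. (x, y, z)) has_derivative (\<lambda>d. (0, 0, d))) (at z)"
      by (auto intro!: derivative_eq_intros simp: zero_prod_def)
    have "h' (x, y, z) (1, 0, 0) * d = h' (x, y, z) (d, 0, 0)"
      "h' (x, y, z) (0, 1, 0) * d = h' (x, y, z) (0, d, 0)"
      "h' (x, y, z) (0, 0, 1) * d = h' (x, y, z) (0, 0, d)" for d
      using scaleR[of d "(1, 0, 0)"] scaleR[of d "(0, 1, 0)"] scaleR[of d "(0, 0, 1)"] by simp_all
    note scale = this[THEN ext]
    show "deriv (\<lambda>x. h x y z) x = h' (x, y, z) (1, 0, 0)"
      "deriv (\<lambda>y. h x y z) y = h' (x, y, z) (0, 1, 0)"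
      "deriv (\<lambda>z. h x y z) z = h' (x, y, z) (0, 0, 1)"
      using has_derivative_compose[OF 1, of "\<lambda>(x, y, z). h x y z", OF D]
        has_derivative_compose[OF 2, of "\<lambda>(x, y, z). h x y z", OF D]
        has_derivative_compose[OF 3, of "\<lambda>(x, y, z). h x y z", OF D]
      by (simp_all add: DERIV_imp_deriv has_field_derivative_def scale)
  qed
  show "((\<lambda>(x, y, z). h x y z) has_derivative
      (\<lambda>(d, d', d''). deriv (\<lambda>x. h x y z) x * d + deriv (\<lambda>y. h x y z) y * d'
        + deriv (\<lambda>z. h x y z) z * d'')) (at (x, y, z))" if x: "x \<in> {0<..<\<R>}"
  proof -
    interpret bounded_linear "h' (x, y, z)" by (rule has_derivative_bounded_linear[OF D[OF x]])
    have eq: "h' (x, y, z) (d, d', d'') = h' (x, y, z) (1, 0, 0) * d + h' (x, y, z) (0, 1, 0) * d'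
        + h' (x, y, z) (0, 0, 1) * d''" for d d' d''
      using scaleR[of d "(1, 0, 0)"] scaleR[of d' "(0, 1, 0)"] scaleR[of d'' "(0, 0, 1)"]
        add[of "(d, 0, 0)" "(0, d', 0)"] add[of "(d, d', 0)" "(0, 0, d'')"] by simp
    have "h' (x, y, z) = (\<lambda>(d, d', d''). deriv (\<lambda>x. h x y z) x * d
        + deriv (\<lambda>y. h x y z) y * d' + deriv (\<lambda>z. h x y z) z * d'')"
      unfolding partials[OF x] by (intro ext, simp only: split_paired_all prod.case, rule eq)
    then show ?thesis using D[OF x, of y z] by (simp only:)
  qed
  have c: "continuous_on ({0<..<\<R>} \<times> UNIV \<times> UNIV) (\<lambda>w. h' w v)" for v
    by (rule continuous_on_subset[OF cont]) auto
  show "continuous_on ({0<..<\<R>} \<times> UNIV \<times> UNIV) (\<lambda>(x, y, z). deriv (\<lambda>x. h x y z) x)"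
    by (rule continuous_on_eq[OF c[of "(1, 0, 0)"]]) (auto simp: partials)
  show "continuous_on ({0<..<\<R>} \<times> UNIV \<times> UNIV) (\<lambda>(x, y, z). deriv (\<lambda>y. h x y z) y)"
    by (rule continuous_on_eq[OF c[of "(0, 1, 0)"]]) (auto simp: partials)
  show "continuous_on ({0<..<\<R>} \<times> UNIV \<times> UNIV) (\<lambda>(x, y, z). deriv (\<lambda>z. h x y z) z)"
    by (rule continuous_on_eq[OF c[of "(0, 0, 1)"]]) (auto simp: partials)
qed

lemma smooth_on_partials4:
  fixes h :: "real \<Rightarrow> real \<Rightarrow> real \<Rightarrow> real \<Rightarrow> real"
  assumes "smooth_on (\<lambda>(x, y, z, t). h x y z t) ({0<..\<R>} \<times> UNIV \<times> UNIV \<times> {0<..})"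
  shows "x \<in> {0<..<\<R>} \<Longrightarrow> t > 0 \<Longrightarrow>
      ((\<lambda>x. h x y z t) has_real_derivative deriv (\<lambda>x. h x y z t) x) (at x)"
    and "x \<in> {0<..<\<R>} \<Longrightarrow> t > 0 \<Longrightarrow>
      ((\<lambda>y. h x y z t) has_real_derivative deriv (\<lambda>y. h x y z t) y) (at y)"
    and "continuous_on ({0<..<\<R>} \<times> UNIV \<times> UNIV \<times> {0<..})
      (\<lambda>(x, y, z, t). deriv (\<lambda>x. h x y z t) x)"
    and "continuous_on ({0<..<\<R>} \<times> UNIV \<times> UNIV \<times> {0<..})
      (\<lambda>(x, y, z, t). deriv (\<lambda>y. h x y z t) y)"
proof -
  let ?D = "{0<..\<R>} \<times> (UNIV :: real set) \<times> (UNIV :: real set) \<times> {0::real<..}"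
  obtain h' where h': "\<And>w. w \<in> ?D \<Longrightarrow>
      ((\<lambda>(x, y, z, t). h x y z t) has_derivative h' w) (at w within ?D)"
    and cont: "\<And>v. continuous_on ?D (\<lambda>w. h' w v)"
    using smooth_on_derivative[OF assms] by blast
  have at: "((\<lambda>x. h x y z t) has_real_derivative h' (x, y, z, t) (1, 0, 0, 0)) (at x)"
    "((\<lambda>y. h x y z t) has_real_derivative h' (x, y, z, t) (0, 1, 0, 0)) (at y)"
    if "x \<in> {0<..<\<R>}" "t > 0" for x y z t
  proof -
    have "at (x, y, z, t) within ?D = at (x, y, z, t)"
      by (rule at_within_open_subset[of _ "{0<..<\<R>} \<times> UNIV \<times> UNIV \<times> {0<..}"])
        (use that in \<open>auto intro!: open_Times\<close>)
    then have D: "((\<lambda>(x, y, z, t). h x y z t) has_derivative h' (x, y, z, t)) (at (x, y, z, t))"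
      using h'[of "(x, y, z, t)"] that by auto
    interpret bounded_linear "h' (x, y, z, t)" by (rule has_derivative_bounded_linear[OF D])
    have 1: "((\<lambda>x. (x, y, z, t)) has_derivative (\<lambda>d. (d, 0, 0, 0))) (at x)"
      and 2: "((\<lambda>y. (x, y, z, t)) has_derivative (\<lambda>d. (0, d, 0, 0))) (at y)"
      by (auto intro!: derivative_eq_intros simp: zero_prod_def)
    have "h' (x, y, z, t) (1, 0, 0, 0) * d = h' (x, y, z, t) (d, 0, 0, 0)"
      "h' (x, y, z, t) (0, 1, 0, 0) * d = h' (x, y, z, t) (0, d, 0, 0)" for d
      using scaleR[of d "(1, 0, 0, 0)"] scaleR[of d "(0, 1, 0, 0)"] by simp_all
    note scale = this[THEN ext]
    show "((\<lambda>x. h x y z t) has_real_derivative h' (x, y, z, t) (1, 0, 0, 0)) (at x)"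
      "((\<lambda>y. h x y z t) has_real_derivative h' (x, y, z, t) (0, 1, 0, 0)) (at y)"
      using has_derivative_compose[OF 1, of "\<lambda>(x, y, z, t). h x y z t", OF D]
        has_derivative_compose[OF 2, of "\<lambda>(x, y, z, t). h x y z t", OF D]
      by (simp_all add: has_field_derivative_def scale)
  qed
  show "x \<in> {0<..<\<R>} \<Longrightarrow> t > 0 \<Longrightarrow>
      ((\<lambda>x. h x y z t) has_real_derivative deriv (\<lambda>x. h x y z t) x) (at x)"
    "x \<in> {0<..<\<R>} \<Longrightarrow> t > 0 \<Longrightarrow>
      ((\<lambda>y. h x y z t) has_real_derivative deriv (\<lambda>y. h x y z t) y) (at y)"
    using at DERIV_imp_deriv by metis+
  have c: "continuous_on ({0<..<\<R>} \<times> UNIV \<times> UNIV \<times> {0<..}) (\<lambda>w. h' w v)" for v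
    by (rule continuous_on_subset[OF cont]) auto
  show "continuous_on ({0<..<\<R>} \<times> UNIV \<times> UNIV \<times> {0<..})
      (\<lambda>(x, y, z, t). deriv (\<lambda>x. h x y z t) x)"
    by (rule continuous_on_eq[OF c[of "(1, 0, 0, 0)"]]) (auto simp: at[THEN DERIV_imp_deriv])
  show "continuous_on ({0<..<\<R>} \<times> UNIV \<times> UNIV \<times> {0<..})
      (\<lambda>(x, y, z, t). deriv (\<lambda>y. h x y z t) y)"
    by (rule continuous_on_eq[OF c[of "(0, 1, 0, 0)"]]) (auto simp: at[THEN DERIV_imp_deriv])
qed

section \<open>Uniform bounds from periodicity and compactness\<close>

text \<open>The codomain is arbitrary so that \<open>P\<close> may take functions as values; one
  representative \<open>y'\<close> then serves all radii at once. The period may be negative, as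
  \<open>2 * pi * \<nu>\<close> is for negative \<nu>.\<close>

lemma periodic_reduce:
  fixes P :: "real \<Rightarrow> 'c"
  assumes per: "\<And>y. P (y + p) = P y" and "p \<noteq> 0"
  obtains y' where "\<bar>y'\<bar> \<le> \<bar>p\<bar>" "P y' = P y"
proof
  have nat: "P (y + real k * p) = P y" for k y
  proof (induction k)
    case (Suc k)
    then show ?case using per[of "y + real k * p"] by (simp add: algebra_simps)
  qed simp
  have int: "P (y + of_int k * p) = P y" for k y
  proof (cases "k \<ge> 0")
    case True
    then show ?thesis using nat[of y "nat k"] by simp
  next
    case False
    then show ?thesis using nat[of "y + of_int k * p" "nat (- k)"] by simp
  qed
  show "P (y - of_int \<lfloor>y / p\<rfloor> * p) = P y"
    using int[of y "- \<lfloor>y / p\<rfloor>"] by simp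
  have "y - of_int \<lfloor>y / p\<rfloor> * p = frac (y / p) * p"
    using \<open>p \<noteq> 0\<close> by (simp add: frac_def field_simps)
  moreover have "frac (y / p) * \<bar>p\<bar> \<le> \<bar>p\<bar>"
    using frac_lt_1[of "y / p"] by (intro mult_left_le_one_le) (auto simp: less_imp_le)
  ultimately show "\<bar>y - of_int \<lfloor>y / p\<rfloor> * p\<bar> \<le> \<bar>p\<bar>"
    by (simp add: abs_mult)
qed

lemma deriv_periodic:
  assumes "\<And>y. P (y + p) = P y"
  shows "deriv P (y + p) = deriv P y"
  unfolding deriv_def DERIV_shift assms ..

text \<open>The first argument ranges over an abstract compact set because it will stand for pairs:
  a radius with the second phase, or a radius with a time.\<close>

lemma periodic_bounded:
  fixes h :: "'p::t2_space \<Rightarrow> real \<Rightarrow> real"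
  assumes "compact K" and cont: "continuous_on (K \<times> UNIV) (\<lambda>(x, y). h x y)"
    and per: "\<And>x y. x \<in> K \<Longrightarrow> h x (y + p) = h x y" and "p \<noteq> 0"
  obtains B where "\<And>x y. x \<in> K \<Longrightarrow> \<bar>h x y\<bar> \<le> B"
proof -
  have "compact ((\<lambda>(x, y). h x y) ` (K \<times> {- \<bar>p\<bar>..\<bar>p\<bar>}))"
    by (intro compact_continuous_image compact_Times continuous_on_subset[OF cont])
      (use \<open>compact K\<close> in auto)
  from compact_imp_bounded[OF this] obtain B
    where B: "\<And>x y. x \<in> K \<Longrightarrow> \<bar>y\<bar> \<le> \<bar>p\<bar> \<Longrightarrow> \<bar>h x y\<bar> \<le> B"
    unfolding bounded_iff by (fastforce simp: abs_le_iff)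
  have "\<bar>h x y\<bar> \<le> B" if x: "x \<in> K" for x y
  proof -
    obtain y' where "\<bar>y'\<bar> \<le> \<bar>p\<bar>" "h x y' = h x y"
      using periodic_reduce[of "h x" p, OF per[OF x] \<open>p \<noteq> 0\<close>] .
    with B[OF x, of y'] show ?thesis by simp
  qed
  then show ?thesis using that by blast
qed

lemma periodic_bounded2:
  fixes h :: "real \<Rightarrow> real \<Rightarrow> real \<Rightarrow> real"
  assumes cont: "continuous_on ({0<..<\<R>} \<times> UNIV \<times> UNIV) (\<lambda>(x, y, z). h x y z)"
    and "0 < a" "b < \<R>" "p \<noteq> 0" "p' \<noteq> 0"
    and per: "\<And>x y z. x \<in> {0<..<\<R>} \<Longrightarrow> h x (y + p) z = h x y z"
      "\<And>x y z. x \<in> {0<..<\<R>} \<Longrightarrow> h x y (z + p') = h x y z"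
  shows "\<exists>B. \<forall>x\<in>{a..b}. \<forall>y z. \<bar>h x y z\<bar> \<le> B"
proof -
  have ab: "x \<in> {0<..<\<R>}" if "x \<in> {a..b}" for x using that assms(2,3) by auto
  have "continuous_on (({a..b} \<times> {- \<bar>p'\<bar>..\<bar>p'\<bar>}) \<times> UNIV)
      (\<lambda>w. case (fst (fst w), snd w, snd (fst w)) of (x, y, z) \<Rightarrow> h x y z)"
    by (rule continuous_on_compose2[OF cont]) (use ab in \<open>auto intro!: continuous_intros\<close>)
  then have "continuous_on (({a..b} \<times> {- \<bar>p'\<bar>..\<bar>p'\<bar>}) \<times> UNIV)
      (\<lambda>(w, y). h (fst w) y (snd w))"
    by (simp add: case_prod_unfold)
  then obtain B where B: "\<And>w y. w \<in> {a..b} \<times> {- \<bar>p'\<bar>..\<bar>p'\<bar>} \<Longrightarrow> \<bar>h (fst w) y (snd w)\<bar> \<le> B"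
    by (rule periodic_bounded[of "{a..b} \<times> {- \<bar>p'\<bar>..\<bar>p'\<bar>}" _ p, rotated])
      (use per(1) ab \<open>p \<noteq> 0\<close> in \<open>auto intro!: compact_Times\<close>)
  have "\<bar>h x y z\<bar> \<le> B" if x: "x \<in> {a..b}" for x y z
  proof -
    obtain z' where "\<bar>z'\<bar> \<le> \<bar>p'\<bar>" "h x y z' = h x y z"
      using periodic_reduce[of "h x y" p', OF per(2)[OF ab[OF x]] \<open>p' \<noteq> 0\<close>] .
    with B[of "(x, z')" y] x show ?thesis by (auto simp: abs_le_iff)
  qed
  then show ?thesis by blast
qed

text \<open>Each partial derivative inherits both periods: in its own variable by a shift of the
  difference quotient, in the others because the differentiated functions coincide. For the radial
  derivative they coincide only near the point, whence the neighbourhood \<open>nhd\<close>.\<close>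

lemma smooth_periodic3_bounds:
  assumes h: "smooth_periodic3 \<R> p p' h" and "0 < a" "b < \<R>" "p \<noteq> 0" "p' \<noteq> 0"
  shows "\<exists>B. \<forall>x\<in>{a..b}. \<forall>y z. \<bar>h x y z\<bar> \<le> B"
    and "\<exists>B. \<forall>x\<in>{a..b}. \<forall>y z. \<bar>deriv (\<lambda>x. h x y z) x\<bar> \<le> B"
    and "\<exists>B. \<forall>x\<in>{a..b}. \<forall>y z. \<bar>deriv (\<lambda>y. h x y z) y\<bar> \<le> B"
    and "\<exists>B. \<forall>x\<in>{a..b}. \<forall>y z. \<bar>deriv (\<lambda>z. h x y z) z\<bar> \<le> B"
proof -
  have sm: "smooth_on (\<lambda>(x, y, z). h x y z) ({0<..\<R>} \<times> UNIV \<times> UNIV)"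
    and per: "\<And>x y z. x \<in> {0<..<\<R>} \<Longrightarrow> h x (y + p) z = h x y z"
      "\<And>x y z. x \<in> {0<..<\<R>} \<Longrightarrow> h x y (z + p') = h x y z"
    using h by (auto simp: smooth_periodic3_def)
  note b = periodic_bounded2[OF _ assms(2-5)]
  have nhd: "\<forall>\<^sub>F x in nhds x. x \<in> {0<..<\<R>}" if "x \<in> {0<..<\<R>}" for x
    using that by (intro eventually_nhds_in_open) auto
  show "\<exists>B. \<forall>x\<in>{a..b}. \<forall>y z. \<bar>h x y z\<bar> \<le> B"
    by (intro b per continuous_on_subset[OF smooth_on_continuous[OF sm]]) auto
  show "\<exists>B. \<forall>x\<in>{a..b}. \<forall>y z. \<bar>deriv (\<lambda>x. h x y z) x\<bar> \<le> B"
    by (intro b smooth_on_partials3[OF sm] deriv_cong_ev eventually_mono[OF nhd] per) auto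
  show "\<exists>B. \<forall>x\<in>{a..b}. \<forall>y z. \<bar>deriv (\<lambda>y. h x y z) y\<bar> \<le> B"
  proof (intro b smooth_on_partials3[OF sm])
    fix x y z assume x: "x \<in> {0<..<\<R>}"
    show "deriv (\<lambda>y. h x y z) (y + p) = deriv (\<lambda>y. h x y z) y"
      by (rule deriv_periodic) (rule per[OF x])
    show "deriv (\<lambda>y. h x y (z + p')) y = deriv (\<lambda>y. h x y z) y"
      by (simp add: per[OF x])
  qed
  show "\<exists>B. \<forall>x\<in>{a..b}. \<forall>y z. \<bar>deriv (\<lambda>z. h x y z) z\<bar> \<le> B"
  proof (intro b smooth_on_partials3[OF sm])
    fix x y z assume x: "x \<in> {0<..<\<R>}"
    show "deriv (\<lambda>z. h x (y + p) z) z = deriv (\<lambda>z. h x y z) z"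
      by (simp add: per[OF x])
    show "deriv (\<lambda>z. h x y z) (z + p') = deriv (\<lambda>z. h x y z) z"
      by (rule deriv_periodic) (rule per[OF x])
  qed
qed

text \<open>The minimum of \<open>h x0\<close> over one period is positive, and uniform continuity
  on a compact box loses at most half of it, simultaneously for all angles, on a thin enough strip
  around \<open>x0\<close>.\<close>

lemma periodic_lower_bound:
  fixes h :: "real \<Rightarrow> real \<Rightarrow> real"
  assumes cont: "continuous_on ({0<..<\<R>} \<times> UNIV) (\<lambda>(x, y). h x y)"
    and per: "\<And>x y. x \<in> {0<..<\<R>} \<Longrightarrow> h x (y + p) = h x y" and "p \<noteq> 0"
    and x0: "x0 \<in> {0<..<\<R>}" and pos: "\<And>y. h x0 y > 0"
  obtains c d where "c > 0" "d > 0" "{x0 - d..x0 + d} \<subseteq> {0<..<\<R>}"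
    and "\<And>x y. x \<in> {x0 - d..x0 + d} \<Longrightarrow> c \<le> h x y"
proof -
  define d0 where "d0 = min x0 (\<R> - x0) / 2"
  have "0 < d0" "d0 < x0" "d0 < \<R> - x0"
    using x0 by (simp_all add: d0_def min_def)
  then have d0: "d0 > 0" "{x0 - d0..x0 + d0} \<subseteq> {0<..<\<R>}" by auto
  define I where "I = {- \<bar>p\<bar>..\<bar>p\<bar>}"
  define K where "K = {x0 - d0..x0 + d0} \<times> I"
  have K: "compact K" "K \<subseteq> {0<..<\<R>} \<times> UNIV" and "compact I" "I \<noteq> {}"
    using d0(2) by (auto simp: K_def I_def intro!: compact_Times)
  have "continuous_on I (\<lambda>y. case (x0, y) of (x, y) \<Rightarrow> h x y)"
    by (rule continuous_on_compose2[OF cont]) (use x0 in \<open>auto intro!: continuous_intros\<close>)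
  then have "continuous_on I (h x0)" by simp
  then obtain y0 where y0: "\<And>y. y \<in> I \<Longrightarrow> h x0 y0 \<le> h x0 y"
    using continuous_attains_inf[OF \<open>compact I\<close> \<open>I \<noteq> {}\<close>] by blast
  define c where "c = h x0 y0 / 2"
  have "c > 0" using pos by (simp add: c_def)
  have "uniformly_continuous_on K (\<lambda>(x, y). h x y)"
    by (rule compact_uniformly_continuous[OF continuous_on_subset[OF cont K(2)] K(1)])
  then obtain d1 where "d1 > 0" and d1: "\<And>w w'. w \<in> K \<Longrightarrow> w' \<in> K \<Longrightarrow> dist w' w < d1 \<Longrightarrow>
      dist (case w' of (x, y) \<Rightarrow> h x y) (case w of (x, y) \<Rightarrow> h x y) < c"
    using \<open>c > 0\<close> unfolding uniformly_continuous_on_def by meson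
  define d where "d = min d0 (d1 / 2)"
  have d: "d > 0" "d \<le> d0" "d < d1" using d0 \<open>d1 > 0\<close> by (auto simp: d_def min_def)
  have "c \<le> h x y" if x: "x \<in> {x0 - d..x0 + d}" for x y
  proof -
    \<comment> \<open>Periodicity is known only for radii in the open interval. Extension by zero
      makes the function-valued \<open>P\<close> periodic, so that the same \<open>y'\<close> can be
      used at \<open>x\<close> and at \<open>x0\<close>.\<close>
    define P where "P y = (\<lambda>x. if x \<in> {0<..<\<R>} then h x y else 0)" for y
    obtain y' where "\<bar>y'\<bar> \<le> \<bar>p\<bar>" and "P y' = P y"
      by (rule periodic_reduce[of P p]) (use per \<open>p \<noteq> 0\<close> in \<open>auto simp: P_def fun_eq_iff\<close>)
    have y': "y' \<in> I" and eq: "h x y' = h x y" if "x \<in> {0<..<\<R>}" for x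
      using that \<open>\<bar>y'\<bar> \<le> \<bar>p\<bar>\<close> fun_cong[OF \<open>P y' = P y\<close>, of x] by (auto simp: I_def abs_le_iff P_def)
    have "x \<in> {x0 - d0..x0 + d0}" using x d(2) by auto
    then have "x \<in> {0<..<\<R>}" using d0(2) by blast
    have "dist (h x y') (h x0 y') < c"
      using d1[of "(x0, y')" "(x, y')"] x d y'[OF x0] d0 by (auto simp: K_def dist_Pair_Pair dist_real_def)
    then have "h x y' \<ge> h x0 y' - c" by (auto simp: dist_real_def)
    also have "h x0 y' - c \<ge> c" using y0[OF y'[OF x0]] by (simp add: c_def)
    finally show ?thesis using eq[OF \<open>x \<in> {0<..<\<R>}\<close>] by simp
  qed
  moreover have "{x0 - d..x0 + d} \<subseteq> {x0 - d0..x0 + d0}"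
    using d(2) by auto
  ultimately show ?thesis using that[OF \<open>c > 0\<close> \<open>d > 0\<close>] d0(2) by blast
qed

text \<open>By the mean value theorem \<open>L x y\<close> is \<open>x - x0\<close> times a radial
  derivative at an intermediate radius, where \<sigma> times the derivative still exceeds
  \<open>c\<close>. The factor \<open>x - x0\<close> in the conclusion treats both sides of
  \<open>x0\<close> at once, and \<sigma> covers the attracting and the repelling case.\<close>

lemma smooth_periodic2_linear_bound:
  assumes L: "smooth_periodic2 \<R> L" and x0: "x0 \<in> {0<..<\<R>}" and zero: "\<And>y. L x0 y = 0"
    and pos: "\<And>y. \<sigma> * deriv (\<lambda>x. L x y) x0 > 0"
  obtains c d where "c > 0" "d > 0" "{x0 - d..x0 + d} \<subseteq> {0<..<\<R>}"
    and "\<And>x y. x \<in> {x0 - d..x0 + d} \<Longrightarrow> c * (x - x0)\<^sup>2 \<le> \<sigma> * L x y * (x - x0)"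
proof -
  have sm: "smooth_on (\<lambda>(x, y). L x y) ({0<..\<R>} \<times> UNIV)"
    and per: "\<And>x y. x \<in> {0<..<\<R>} \<Longrightarrow> L x (y + 2 * pi) = L x y"
    using L by (auto simp: smooth_periodic2_def)
  have nhd: "\<forall>\<^sub>F x in nhds x. x \<in> {0<..<\<R>}" if "x \<in> {0<..<\<R>}" for x
    using that by (intro eventually_nhds_in_open) auto
  let ?h = "\<lambda>x y. \<sigma> * deriv (\<lambda>x. L x y) x"
  have cont: "continuous_on ({0<..<\<R>} \<times> UNIV) (\<lambda>(x, y). ?h x y)"
    using continuous_on_mult_left[OF smooth_on_partials2(2)[OF sm]] by (simp add: case_prod_unfold)
  have per': "?h x (y + 2 * pi) = ?h x y" if "x \<in> {0<..<\<R>}" for x y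
    using deriv_cong_ev[OF eventually_mono[OF nhd[OF that] per] refl] by simp
  obtain c d where cd: "c > 0" "d > 0" "{x0 - d..x0 + d} \<subseteq> {0<..<\<R>}"
    and h: "\<And>x y. x \<in> {x0 - d..x0 + d} \<Longrightarrow> c \<le> ?h x y"
    by (rule periodic_lower_bound[OF cont per' _ x0 pos]) auto
  have "c * (x - x0)\<^sup>2 \<le> \<sigma> * L x y * (x - x0)" if x: "x \<in> {x0 - d..x0 + d}" for x y
  proof (cases "x = x0")
    case False
    have der: "((\<lambda>x. L x y) has_real_derivative deriv (\<lambda>x. L x y) z) (at z)"
      if "z \<in> {x0 - d..x0 + d}" for z
      using smooth_on_partials2(1)[OF sm] cd(3) that by blast
    obtain z where z: "z \<in> {x0 - d..x0 + d}"
      and eq: "L x y = (x - x0) * deriv (\<lambda>x. L x y) z"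
    proof (cases "x < x0")
      case True
      have "\<exists>z>x. z < x0 \<and> L x0 y - L x y = (x0 - x) * deriv (\<lambda>x. L x y) z"
        by (rule MVT2[OF True der]) (use x \<open>d > 0\<close> in auto)
      then obtain z where "x < z" "z < x0" "L x0 y - L x y = (x0 - x) * deriv (\<lambda>x. L x y) z"
        by blast
      then show ?thesis
        using x \<open>d > 0\<close> zero[of y] by (intro that[of z]) (auto simp: algebra_simps)
    next
      case False
      then have "x0 < x" using \<open>x \<noteq> x0\<close> by simp
      have "\<exists>z>x0. z < x \<and> L x y - L x0 y = (x - x0) * deriv (\<lambda>x. L x y) z"
        by (rule MVT2[OF \<open>x0 < x\<close> der]) (use x \<open>d > 0\<close> in auto)
      then obtain z where "x0 < z" "z < x" "L x y - L x0 y = (x - x0) * deriv (\<lambda>x. L x y) z"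
        by blast
      then show ?thesis
        using x \<open>d > 0\<close> zero[of y] by (intro that[of z]) auto
    qed
    have "c * (x - x0)\<^sup>2 \<le> ?h z y * (x - x0)\<^sup>2"
      using h[OF z] by (intro mult_right_mono) auto
    then show ?thesis by (subst eq) (simp add: power2_eq_square mult_ac)
  qed simp
  with cd that show ?thesis by blast
qed

section \<open>Asymptotic expansions along a solution\<close>

lemma smooth_on_chain_rule3:
  fixes h :: "real \<Rightarrow> real \<Rightarrow> real \<Rightarrow> real"
  assumes h: "smooth_on (\<lambda>(x, y, z). h x y z) ({0<..\<R>} \<times> UNIV \<times> UNIV)"
    and "x t \<in> {0<..<\<R>}"
    and x: "(x has_real_derivative x') (at t within I)"
    and y: "(y has_real_derivative y') (at t within I)"
    and z: "(z has_real_derivative z') (at t within I)"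
  shows "((\<lambda>t. h (x t) (y t) (z t)) has_real_derivative
      deriv (\<lambda>r. h r (y t) (z t)) (x t) * x' + deriv (\<lambda>r. h (x t) r (z t)) (y t) * y'
        + deriv (\<lambda>r. h (x t) (y t) r) (z t) * z') (at t within I)"
proof -
  have "((\<lambda>t. (x t, y t, z t)) has_derivative (\<lambda>d. (x' * d, y' * d, z' * d))) (at t within I)"
    using x y z by (auto simp: has_field_derivative_def intro!: has_derivative_Pair)
  note D = has_derivative_compose[OF this smooth_on_partials3(1)[OF h \<open>x t \<in> {0<..<\<R>}\<close>]]
  show ?thesis
    by (rule has_derivative_imp_has_field_derivative[OF D[unfolded prod.case]])
      (simp add: algebra_simps)
qed

section \<open>Landau calculus for uniform expansions\<close>

text \<open>This translates between Landau symbols and uniform estimates: along this product filter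
  the threshold \<open>T\<close> does not depend on the point of \<open>A\<close>.\<close>

lemma eventually_principal_times_at_top:
  "eventually P (principal A \<times>\<^sub>F (at_top :: real filter))
    \<longleftrightarrow> (\<exists>T. \<forall>x\<in>A. \<forall>t\<ge>T. P (x, t))"
  unfolding eventually_prod_filter eventually_principal eventually_at_top_linorder
proof
  show "\<exists>T. \<forall>x\<in>A. \<forall>t\<ge>T. P (x, t)"
    if "\<exists>Pf Pg. (\<forall>x\<in>A. Pf x) \<and> (\<exists>N. \<forall>n\<ge>N. Pg n) \<and> (\<forall>x y. Pf x \<longrightarrow> Pg y \<longrightarrow> P (x, y))"
    using that by blast
  assume "\<exists>T. \<forall>x\<in>A. \<forall>t\<ge>T. P (x, t)"
  then obtain T where "\<forall>x\<in>A. \<forall>t\<ge>T. P (x, t)" ..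
  then show "\<exists>Pf Pg. (\<forall>x\<in>A. Pf x) \<and> (\<exists>N. \<forall>n\<ge>N. Pg n) \<and> (\<forall>x y. Pf x \<longrightarrow> Pg y \<longrightarrow> P (x, y))"
    by (intro exI[of _ "\<lambda>x. x \<in> A"] exI[of _ "\<lambda>t. t \<ge> T"]) auto
qed

text \<open>With truncations \<open>A\<close> and \<open>B\<close>,
  \<open>a * b - A * B = (a - A) * b + A * (b - B)\<close> is of order \<open>X^(N+1)\<close>, as
  \<open>b\<close> and \<open>A\<close> are bounded. The products of degree above \<open>N\<close>
  in \<open>A * B\<close> are of that order too, since the surplus powers of \<open>X\<close> are
  bounded. The coefficients vary with the point, so boundedness along the filter replaces
  constancy.\<close>

lemma bigo_Cauchy_product:
  fixes X a b :: "'c \<Rightarrow> real" and \<alpha> \<beta> :: "nat \<Rightarrow> 'c \<Rightarrow> real"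
  assumes X: "X \<in> O[F](\<lambda>_. 1)"
    and \<alpha>: "\<And>i. i \<le> N \<Longrightarrow> \<alpha> i \<in> O[F](\<lambda>_. 1)" and \<beta>: "\<And>i. i \<le> N \<Longrightarrow> \<beta> i \<in> O[F](\<lambda>_. 1)"
    and a: "(\<lambda>w. a w - (\<Sum>i\<le>N. \<alpha> i w * X w ^ i)) \<in> O[F](\<lambda>w. X w ^ (N + 1))"
    and b: "(\<lambda>w. b w - (\<Sum>i\<le>N. \<beta> i w * X w ^ i)) \<in> O[F](\<lambda>w. X w ^ (N + 1))"
  shows "(\<lambda>w. a w * b w - (\<Sum>k\<le>N. (\<Sum>i\<le>k. \<alpha> i w * \<beta> (k - i) w) * X w ^ k))
      \<in> O[F](\<lambda>w. X w ^ (N + 1))"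
proof -
  have Xp: "(\<lambda>w. X w ^ k) \<in> O[F](\<lambda>_. 1)" for k
    using landau_o.big_power[OF X, of k] by simp
  have poly: "(\<lambda>w. \<Sum>i\<le>N. c i w * X w ^ i) \<in> O[F](\<lambda>_. 1)"
    if "\<And>i. i \<le> N \<Longrightarrow> c i \<in> O[F](\<lambda>_. 1)" for c :: "nat \<Rightarrow> 'c \<Rightarrow> real"
    by (rule big_sum_in_bigo) (use landau_o.big.mult[OF that Xp] in auto)
  let ?A = "\<lambda>w. \<Sum>i\<le>N. \<alpha> i w * X w ^ i" and ?B = "\<lambda>w. \<Sum>i\<le>N. \<beta> i w * X w ^ i"
  let ?t = "\<lambda>w (i, j). \<alpha> i w * \<beta> j w * X w ^ (i + j)"
  let ?low = "{(i, j). i + j \<le> N}"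
  have "(\<lambda>w. (b w - ?B w) + ?B w) \<in> O[F](\<lambda>_. 1)"
    by (intro sum_in_bigo poly \<beta> landau_o.big.trans[OF b Xp])
  then have b1: "b \<in> O[F](\<lambda>_. 1)" by simp
  have "(\<lambda>w. \<Sum>p\<in>{..N} \<times> {..N} - ?low. ?t w p) \<in> O[F](\<lambda>w. X w ^ (N + 1))"
  proof (rule big_sum_in_bigo)
    fix p assume p: "p \<in> {..N} \<times> {..N} - ?low"
    then obtain i j where ij: "p = (i, j)" "i \<le> N" "j \<le> N" "i + j \<ge> N + 1" by auto
    then have "i + j = (i + j - N - 1) + (N + 1)" by simp
    then have "?t w p = (\<alpha> i w * \<beta> j w * X w ^ (i + j - N - 1)) * X w ^ (N + 1)" for w
      using ij by (metis (no_types, lifting) case_prod_conv mult.assoc power_add)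
    moreover have "(\<lambda>w. (\<alpha> i w * \<beta> j w * X w ^ (i + j - N - 1)) * X w ^ (N + 1))
        \<in> O[F](\<lambda>w. (1 * 1 * 1) * X w ^ (N + 1))"
      by (intro landau_o.big.mult \<alpha> \<beta> ij Xp) auto
    ultimately show "(\<lambda>w. ?t w p) \<in> O[F](\<lambda>w. X w ^ (N + 1))" by simp
  qed
  moreover have "(\<lambda>w. (a w - ?A w) * b w) \<in> O[F](\<lambda>w. X w ^ (N + 1) * 1)"
    by (intro landau_o.big.mult a b1)
  moreover have "(\<lambda>w. ?A w * (b w - ?B w)) \<in> O[F](\<lambda>w. 1 * X w ^ (N + 1))"
    by (intro landau_o.big.mult b poly \<alpha>)
  ultimately have "(\<lambda>w. (a w - ?A w) * b w + ?A w * (b w - ?B w)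
      + (\<Sum>p\<in>{..N} \<times> {..N} - ?low. ?t w p)) \<in> O[F](\<lambda>w. X w ^ (N + 1))"
    by (intro sum_in_bigo) simp_all
  moreover have "(a w - ?A w) * b w + ?A w * (b w - ?B w) + (\<Sum>p\<in>{..N} \<times> {..N} - ?low. ?t w p)
      = a w * b w - (\<Sum>k\<le>N. (\<Sum>i\<le>k. \<alpha> i w * \<beta> (k - i) w) * X w ^ k)" for w
  proof -
    have sub: "?low \<subseteq> {..N} \<times> {..N}" by auto
    have "?A w * ?B w = (\<Sum>p\<in>{..N} \<times> {..N}. ?t w p)"
      by (simp add: sum_product sum.cartesian_product power_add mult_ac case_prod_unfold)
    moreover have "(\<Sum>p\<in>{..N} \<times> {..N} - ?low. ?t w p)
        = (\<Sum>p\<in>{..N} \<times> {..N}. ?t w p) - (\<Sum>p\<in>?low. ?t w p)"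
      by (rule sum_diff) (use sub in auto)
    moreover have "(\<Sum>p\<in>?low. ?t w p) = (\<Sum>k\<le>N. (\<Sum>i\<le>k. \<alpha> i w * \<beta> (k - i) w) * X w ^ k)"
      by (subst sum.triangle_reindex_eq) (simp add: sum_distrib_right)
    ultimately show ?thesis by (simp add: algebra_simps)
  qed
  ultimately show ?thesis by simp
qed

lemma powr_neg_frac: "t > 0 \<Longrightarrow> t powr (- (real k / real q)) = (t powr (- (1 / real q))) ^ k"
  by (simp add: powr_powr flip: powr_realpow)

lemma fps_nth_formal_derivative:
  assumes "k \<le> q"
  shows "fps_nth (formal_derivative q s F G W R \<Psi> \<sigma>) k =
      (\<Sum>i\<le>k. (if i = 0 then 0 else F i R \<Psi> \<sigma>) * deriv (\<lambda>x. W (k - i) x \<Psi> \<sigma>) R)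
    + (\<Sum>i\<le>k. (if i = 0 then 0 else G i R \<Psi> \<sigma>) * deriv (\<lambda>x. W (k - i) R x \<sigma>) \<Psi>)
    + (\<Sum>i\<le>k. s i * deriv (\<lambda>x. W (k - i) R \<Psi> x) \<sigma>)"
proof -
  have zero: "fps_nth (fps_const c * fps_X ^ (q + 1) * A) k = 0" for c and A :: "real fps"
    using assms
    by (simp only: mult.assoc fps_mult_left_const_nth fps_X_power_mult_nth) simp
  show ?thesis
    unfolding formal_derivative_def fps_sub_nth fps_add_nth zero
    by (simp add: fps_tail_def fps_mult_nth atLeast0AtMost)
qed

locale resonant_system =
  fixes \<omega> \<R> :: real and q :: nat and \<kappa> \<nu> :: int
    and f g :: "real \<Rightarrow> real \<Rightarrow> real \<Rightarrow> real \<Rightarrow> real"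
    and fk gk :: "nat \<Rightarrow> real \<Rightarrow> real \<Rightarrow> real \<Rightarrow> real"
    and S :: "real \<Rightarrow> real" and s :: "nat \<Rightarrow> real"
  assumes q: "q \<ge> 1"
    and f: "smooth_periodic_rhs \<R> f" and g: "smooth_periodic_rhs \<R> g"
    and S: "smooth_on S {0<..}"
    and \<nu>: "\<nu> \<noteq> 0" and resonance: "of_int \<kappa> * s 0 = of_int \<nu> * \<omega>"
    and fk: "\<And>k. k \<ge> 1 \<Longrightarrow> smooth_periodic3 \<R> (2 * pi) (2 * pi) (fk k)"
    and gk: "\<And>k. k \<ge> 1 \<Longrightarrow> smooth_periodic3 \<R> (2 * pi) (2 * pi) (gk k)"
    and f_expansion: "asymptotic_expansion \<R> q f fk"
    and g_expansion: "asymptotic_expansion \<R> q g gk"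
    and S_expansion: "\<And>N. (\<lambda>t. deriv S t - (\<Sum>k = 0..N. t powr (- (real k / real q)) * s k))
      \<in> O[at_top](\<lambda>t. t powr (- (real (N + 1) / real q)))"
begin

abbreviation "c \<equiv> of_int \<kappa> / of_int \<nu> :: real"

text \<open>The expansions are handled as Landau classes on points \<open>w = ((R, \<Psi>, \<sigma>), t)\<close> along a filter
  that is principal in \<open>(R, \<Psi>, \<sigma>)\<close>, which encodes uniformity in these variables. The fast
  phase \<open>\<sigma>\<close> is kept independent of \<open>t\<close>; it becomes \<open>S t\<close> along a solution.\<close>

abbreviation rad :: "(real \<times> real \<times> real) \<times> real \<Rightarrow> real" where "rad w \<equiv> fst (fst w)"
abbreviation ang :: "(real \<times> real \<times> real) \<times> real \<Rightarrow> real" where "ang w \<equiv> fst (snd (fst w))"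
abbreviation fast :: "(real \<times> real \<times> real) \<times> real \<Rightarrow> real" where "fast w \<equiv> snd (snd (fst w))"
abbreviation X :: "(real \<times> real \<times> real) \<times> real \<Rightarrow> real" where "X w \<equiv> snd w powr (- (1 / real q))"
abbreviation Fl :: "real \<Rightarrow> real \<Rightarrow> ((real \<times> real \<times> real) \<times> real) filter"
  where "Fl a b \<equiv> principal ({a..b} \<times> UNIV) \<times>\<^sub>F at_top"

lemma S_has_derivative: "t > 0 \<Longrightarrow> (S has_real_derivative deriv S t) (at t)"
proof -
  assume "t > 0"
  obtain S' where "\<And>t. t \<in> {0<..} \<Longrightarrow> (S has_derivative S' t) (at t within {0<..})"
    using smooth_on_derivative[OF S] by blast
  then have "(S has_derivative S' t) (at t)"
    using \<open>t > 0\<close> by (metis at_within_open greaterThan_iff open_greaterThan)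
  then have "S differentiable at t" unfolding differentiable_def by blast
  then show ?thesis by (simp add: real_differentiable_def DERIV_deriv_iff_real_differentiable)
qed

lemma expansion_bigo:
  assumes h: "asymptotic_expansion \<R> q h hk" and "0 < a" "b < \<R>"
  shows "(\<lambda>w. h (rad w) (c * fast w + ang w) (fast w) (snd w)
      - (\<Sum>k\<le>N. (if k = 0 then 0 else hk k (rad w) (c * fast w + ang w) (fast w)) * X w ^ k))
    \<in> O[Fl a b](\<lambda>w. X w ^ (N + 1))"
proof (cases "a \<le> b")
  case True
  with assms have "a \<in> {0<..\<R>}" by auto
  then obtain C where "\<forall>\<^sub>F t in at_top. \<forall>\<rho>\<in>{a..\<R>}. \<forall>\<phi> S.
      \<bar>h \<rho> \<phi> S t - (\<Sum>k = 1..N. t powr (- (real k / real q)) * hk k \<rho> \<phi> S)\<bar>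
        \<le> C * t powr (- (real (N + 1) / real q))"
    using h unfolding asymptotic_expansion_def by meson
  with eventually_gt_at_top[of 0] have "\<forall>\<^sub>F t in at_top. t > 0 \<and> (\<forall>\<rho>\<in>{a..\<R>}. \<forall>\<phi> S.
      \<bar>h \<rho> \<phi> S t - (\<Sum>k = 1..N. t powr (- (real k / real q)) * hk k \<rho> \<phi> S)\<bar>
        \<le> C * t powr (- (real (N + 1) / real q)))"
    by (rule eventually_conj)
  then obtain T where "\<forall>t\<ge>T. t > 0 \<and> (\<forall>\<rho>\<in>{a..\<R>}. \<forall>\<phi> S.
      \<bar>h \<rho> \<phi> S t - (\<Sum>k = 1..N. t powr (- (real k / real q)) * hk k \<rho> \<phi> S)\<bar>
        \<le> C * t powr (- (real (N + 1) / real q)))"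
    unfolding eventually_at_top_linorder by (elim exE)
  then have T: "\<And>t. t \<ge> T \<Longrightarrow> t > 0" and est: "\<And>t \<rho> \<phi> S. t \<ge> T \<Longrightarrow> \<rho> \<in> {a..\<R>} \<Longrightarrow>
      \<bar>h \<rho> \<phi> S t - (\<Sum>k = 1..N. t powr (- (real k / real q)) * hk k \<rho> \<phi> S)\<bar>
        \<le> C * t powr (- (real (N + 1) / real q))"
    by blast+
  have "\<bar>h R (c * \<sigma> + \<Psi>) \<sigma> t
      - (\<Sum>k\<le>N. (if k = 0 then 0 else hk k R (c * \<sigma> + \<Psi>) \<sigma>) * (t powr (- (1 / real q))) ^ k)\<bar>
    \<le> C * \<bar>(t powr (- (1 / real q))) ^ (N + 1)\<bar>" if "R \<in> {a..b}" and t: "t \<ge> T" for R \<Psi> \<sigma> t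
  proof -
    have R: "R \<in> {a..\<R>}" using that \<open>b < \<R>\<close> by auto
    let ?X = "t powr (- (1 / real q))"
    have "(\<Sum>k\<le>N. (if k = 0 then 0 else hk k R (c * \<sigma> + \<Psi>) \<sigma>) * ?X ^ k)
        = (\<Sum>k = 1..N. t powr (- (real k / real q)) * hk k R (c * \<sigma> + \<Psi>) \<sigma>)"
      by (rule sum.mono_neutral_cong_right) (auto simp: powr_neg_frac[OF T[OF t]])
    then show ?thesis
      using est[OF t R, of "c * \<sigma> + \<Psi>" \<sigma>] powr_neg_frac[OF T[OF t], of "N + 1" q] by simp
  qed
  then show ?thesis
    by (intro bigoI[of _ C], unfold eventually_principal_times_at_top)
      (intro exI[of _ T] ballI allI impI, auto cong: if_cong)
next
  \<comment> \<open>An empty strip makes \<open>Fl a b\<close> the trivial filter, along which every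
    bound holds.\<close>
  case False
  then have "eventually (\<lambda>_. False) (Fl a b)"
    by (subst eventually_principal_times_at_top) simp
  then show ?thesis by (intro bigoI[of _ 0]) (auto elim: eventually_mono)
qed

lemma bounded_imp_bigo_1:
  fixes h :: "real \<Rightarrow> real \<Rightarrow> real \<Rightarrow> real"
  assumes "\<exists>B. \<forall>x\<in>{a..b}. \<forall>y z. \<bar>h x y z\<bar> \<le> B"
  shows "(\<lambda>w. h (rad w) (ang w) (fast w)) \<in> O[Fl a b](\<lambda>_. 1)"
proof -
  obtain B where "\<forall>x\<in>{a..b}. \<forall>y z. \<bar>h x y z\<bar> \<le> B" using assms ..
  then show ?thesis
    by (intro bigoI[of _ B], unfold eventually_principal_times_at_top) auto
qed

lemma X_tendsto: "(X \<longlongrightarrow> 0) (Fl a b)"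
proof -
  have "((\<lambda>t :: real. t powr (- (1 / real q))) \<longlongrightarrow> 0) at_top"
    using q by (intro tendsto_neg_powr filterlim_ident) auto
  then show ?thesis by (rule filterlim_compose) (rule filterlim_snd)
qed

lemma X_bigo_1: "X \<in> O[Fl a b](\<lambda>_. 1)"
  by (rule landau_o.small_imp_big, rule smalloI_tendsto) (use X_tendsto in auto)

text \<open>The first three terms form the derivative of \<open>\<Sum>k\<le>N. X^k W k\<close> along
  the system with the powers of \<open>t\<close> frozen. Each is a product of two expansions, and
  the three Cauchy products add up to the coefficients of the formal derivative;
  \<open>N \<le> q\<close> ensures that these contain nothing from the time derivative of the
  powers.\<close>

lemma averaging_bigo:
  assumes "N \<le> q" "0 < a" "b < \<R>"
    and W: "\<And>k. k \<le> N \<Longrightarrow> \<exists>B. \<forall>x\<in>{a..b}. \<forall>y z. \<bar>deriv (\<lambda>x. W k x y z) x\<bar> \<le> B"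
      "\<And>k. k \<le> N \<Longrightarrow> \<exists>B. \<forall>x\<in>{a..b}. \<forall>y z. \<bar>deriv (\<lambda>y. W k x y z) y\<bar> \<le> B"
      "\<And>k. k \<le> N \<Longrightarrow> \<exists>B. \<forall>x\<in>{a..b}. \<forall>y z. \<bar>deriv (\<lambda>z. W k x y z) z\<bar> \<le> B"
  shows "(\<lambda>w. f (rad w) (c * fast w + ang w) (fast w) (snd w)
        * (\<Sum>k\<le>N. deriv (\<lambda>x. W k x (ang w) (fast w)) (rad w) * X w ^ k)
      + (\<omega> + g (rad w) (c * fast w + ang w) (fast w) (snd w) - c * deriv S (snd w))
        * (\<Sum>k\<le>N. deriv (\<lambda>y. W k (rad w) y (fast w)) (ang w) * X w ^ k)
      + deriv S (snd w) * (\<Sum>k\<le>N. deriv (\<lambda>z. W k (rad w) (ang w) z) (fast w) * X w ^ k)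
      - (\<Sum>k\<le>N. fps_nth (formal_derivative q s (resonant_F \<kappa> \<nu> fk) (resonant_G \<kappa> \<nu> s gk) W
          (rad w) (ang w) (fast w)) k * X w ^ k))
    \<in> O[Fl a b](\<lambda>w. X w ^ (N + 1))"
proof -
  let ?F = "\<lambda>k w. if k = 0 then 0 else fk k (rad w) (c * fast w + ang w) (fast w)"
  let ?G = "\<lambda>k w. if k = 0 then 0 else gk k (rad w) (c * fast w + ang w) (fast w)"
  \<comment> \<open>The entry of index 0 is zero by resonance: \<open>\<omega> = c * s 0\<close>, so
    the constant term of the slow phase velocity cancels.\<close>
  let ?G' = "\<lambda>k w. if k = 0 then 0 else gk k (rad w) (c * fast w + ang w) (fast w) - c * s k"
  let ?P = "\<lambda>k w. deriv (\<lambda>x. W k x (ang w) (fast w)) (rad w)"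
  let ?Q = "\<lambda>k w. deriv (\<lambda>y. W k (rad w) y (fast w)) (ang w)"
  let ?Z = "\<lambda>k w. deriv (\<lambda>z. W k (rad w) (ang w) z) (fast w)"
  have S_bigo: "(\<lambda>w. deriv S (snd w) - (\<Sum>k\<le>N. s k * X w ^ k)) \<in> O[Fl a b](\<lambda>w. X w ^ (N + 1))"
  proof -
    have "(\<lambda>w. deriv S (snd w) - (\<Sum>k = 0..N. snd w powr (- (real k / real q)) * s k))
        \<in> O[Fl a b](\<lambda>w. snd w powr (- (real (N + 1) / real q)))"
      using landau_o.big.compose[OF S_expansion filterlim_snd] .
    moreover have "\<forall>\<^sub>F w in Fl a b. snd w > (0 :: real)"
      by (intro eventually_compose_filterlim[OF _ filterlim_snd] eventually_gt_at_top)
    then have "\<forall>\<^sub>F w in Fl a b. deriv S (snd w) - (\<Sum>k = 0..N. snd w powr (- (real k / real q)) * s k)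
        = deriv S (snd w) - (\<Sum>k\<le>N. s k * X w ^ k)"
      by eventually_elim (simp add: powr_neg_frac atLeast0AtMost mult.commute)
    moreover have "\<forall>\<^sub>F w in Fl a b. snd w powr (- (real (N + 1) / real q)) = X w ^ (N + 1)"
      using \<open>\<forall>\<^sub>F w in Fl a b. snd w > 0\<close> by eventually_elim (rule powr_neg_frac)
    ultimately show ?thesis by (simp only: landau_o.big.cong_ex)
  qed
  have F_bigo: "(\<lambda>w. f (rad w) (c * fast w + ang w) (fast w) (snd w) - (\<Sum>k\<le>N. ?F k w * X w ^ k))
      \<in> O[Fl a b](\<lambda>w. X w ^ (N + 1))"
    by (rule expansion_bigo[OF f_expansion assms(2,3)])
  have "(\<lambda>w. (g (rad w) (c * fast w + ang w) (fast w) (snd w) - (\<Sum>k\<le>N. ?G k w * X w ^ k))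
      - c * (deriv S (snd w) - (\<Sum>k\<le>N. s k * X w ^ k))) \<in> O[Fl a b](\<lambda>w. X w ^ (N + 1))"
    using landau_o.big.mult[OF _ S_bigo, of "\<lambda>_. c" "\<lambda>_. 1"]
    by (intro sum_in_bigo expansion_bigo[OF g_expansion assms(2,3)]) simp
  moreover have "(g (rad w) (c * fast w + ang w) (fast w) (snd w) - (\<Sum>k\<le>N. ?G k w * X w ^ k))
      - c * (deriv S (snd w) - (\<Sum>k\<le>N. s k * X w ^ k))
    = (\<omega> + g (rad w) (c * fast w + ang w) (fast w) (snd w) - c * deriv S (snd w))
      - (\<Sum>k\<le>N. ?G' k w * X w ^ k)" for w
  proof -
    have "\<omega> = c * s 0" using resonance \<nu> by (simp add: field_simps)
    then have "(\<Sum>k\<le>N. ?G' k w * X w ^ k)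
        = \<omega> + ((\<Sum>k\<le>N. ?G k w * X w ^ k) - c * (\<Sum>k\<le>N. s k * X w ^ k))"
      unfolding sum_distrib_left sum_subtractf[symmetric]
      by (subst (1 2) sum.atMost_shift) (simp add: algebra_simps)
    then show ?thesis by (simp add: algebra_simps)
  qed
  ultimately have G_bigo: "(\<lambda>w. (\<omega> + g (rad w) (c * fast w + ang w) (fast w) (snd w) - c * deriv S (snd w))
      - (\<Sum>k\<le>N. ?G' k w * X w ^ k)) \<in> O[Fl a b](\<lambda>w. X w ^ (N + 1))"
    by (simp only:)
  have bdd: "(\<lambda>w. h k (rad w) (c * fast w + ang w) (fast w)) \<in> O[Fl a b](\<lambda>_. 1)"
    if h: "\<And>k. k \<ge> 1 \<Longrightarrow> smooth_periodic3 \<R> (2 * pi) (2 * pi) (h k)" and "k \<noteq> 0"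
    for h :: "nat \<Rightarrow> real \<Rightarrow> real \<Rightarrow> real \<Rightarrow> real" and k
  proof -
    have "\<exists>B. \<forall>x\<in>{a..b}. \<forall>y z. \<bar>h k x y z\<bar> \<le> B"
      by (rule smooth_periodic3_bounds(1)[OF h assms(2,3)]) (use \<open>k \<noteq> 0\<close> in auto)
    \<comment> \<open>The bound holds for all angles and hence survives the substitution
      \<open>c * z + y\<close>, after which the function need not have period \<open>2 * pi\<close>
      in \<open>z\<close>.\<close>
    then have "\<exists>B. \<forall>x\<in>{a..b}. \<forall>y z. \<bar>h k x (c * z + y) z\<bar> \<le> B" by meson
    then show ?thesis by (rule bounded_imp_bigo_1)
  qed
  have F1: "?F k \<in> O[Fl a b](\<lambda>_. 1)" and G1: "?G' k \<in> O[Fl a b](\<lambda>_. 1)" for k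
    using bdd[of fk k, OF fk] bdd[of gk k, OF gk] by (cases "k = 0"; auto intro!: sum_in_bigo)+
  have W1: "?P k \<in> O[Fl a b](\<lambda>_. 1)" "?Q k \<in> O[Fl a b](\<lambda>_. 1)" "?Z k \<in> O[Fl a b](\<lambda>_. 1)"
    if "k \<le> N" for k
    using bounded_imp_bigo_1[OF W(1)[OF that]] bounded_imp_bigo_1[OF W(2)[OF that]]
      bounded_imp_bigo_1[OF W(3)[OF that]] by simp_all
  have product: "(\<lambda>w. A w * (\<Sum>k\<le>N. \<beta> k w * X w ^ k) - (\<Sum>k\<le>N. (\<Sum>i\<le>k. \<alpha> i w * \<beta> (k - i) w) * X w ^ k))
      \<in> O[Fl a b](\<lambda>w. X w ^ (N + 1))"
    if "\<And>k. k \<le> N \<Longrightarrow> \<alpha> k \<in> O[Fl a b](\<lambda>_. 1)" "\<And>k. k \<le> N \<Longrightarrow> \<beta> k \<in> O[Fl a b](\<lambda>_. 1)"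
      "(\<lambda>w. A w - (\<Sum>k\<le>N. \<alpha> k w * X w ^ k)) \<in> O[Fl a b](\<lambda>w. X w ^ (N + 1))" for A \<alpha> \<beta>
    by (rule bigo_Cauchy_product[OF X_bigo_1 that]) simp_all
  have "(\<lambda>w. (f (rad w) (c * fast w + ang w) (fast w) (snd w) * (\<Sum>k\<le>N. ?P k w * X w ^ k)
        - (\<Sum>k\<le>N. (\<Sum>i\<le>k. ?F i w * ?P (k - i) w) * X w ^ k))
      + ((\<omega> + g (rad w) (c * fast w + ang w) (fast w) (snd w) - c * deriv S (snd w))
          * (\<Sum>k\<le>N. ?Q k w * X w ^ k)
        - (\<Sum>k\<le>N. (\<Sum>i\<le>k. ?G' i w * ?Q (k - i) w) * X w ^ k))
      + (deriv S (snd w) * (\<Sum>k\<le>N. ?Z k w * X w ^ k)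
        - (\<Sum>k\<le>N. (\<Sum>i\<le>k. s i * ?Z (k - i) w) * X w ^ k)))
    \<in> O[Fl a b](\<lambda>w. X w ^ (N + 1))"
    by (intro sum_in_bigo(1)[OF sum_in_bigo(1)] product[OF F1 W1(1) F_bigo]
        product[OF G1 W1(2) G_bigo] product[OF _ W1(3) S_bigo]) simp_all
  moreover have "fps_nth (formal_derivative q s (resonant_F \<kappa> \<nu> fk) (resonant_G \<kappa> \<nu> s gk) W
          (rad w) (ang w) (fast w)) k
      = (\<Sum>i\<le>k. ?F i w * ?P (k - i) w) + (\<Sum>i\<le>k. ?G' i w * ?Q (k - i) w)
        + (\<Sum>i\<le>k. s i * ?Z (k - i) w)" if "k \<le> N" for k w
    using that \<open>N \<le> q\<close>
    by (subst fps_nth_formal_derivative) (auto simp: resonant_F_def resonant_G_def cong: if_cong)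
  ultimately show ?thesis
    by (simp add: distrib_right sum.distrib algebra_simps)
qed

lemma DERIV_powr_neg_frac_power:
  "t > 0 \<Longrightarrow> ((\<lambda>t. (t powr (- (1 / real q))) ^ k) has_real_derivative
    - (real k / real q) * (t powr (- (1 / real q))) ^ k / t) (at t within I)"
proof -
  assume "t > 0"
  have "((\<lambda>t. (t powr (- (1 / real q))) ^ k) has_real_derivative real k *
      ((- (1 / real q) * t powr (- (1 / real q) - 1)) * (t powr (- (1 / real q))) ^ (k - Suc 0))) (at t)"
    by (intro DERIV_power has_real_derivative_powr \<open>t > 0\<close>)
  also have "real k * ((- (1 / real q) * t powr (- (1 / real q) - 1))
      * (t powr (- (1 / real q))) ^ (k - Suc 0)) = - (real k / real q) * (t powr (- (1 / real q))) ^ k / t"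
    using \<open>t > 0\<close> by (cases k) (simp_all add: powr_diff)
  finally show ?thesis by (rule has_field_derivative_at_within)
qed

section \<open>The truncated near-identity transformation\<close>

text \<open>\<open>W 0\<close> is kept apart as a linear function because radius and angle are not
  periodic, although their partial derivatives are constant; \<open>(c1, c2)\<close> is
  \<open>(1, 0)\<close> for the radial and \<open>(0, 1)\<close> for the angular equation.
  \<open>T\<close> precedes the solution because the estimates are uniform on the strip. They are
  asserted at each single time with \<open>\<rho> t \<in> {a..b}\<close>, so they can be used before
  confinement is known.\<close>

lemma near_identity:
  assumes "N \<le> q" "0 < a" "b < \<R>" "\<eta> > 0"
    and W: "\<And>k. 1 \<le> k \<Longrightarrow> smooth_periodic3 \<R> (2 * pi) (2 * pi * of_int \<nu>) (W k)"
    and W0: "W 0 = (\<lambda>x y z. c1 * x + c2 * y)"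
    and coeff: "\<And>k x y z. k \<le> N \<Longrightarrow> x \<in> {0<..<\<R>} \<Longrightarrow>
      fps_nth (formal_derivative q s (resonant_F \<kappa> \<nu> fk) (resonant_G \<kappa> \<nu> s gk) W x y z) k
        = (if k = N then L x y else 0)"
  obtains T where "T \<ge> 1"
    and "\<And>ts I \<rho> \<phi>. solution_from \<R> \<omega> f g S ts I \<rho> \<phi> \<Longrightarrow> \<exists>y D. \<forall>t\<in>I. t \<ge> T \<longrightarrow> \<rho> t \<in> {a..b} \<longrightarrow>
        \<bar>y t - (c1 * \<rho> t + c2 * (\<phi> t - c * S t))\<bar> \<le> \<eta>
      \<and> (y has_real_derivative D t) (at t within I)
      \<and> \<bar>D t - t powr (- (real N / real q)) * L (\<rho> t) (\<phi> t - c * S t)\<bar>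
          \<le> \<eta> * t powr (- (real N / real q))"
proof -
  have per: "2 * pi \<noteq> 0" "2 * pi * real_of_int \<nu> \<noteq> 0" using \<nu> by auto
  have W0_deriv: "deriv (\<lambda>x. W 0 x y z) x = c1" "deriv (\<lambda>y. W 0 x y z) y = c2"
    "deriv (\<lambda>z. W 0 x y z) z = 0" for x y z
    unfolding W0 by (auto intro!: DERIV_imp_deriv derivative_eq_intros)
  \<comment> \<open>The derivative of the truncated series along a solution splits into
    \<open>V\<close>, with the powers of \<open>t\<close> frozen, and \<open>V'\<close>, where only
    these powers are differentiated.\<close>
  define V where "V w = f (rad w) (c * fast w + ang w) (fast w) (snd w)
        * (\<Sum>k\<le>N. deriv (\<lambda>x. W k x (ang w) (fast w)) (rad w) * X w ^ k)
      + (\<omega> + g (rad w) (c * fast w + ang w) (fast w) (snd w) - c * deriv S (snd w))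
        * (\<Sum>k\<le>N. deriv (\<lambda>y. W k (rad w) y (fast w)) (ang w) * X w ^ k)
      + deriv S (snd w) * (\<Sum>k\<le>N. deriv (\<lambda>z. W k (rad w) (ang w) z) (fast w) * X w ^ k)" for w
  define V' where "V' w = (\<Sum>k\<le>N. - (real k / real q) * X w ^ k / snd w
      * W k (rad w) (ang w) (fast w))" for w
  have pos: "\<forall>\<^sub>F w in Fl a b. snd w > 0"
    by (intro eventually_compose_filterlim[OF _ filterlim_snd] eventually_gt_at_top)
  have small: "(\<lambda>w. X w ^ (k + j)) \<in> o[Fl a b](\<lambda>w. X w ^ k)" if "j \<noteq> 0" for k j
  proof -
    have "(\<lambda>w. X w ^ j) \<in> o[Fl a b](\<lambda>_. 1)"
      using tendsto_power[OF X_tendsto, of j a b] that by (intro smalloI_tendsto) (auto simp: power_0_left)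
    from landau_o.big_small_mult[OF landau_o.big_refl this, of "\<lambda>w. X w ^ k"]
    show ?thesis by (simp add: power_add)
  qed
  have W1: "(\<lambda>w. W k (rad w) (ang w) (fast w)) \<in> O[Fl a b](\<lambda>_. 1)" if "k \<ge> 1" for k
    by (intro bounded_imp_bigo_1 smooth_periodic3_bounds(1)[OF W[OF that] assms(2,3) per])
  have main: "(\<lambda>w. V w + V' w - X w ^ N * L (rad w) (ang w)) \<in> O[Fl a b](\<lambda>w. X w ^ (N + 1))"
  proof -
    have V0: "(\<lambda>w. V w - (\<Sum>k\<le>N. fps_nth (formal_derivative q s (resonant_F \<kappa> \<nu> fk)
        (resonant_G \<kappa> \<nu> s gk) W (rad w) (ang w) (fast w)) k * X w ^ k))
      \<in> O[Fl a b](\<lambda>w. X w ^ (N + 1))"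
      unfolding V_def
    proof (rule averaging_bigo[OF assms(1-3)])
      fix k assume "k \<le> N"
      show "\<exists>B. \<forall>x\<in>{a..b}. \<forall>y z. \<bar>deriv (\<lambda>x. W k x y z) x\<bar> \<le> B"
        "\<exists>B. \<forall>x\<in>{a..b}. \<forall>y z. \<bar>deriv (\<lambda>y. W k x y z) y\<bar> \<le> B"
        "\<exists>B. \<forall>x\<in>{a..b}. \<forall>y z. \<bar>deriv (\<lambda>z. W k x y z) z\<bar> \<le> B"
        using smooth_periodic3_bounds(2-4)[OF W assms(2,3) per, of k]
        by (cases "k = 0"; auto simp: W0_deriv)+
    qed
    have "\<forall>\<^sub>F w in Fl a b. rad w \<in> {a..b}"
      by (subst eventually_principal_times_at_top) auto
    then have ev: "\<forall>\<^sub>F w in Fl a b. V w - (\<Sum>k\<le>N. fps_nth (formal_derivative q s (resonant_F \<kappa> \<nu> fk)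
        (resonant_G \<kappa> \<nu> s gk) W (rad w) (ang w) (fast w)) k * X w ^ k)
      = V w - X w ^ N * L (rad w) (ang w)"
    proof eventually_elim
      case (elim w)
      then have "rad w \<in> {0<..<\<R>}" using assms(2,3) by auto
      have "(\<Sum>k\<le>N. fps_nth (formal_derivative q s (resonant_F \<kappa> \<nu> fk)
          (resonant_G \<kappa> \<nu> s gk) W (rad w) (ang w) (fast w)) k * X w ^ k)
        = (\<Sum>k\<le>N. if k = N then L (rad w) (ang w) * X w ^ k else 0)"
        by (intro sum.cong refl) (simp add: coeff[OF _ \<open>rad w \<in> {0<..<\<R>}\<close>])
      then show ?case by simp
    qed
    note V = landau_o.big.in_cong[THEN iffD1, OF ev V0]
    have "V' \<in> O[Fl a b](\<lambda>w. X w ^ (N + 1))"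
      unfolding V'_def
    proof (rule big_sum_in_bigo)
      fix k assume "k \<in> {..N}"
      show "(\<lambda>w. - (real k / real q) * X w ^ k / snd w * W k (rad w) (ang w) (fast w))
        \<in> O[Fl a b](\<lambda>w. X w ^ (N + 1))"
      \<comment> \<open>The factor \<open>1 / t\<close> equals \<open>X^q\<close> and thus contains
        \<open>X^N\<close>; for \<open>k \<ge> 1\<close> one factor of \<open>X^k\<close> supplies
        the missing power. For \<open>k = 0\<close> the coefficient is zero.\<close>
      proof (cases "k = 0")
        case False
        have "\<forall>\<^sub>F w in Fl a b. 1 / snd w = X w ^ (q - N) * X w ^ N"
          using pos
        proof eventually_elim
          case (elim w)
          then have "X w ^ q = 1 / snd w"
            using q powr_neg_frac[of "snd w" q q] by (simp add: powr_minus_divide)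
          then show ?case using \<open>N \<le> q\<close> by (simp flip: power_add)
        qed
        then have ev: "\<forall>\<^sub>F w in Fl a b. - (real k / real q) * X w ^ k / snd w * W k (rad w) (ang w) (fast w)
            = - (real k / real q) * X w ^ (k - 1) * X w ^ (q - N) * W k (rad w) (ang w) (fast w)
              * X w ^ (N + 1)"
        proof eventually_elim
          case (elim w)
          have "X w ^ k / snd w = X w ^ k * (X w ^ (q - N) * X w ^ N)" by (subst elim[symmetric]) simp
          also have "\<dots> = X w ^ (k - 1) * X w ^ (q - N) * X w ^ (N + 1)"
            using False by (cases k) auto
          finally show ?case by (simp only: times_divide_eq_right[symmetric]) simp
        qed
        have "(\<lambda>w. - (real k / real q) * X w ^ (k - 1) * X w ^ (q - N)
              * W k (rad w) (ang w) (fast w) * X w ^ (N + 1))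
            \<in> O[Fl a b](\<lambda>w. 1 * 1 ^ (k - 1) * 1 ^ (q - N) * 1 * X w ^ (N + 1))"
          by (intro landau_o.big.mult landau_o.big_power X_bigo_1 W1) (use False in simp_all)
        then show ?thesis by (intro landau_o.big.in_cong[THEN iffD2, OF ev]) (simp only: mult_1 power_one)
      qed simp
    qed
    from sum_in_bigo(1)[OF V this] show ?thesis by (simp add: algebra_simps)
  qed
  \<comment> \<open>The extra power of \<open>X\<close> turns the bound into \<open>o(X^N)\<close>,
    which allows the prescribed constant \<eta> in place of an uncontrolled one.\<close>
  have small1: "(\<lambda>w. V w + V' w - X w ^ N * L (rad w) (ang w)) \<in> o[Fl a b](\<lambda>w. X w ^ N)"
    by (rule landau_o.big_small_trans[OF main small]) simp
  have ev1: "\<forall>\<^sub>F w in Fl a b. \<bar>V w + V' w - X w ^ N * L (rad w) (ang w)\<bar> \<le> \<eta> * X w ^ N"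
    using landau_o.smallD[OF small1 \<open>\<eta> > 0\<close>] by simp
  have small2: "(\<lambda>w. \<Sum>k\<in>{1..N}. X w ^ k * W k (rad w) (ang w) (fast w)) \<in> o[Fl a b](\<lambda>_. 1)"
  proof (rule big_sum_in_smallo)
    fix k assume "k \<in> {1..N}"
    then show "(\<lambda>w. X w ^ k * W k (rad w) (ang w) (fast w)) \<in> o[Fl a b](\<lambda>_. 1)"
      using landau_o.small_big_mult[OF small[of k 0] W1[of k]] by simp
  qed
  have ev2: "\<forall>\<^sub>F w in Fl a b. \<bar>\<Sum>k\<in>{1..N}. X w ^ k * W k (rad w) (ang w) (fast w)\<bar> \<le> \<eta>"
    using landau_o.smallD[OF small2 \<open>\<eta> > 0\<close>] by simp
  obtain T where "T \<ge> 1" and T1: "\<And>x y z t. x \<in> {a..b} \<Longrightarrow> t \<ge> T \<Longrightarrow>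
      \<bar>V ((x, y, z), t) + V' ((x, y, z), t) - X ((x, y, z), t) ^ N * L x y\<bar> \<le> \<eta> * X ((x, y, z), t) ^ N"
    and T2: "\<And>x y z t. x \<in> {a..b} \<Longrightarrow> t \<ge> T \<Longrightarrow>
      \<bar>\<Sum>k\<in>{1..N}. X ((x, y, z), t) ^ k * W k x y z\<bar> \<le> \<eta>"
  proof -
    obtain T1 where T1: "\<forall>x\<in>{a..b} \<times> UNIV. \<forall>t\<ge>T1. \<bar>V (x, t) + V' (x, t) -
        X (x, t) ^ N * L (rad (x, t)) (ang (x, t))\<bar> \<le> \<eta> * X (x, t) ^ N"
      using ev1 unfolding eventually_principal_times_at_top by blast
    obtain T2 where T2: "\<forall>x\<in>{a..b} \<times> UNIV. \<forall>t\<ge>T2.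
        \<bar>\<Sum>k\<in>{1..N}. X (x, t) ^ k * W k (rad (x, t)) (ang (x, t)) (fast (x, t))\<bar> \<le> \<eta>"
      using ev2 unfolding eventually_principal_times_at_top by blast
    show ?thesis
    proof (rule that[of "max 1 (max T1 T2)"])
      show "1 \<le> max 1 (max T1 T2)" by simp
      fix x y z t :: real assume x: "x \<in> {a..b}" and t: "max 1 (max T1 T2) \<le> t"
      show "\<bar>V ((x, y, z), t) + V' ((x, y, z), t) - X ((x, y, z), t) ^ N * L x y\<bar> \<le> \<eta> * X ((x, y, z), t) ^ N"
        using T1[rule_format, of "(x, y, z)" t] x t by simp
      show "\<bar>\<Sum>k\<in>{1..N}. X ((x, y, z), t) ^ k * W k x y z\<bar> \<le> \<eta>"
        using T2[rule_format, of "(x, y, z)" t] x t by simp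
    qed
  qed
  show ?thesis
  proof (rule that[OF \<open>T \<ge> 1\<close>])
    fix ts I \<rho> \<phi> assume sol: "solution_from \<R> \<omega> f g S ts I \<rho> \<phi>"
    define \<Psi> where "\<Psi> t = \<phi> t - c * S t" for t
    define w where "w t = ((\<rho> t, \<Psi> t, S t), t)" for t
    define y where "y t = (\<Sum>k\<le>N. (t powr (- (1 / real q))) ^ k * W k (\<rho> t) (\<Psi> t) (S t))" for t
    have est: "\<bar>y t - (c1 * \<rho> t + c2 * \<Psi> t)\<bar> \<le> \<eta>
      \<and> (y has_real_derivative V (w t) + V' (w t)) (at t within I)
      \<and> \<bar>V (w t) + V' (w t) - t powr (- (real N / real q)) * L (\<rho> t) (\<Psi> t)\<bar>
          \<le> \<eta> * t powr (- (real N / real q))"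
      if "t \<in> I" "t \<ge> T" "\<rho> t \<in> {a..b}" for t
    proof -
      have "t > 0" using that \<open>T \<ge> 1\<close> by simp
      have \<rho>_in: "\<rho> t \<in> {0<..<\<R>}" using that assms(2,3) by auto
      have \<rho>: "(\<rho> has_real_derivative f (\<rho> t) (\<phi> t) (S t) t) (at t within I)"
        and \<phi>: "(\<phi> has_real_derivative \<omega> + g (\<rho> t) (\<phi> t) (S t) t) (at t within I)"
        using sol \<open>t \<in> I\<close> unfolding solution_from_def by blast+
      have S': "(S has_real_derivative deriv S t) (at t within I)"
        using S_has_derivative[OF \<open>t > 0\<close>] by (rule has_field_derivative_at_within)
      have \<Psi>: "(\<Psi> has_real_derivative \<omega> + g (\<rho> t) (\<phi> t) (S t) t - c * deriv S t) (at t within I)"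
        unfolding \<Psi>_def by (intro DERIV_diff \<phi> DERIV_cmult S')
      let ?D = "\<lambda>k. deriv (\<lambda>r. W k r (\<Psi> t) (S t)) (\<rho> t) * f (\<rho> t) (\<phi> t) (S t) t
          + deriv (\<lambda>r. W k (\<rho> t) r (S t)) (\<Psi> t) * (\<omega> + g (\<rho> t) (\<phi> t) (S t) t - c * deriv S t)
          + deriv (\<lambda>r. W k (\<rho> t) (\<Psi> t) r) (S t) * deriv S t"
      have Wk: "((\<lambda>t. W k (\<rho> t) (\<Psi> t) (S t)) has_real_derivative ?D k) (at t within I)" for k
      proof (cases "k = 0")
        case True
        have "((\<lambda>t. c1 * \<rho> t + c2 * \<Psi> t) has_real_derivative
            c1 * f (\<rho> t) (\<phi> t) (S t) t + c2 * (\<omega> + g (\<rho> t) (\<phi> t) (S t) t - c * deriv S t)) (at t within I)"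
          by (intro DERIV_add DERIV_cmult \<rho> \<Psi>)
        then show ?thesis unfolding True W0_deriv by (simp add: W0)
      next
        case False
        then have "smooth_on (\<lambda>(x, y, z). W k x y z) ({0<..\<R>} \<times> UNIV \<times> UNIV)"
          using W[of k] by (simp add: smooth_periodic3_def)
        then show ?thesis by (rule smooth_on_chain_rule3[OF _ \<rho>_in \<rho> \<Psi> S'])
      qed
      have "(y has_real_derivative (\<Sum>k\<le>N. - (real k / real q) * (t powr (- (1 / real q))) ^ k / t
          * W k (\<rho> t) (\<Psi> t) (S t) + ?D k * (t powr (- (1 / real q))) ^ k)) (at t within I)"
        unfolding y_def by (intro DERIV_sum DERIV_mult DERIV_powr_neg_frac_power \<open>t > 0\<close> Wk)
      also have "(\<Sum>k\<le>N. - (real k / real q) * (t powr (- (1 / real q))) ^ k / t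
          * W k (\<rho> t) (\<Psi> t) (S t) + ?D k * (t powr (- (1 / real q))) ^ k) = V (w t) + V' (w t)"
      proof -
        have "c * S t + \<Psi> t = \<phi> t" by (simp add: \<Psi>_def)
        then show ?thesis
          unfolding V_def V'_def w_def fst_conv snd_conv sum_distrib_left sum.distrib[symmetric]
          by (intro sum.cong refl) (simp add: algebra_simps)
      qed
      finally have "(y has_real_derivative V (w t) + V' (w t)) (at t within I)" .
      moreover have "y t - (c1 * \<rho> t + c2 * \<Psi> t)
          = (\<Sum>k\<in>{1..N}. (t powr (- (1 / real q))) ^ k * W k (\<rho> t) (\<Psi> t) (S t))"
        unfolding y_def by (subst sum.atMost_shift) (simp add: W0 sum.atLeast1_atMost_eq lessThan_Suc_atMost)
      ultimately show ?thesis
        using T1[OF that(3,2), of "\<Psi> t" "S t"] T2[OF that(3,2), of "\<Psi> t" "S t"]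
        by (simp add: w_def powr_neg_frac[OF \<open>t > 0\<close>])
    qed
    show "\<exists>y D. \<forall>t\<in>I. t \<ge> T \<longrightarrow> \<rho> t \<in> {a..b} \<longrightarrow>
        \<bar>y t - (c1 * \<rho> t + c2 * (\<phi> t - c * S t))\<bar> \<le> \<eta>
      \<and> (y has_real_derivative D t) (at t within I)
      \<and> \<bar>D t - t powr (- (real N / real q)) * L (\<rho> t) (\<phi> t - c * S t)\<bar>
          \<le> \<eta> * t powr (- (real N / real q))"
      by (intro exI[of _ y] exI[of _ "\<lambda>t. V (w t) + V' (w t)"] ballI impI)
        (rule est[unfolded \<Psi>_def])
  qed
qed

end

section \<open>The flow in a strip\<close>

lemma higher_deriv_zero_on_open:
  fixes h :: "real \<Rightarrow> real"
  assumes "open U" and "\<And>x. x \<in> U \<Longrightarrow> h x = 0" and "x \<in> U"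
  shows "(deriv ^^ i) h x = 0"
  using \<open>x \<in> U\<close>
proof (induction i arbitrary: x)
  case (Suc i)
  have "\<forall>\<^sub>F x in nhds x. (deriv ^^ i) h x = 0"
    using eventually_nhds_in_open[OF \<open>open U\<close> Suc.prems] by eventually_elim (rule Suc.IH)
  then have "deriv ((deriv ^^ i) h) x = deriv (\<lambda>_. 0) x"
    by (rule deriv_cong_ev) simp
  then show ?case by simp
qed (use assms in simp)

text \<open>An index \<open>k < N\<close> contributes nothing, since \<open>L k\<close> vanishes on
  an open set of radii and so do its iterated derivatives. The case \<open>k = K = N\<close> leaves
  only \<open>i = j = 0\<close>, the undifferentiated \<open>L N\<close>. The increments
  \<open>A\<close> and \<open>B\<close> thus never matter.\<close>

lemma fps_nth_taylor_composition:
  assumes zero: "\<And>k x y. 1 \<le> k \<Longrightarrow> k < N \<Longrightarrow> x \<in> {0<..<\<R>} \<Longrightarrow> L k x y = 0"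
    and x: "x \<in> {0<..<\<R>}" and "1 \<le> N" "K \<le> N"
  shows "fps_nth (taylor_composition L x y A B) K = (if K = N then L N x y else 0)"
proof -
  have low: "(deriv ^^ i) (\<lambda>x. (deriv ^^ j) (\<lambda>y. L k x y) y) x = 0" if k: "1 \<le> k" "k < N" for i j k
  proof (rule higher_deriv_zero_on_open[OF _ _ x])
    show "(deriv ^^ j) (\<lambda>y. L k x y) y = 0" if "x \<in> {0<..<\<R>}" for x
      by (rule higher_deriv_zero_on_open[of UNIV]) (simp_all add: zero[OF k that])
  qed simp
  have "fps_nth (taylor_composition L x y A B) K
      = (\<Sum>k = 1..K. if k = N then L N x y else 0)"
    unfolding taylor_composition_def fps_nth_Abs_fps
  proof (rule sum.cong[OF refl])
    fix k assume "k \<in> {1..K}"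
    then show "(\<Sum>i\<le>K - k. \<Sum>j\<le>K - k. (deriv ^^ i) (\<lambda>x. (deriv ^^ j) (\<lambda>y. L k x y) y) x
        / (fact i * fact j) * fps_nth (A ^ i * B ^ j) (K - k)) = (if k = N then L N x y else 0)"
      using \<open>K \<le> N\<close> low by (cases "k = N") auto
  qed
  then show ?thesis using \<open>1 \<le> N\<close> \<open>K \<le> N\<close> by auto
qed

section \<open>Confined solutions: frozen flow and continuation\<close>

context resonant_system
begin

text \<open>Radius and time range over compact intervals and the angle is periodic, so both partial
  derivatives are bounded. The change is split into a radial step at fixed angle and an angular step
  at fixed radius.\<close>

lemma rhs_lipschitz:
  assumes h: "smooth_periodic_rhs \<R> h" and "0 < a" "b < \<R>" "0 < ts"
  obtains L where "L > 0" and "\<And>x x' y y' t. x \<in> {a..b} \<Longrightarrow> x' \<in> {a..b} \<Longrightarrow> t \<in> {ts..T} \<Longrightarrow>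
      \<bar>h x y (S t) t - h x' y' (S t) t\<bar> \<le> L * (\<bar>x - x'\<bar> + \<bar>y - y'\<bar>)"
proof -
  have sm: "smooth_on (\<lambda>(x, y, z, t). h x y z t) ({0<..\<R>} \<times> UNIV \<times> UNIV \<times> {0<..})"
    and per: "\<And>x y z t. x \<in> {0<..<\<R>} \<Longrightarrow> t > 0 \<Longrightarrow> h x (y + 2 * pi) z t = h x y z t"
    using h by (auto simp: smooth_periodic_rhs_def)
  note partials = smooth_on_partials4[OF sm]
  have ab: "x \<in> {0<..<\<R>}" if "x \<in> {a..b}" for x using that assms(2,3) by auto
  have nhd: "\<forall>\<^sub>F x in nhds x. x \<in> {0<..<\<R>}" if "x \<in> {0<..<\<R>}" for x
    using that by (intro eventually_nhds_in_open) auto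
  have "continuous_on {0<..} S"
    using S by (rule smooth_on_continuous)
  then have cont: "continuous_on (({a..b} \<times> {ts..T}) \<times> UNIV) (\<lambda>p. S (snd (fst p)))"
    by (rule continuous_on_compose2) (use \<open>0 < ts\<close> in \<open>auto intro!: continuous_intros\<close>)
  have K: "compact ({a..b} \<times> {ts..T})" by (intro compact_Times) auto
  let ?p = "\<lambda>p. (fst (fst p), snd p, S (snd (fst p)), snd (fst p))"
  have p: "continuous_on (({a..b} \<times> {ts..T}) \<times> UNIV) ?p"
    by (intro continuous_intros cont)
  have sub: "?p ` (({a..b} \<times> {ts..T}) \<times> UNIV) \<subseteq> {0<..<\<R>} \<times> UNIV \<times> UNIV \<times> {0<..}"
    using ab \<open>0 < ts\<close> by auto
  obtain B1 where B1: "\<And>x t y. x \<in> {a..b} \<Longrightarrow> t \<in> {ts..T} \<Longrightarrow> \<bar>deriv (\<lambda>x. h x y (S t) t) x\<bar> \<le> B1"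
  proof (rule periodic_bounded[of "{a..b} \<times> {ts..T}"
        "\<lambda>w y. deriv (\<lambda>x. h x y (S (snd w)) (snd w)) (fst w)" "2 * pi"])
    show "continuous_on (({a..b} \<times> {ts..T}) \<times> UNIV)
        (\<lambda>(w, y). deriv (\<lambda>x. h x y (S (snd w)) (snd w)) (fst w))"
      using continuous_on_compose2[OF partials(3) p sub] by (simp add: case_prod_unfold)
    fix w y assume "w \<in> {a..b} \<times> {ts..T}"
    then show "deriv (\<lambda>x. h x (y + 2 * pi) (S (snd w)) (snd w)) (fst w)
        = deriv (\<lambda>x. h x y (S (snd w)) (snd w)) (fst w)"
      using ab \<open>0 < ts\<close>
      by (intro deriv_cong_ev eventually_mono[OF nhd] per) auto
  qed (use K in force)+
  obtain B2 where B2: "\<And>x t y. x \<in> {a..b} \<Longrightarrow> t \<in> {ts..T} \<Longrightarrow> \<bar>deriv (\<lambda>y. h x y (S t) t) y\<bar> \<le> B2"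
  proof (rule periodic_bounded[of "{a..b} \<times> {ts..T}"
        "\<lambda>w y. deriv (\<lambda>y. h (fst w) y (S (snd w)) (snd w)) y" "2 * pi"])
    show "continuous_on (({a..b} \<times> {ts..T}) \<times> UNIV)
        (\<lambda>(w, y). deriv (\<lambda>y. h (fst w) y (S (snd w)) (snd w)) y)"
      using continuous_on_compose2[OF partials(4) p sub] by (simp add: case_prod_unfold)
    fix w y assume "w \<in> {a..b} \<times> {ts..T}"
    then show "deriv (\<lambda>y. h (fst w) y (S (snd w)) (snd w)) (y + 2 * pi)
        = deriv (\<lambda>y. h (fst w) y (S (snd w)) (snd w)) y"
      using ab \<open>0 < ts\<close> by (intro deriv_periodic per) auto
  qed (use K in force)+
  \<comment> \<open>If \<open>{ts..T}\<close> is empty, \<open>B1\<close> and \<open>B2\<close> are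
    arbitrary; the absolute values and the summand 1 keep \<open>L\<close> positive in that case as
    well.\<close>
  define L where "L = \<bar>B1\<bar> + \<bar>B2\<bar> + 1"
  have "\<bar>h x y (S t) t - h x' y' (S t) t\<bar> \<le> L * (\<bar>x - x'\<bar> + \<bar>y - y'\<bar>)"
    if x: "x \<in> {a..b}" "x' \<in> {a..b}" and t: "t \<in> {ts..T}" for x x' y y' t
  proof -
    have "t > 0" using t \<open>0 < ts\<close> by simp
    have "norm (h x y (S t) t - h x' y (S t) t) \<le> B1 * norm (x - x')"
    proof (rule field_differentiable_bound[of "{a..b}" _ "\<lambda>x. deriv (\<lambda>x. h x y (S t) t) x"])
      show "((\<lambda>x. h x y (S t) t) has_real_derivative deriv (\<lambda>x. h x y (S t) t) x) (at x within {a..b})"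
        if "x \<in> {a..b}" for x
        using partials(1)[OF ab[OF that] \<open>t > 0\<close>] by (rule has_field_derivative_at_within)
    qed (use B1 x t in auto)
    moreover have "norm (h x' y (S t) t - h x' y' (S t) t) \<le> B2 * norm (y - y')"
    proof (rule field_differentiable_bound[of UNIV _ "\<lambda>y. deriv (\<lambda>y. h x' y (S t) t) y"])
      show "((\<lambda>y. h x' y (S t) t) has_real_derivative deriv (\<lambda>y. h x' y (S t) t) y) (at y)" for y
        by (rule partials(2)[OF ab[OF x(2)] \<open>t > 0\<close>])
    qed (use B2 x t in auto)
    moreover have "B1 * \<bar>x - x'\<bar> \<le> L * \<bar>x - x'\<bar>" "B2 * \<bar>y - y'\<bar> \<le> L * \<bar>y - y'\<bar>"
      by (auto simp: L_def intro!: mult_right_mono)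
    ultimately show ?thesis unfolding real_norm_def distrib_left by linarith
  qed
  moreover have "L > 0" unfolding L_def by linarith
  ultimately show ?thesis using that by blast
qed

text \<open>Freezing the right-hand side outside \<open>a \<le> \<rho> \<le> b\<close> makes it globally Lipschitz. The
  resulting global flow solves the original system for as long as it stays in that strip.\<close>

lemma clamped_flow:
  assumes "0 < a" "a \<le> b" "b < \<R>" "0 < ts" "ts \<le> T"
  obtains \<rho> \<phi> where "\<rho> ts = \<rho>0" "continuous_on {ts..T} \<rho>"
    and "\<And>J. J \<subseteq> {ts..T} \<Longrightarrow> is_interval J \<Longrightarrow> ts \<in> J \<Longrightarrow> (\<And>t. t \<in> J \<Longrightarrow> \<rho> t \<in> {a..b}) \<Longrightarrow>
      solution_from \<R> \<omega> f g S ts J \<rho> \<phi>"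
    and "\<And>I \<rho>' \<phi>' t. solution_from \<R> \<omega> f g S ts I \<rho>' \<phi>' \<Longrightarrow> I \<subseteq> {ts..T} \<Longrightarrow>
      (\<And>t. t \<in> I \<Longrightarrow> \<rho>' t \<in> {a..b}) \<Longrightarrow> \<rho>' ts = \<rho>0 \<Longrightarrow> \<phi>' ts = \<phi>0 \<Longrightarrow> t \<in> I \<Longrightarrow>
      \<rho>' t = \<rho> t \<and> \<phi>' t = \<phi> t"
proof -
  \<comment> \<open>A retraction onto the strip that does not increase distances, so Lipschitz
    bounds survive it. The angle needs no freezing, as those bounds are uniform in it.\<close>
  define cl where "cl x = max a (min b x)" for x
  have cl: "cl x \<in> {a..b}" "\<bar>cl x - cl x'\<bar> \<le> \<bar>x - x'\<bar>" "x \<in> {a..b} \<Longrightarrow> cl x = x" for x x'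
    using \<open>a \<le> b\<close> by (auto simp: cl_def max_def min_def)
  have ab: "x \<in> {0<..\<R>}" if "x \<in> {a..b}" for x using that assms by auto
  define F where "F t p = (f (cl (fst p)) (snd p) (S t) t, \<omega> + g (cl (fst p)) (snd p) (S t) t)" for t p
  obtain L1 where "L1 > 0" and L1: "\<And>x x' y y' t. x \<in> {a..b} \<Longrightarrow> x' \<in> {a..b} \<Longrightarrow> t \<in> {ts..T} \<Longrightarrow>
      \<bar>f x y (S t) t - f x' y' (S t) t\<bar> \<le> L1 * (\<bar>x - x'\<bar> + \<bar>y - y'\<bar>)"
    using rhs_lipschitz[OF f assms(1,3,4)] by blast
  obtain L2 where "L2 > 0" and L2: "\<And>x x' y y' t. x \<in> {a..b} \<Longrightarrow> x' \<in> {a..b} \<Longrightarrow> t \<in> {ts..T} \<Longrightarrow>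
      \<bar>g x y (S t) t - g x' y' (S t) t\<bar> \<le> L2 * (\<bar>x - x'\<bar> + \<bar>y - y'\<bar>)"
    using rhs_lipschitz[OF g assms(1,3,4)] by blast
  \<comment> \<open>The factor 2 bounds the sum of the two coordinate distances by the Euclidean
    norm of the pair.\<close>
  define L where "L = 2 * (L1 + L2)"
  have "L > 0" using \<open>L1 > 0\<close> \<open>L2 > 0\<close> by (simp add: L_def)
  have lip: "norm (F t u - F t v) \<le> L * norm (u - v)" if t: "t \<in> {ts..T}" for t u v
  proof -
    let ?d = "\<bar>cl (fst u) - cl (fst v)\<bar> + \<bar>snd u - snd v\<bar>"
    have "F t u - F t v = (f (cl (fst u)) (snd u) (S t) t - f (cl (fst v)) (snd v) (S t) t,
        g (cl (fst u)) (snd u) (S t) t - g (cl (fst v)) (snd v) (S t) t)"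
      by (simp add: F_def)
    then have "norm (F t u - F t v) \<le> \<bar>f (cl (fst u)) (snd u) (S t) t - f (cl (fst v)) (snd v) (S t) t\<bar>
        + \<bar>g (cl (fst u)) (snd u) (S t) t - g (cl (fst v)) (snd v) (S t) t\<bar>"
      by (simp only: real_norm_def[symmetric] norm_Pair_le)
    also have "\<dots> \<le> L1 * ?d + L2 * ?d"
      by (intro add_mono L1 L2 cl t)
    also have "\<dots> = (L1 + L2) * ?d" by (simp add: algebra_simps)
    also have "\<dots> \<le> (L1 + L2) * (norm (u - v) + norm (u - v))"
    proof (intro mult_left_mono add_mono)
      have "norm (fst (u - v)) \<le> norm (u - v)" "norm (snd (u - v)) \<le> norm (u - v)"
        by (metis norm_fst_le prod.collapse, metis norm_snd_le prod.collapse)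
      then show "\<bar>cl (fst u) - cl (fst v)\<bar> \<le> norm (u - v)" "\<bar>snd u - snd v\<bar> \<le> norm (u - v)"
        using cl(2)[of "fst u" "fst v"] by simp_all
    qed (use \<open>L1 > 0\<close> \<open>L2 > 0\<close> in simp)
    finally show ?thesis by (simp add: L_def algebra_simps)
  qed
  have contS: "continuous_on {0<..} S" using S by (rule smooth_on_continuous)
  have cont: "continuous_on ({ts..T} \<times> UNIV) (\<lambda>(t, p). F t p)"
  proof -
    let ?p = "\<lambda>w. (cl (fst (snd w)), snd (snd w), S (fst w), fst w)"
    have "continuous_on ({ts..T} \<times> UNIV) (\<lambda>w. S (fst w))"
      by (rule continuous_on_compose2[OF contS]) (use \<open>0 < ts\<close> in \<open>auto intro!: continuous_intros\<close>)
    then have p: "continuous_on ({ts..T} \<times> UNIV) ?p"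
      unfolding cl_def by (intro continuous_intros)
    have sub: "?p ` ({ts..T} \<times> UNIV) \<subseteq> {0<..\<R>} \<times> UNIV \<times> UNIV \<times> {0<..}"
      using ab[OF cl(1)] \<open>0 < ts\<close> by auto
    have "continuous_on ({ts..T} \<times> UNIV) (\<lambda>w. h (cl (fst (snd w))) (snd (snd w)) (S (fst w)) (fst w))"
      if "smooth_periodic_rhs \<R> h" for h
    proof -
      have "continuous_on ({0<..\<R>} \<times> UNIV \<times> UNIV \<times> {0<..}) (\<lambda>(x, y, z, t). h x y z t)"
        using that smooth_on_continuous unfolding smooth_periodic_rhs_def by blast
      from continuous_on_compose2[OF this p sub] show ?thesis by simp
    qed
    from this[OF f] this[OF g] show ?thesis
      unfolding F_def case_prod_unfold by (intro continuous_intros)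
  qed
  obtain z where z0: "z ts = (\<rho>0, \<phi>0)"
    and z: "\<And>t. t \<in> {ts..T} \<Longrightarrow> (z has_vector_derivative F t (z t)) (at t within {ts..T})"
    using picard_lindelof_global[OF \<open>ts \<le> T\<close> \<open>L > 0\<close> cont lip] by blast
  define \<rho> where "\<rho> t = fst (z t)" for t
  define \<phi> where "\<phi> t = snd (z t)" for t
  have \<rho>: "(\<rho> has_real_derivative f (cl (\<rho> t)) (\<phi> t) (S t) t) (at t within {ts..T})"
    and \<phi>: "(\<phi> has_real_derivative \<omega> + g (cl (\<rho> t)) (\<phi> t) (S t) t) (at t within {ts..T})"
    if "t \<in> {ts..T}" for t
    using bounded_linear.has_vector_derivative[OF bounded_linear_fst z[OF that]]
      bounded_linear.has_vector_derivative[OF bounded_linear_snd z[OF that]]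
    by (simp_all add: \<rho>_def[abs_def] \<phi>_def[abs_def] F_def
        has_real_derivative_iff_has_vector_derivative)
  show ?thesis
  proof (rule that)
    show "\<rho> ts = \<rho>0" by (simp add: \<rho>_def z0)
    show "continuous_on {ts..T} \<rho>"
      using \<rho> DERIV_continuous continuous_on_eq_continuous_within by blast
    show "solution_from \<R> \<omega> f g S ts J \<rho> \<phi>"
      if J: "J \<subseteq> {ts..T}" "is_interval J" "ts \<in> J" and strip: "\<And>t. t \<in> J \<Longrightarrow> \<rho> t \<in> {a..b}" for J
      unfolding solution_from_def
    proof (intro conjI ballI)
      show "J \<subseteq> {ts..}" using J by auto
      fix t assume t: "t \<in> J"
      then have t': "t \<in> {ts..T}" using J by blast
      show "\<rho> t \<in> {0<..\<R>}" using ab[OF strip[OF t]] .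
      show "(\<rho> has_real_derivative f (\<rho> t) (\<phi> t) (S t) t) (at t within J)"
        "(\<phi> has_real_derivative \<omega> + g (\<rho> t) (\<phi> t) (S t) t) (at t within J)"
        using DERIV_subset[OF \<rho>[OF t'] J(1)] DERIV_subset[OF \<phi>[OF t'] J(1)]
        by (simp_all add: cl(3)[OF strip[OF t]])
    qed (use J in auto)
    fix I \<rho>' \<phi>' t assume sol: "solution_from \<R> \<omega> f g S ts I \<rho>' \<phi>'" and "I \<subseteq> {ts..T}"
      and strip: "\<And>t. t \<in> I \<Longrightarrow> \<rho>' t \<in> {a..b}" and init: "\<rho>' ts = \<rho>0" "\<phi>' ts = \<phi>0" and "t \<in> I"
    then have "ts \<le> t" by auto
    have sub: "{ts..t} \<subseteq> I"
      using sol \<open>t \<in> I\<close> unfolding solution_from_def is_interval_1 by auto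
    have "(\<rho>' t, \<phi>' t) = z t"
    proof (rule ode_unique[OF \<open>ts \<le> t\<close>, of _ _ F L])
      show "(\<rho>' ts, \<phi>' ts) = z ts" by (simp add: z0 init)
      fix r assume r: "r \<in> {ts..t}"
      then have rI: "r \<in> I" "r \<in> {ts..T}" using sub \<open>I \<subseteq> {ts..T}\<close> by blast+
      have "(\<rho>' has_real_derivative f (\<rho>' r) (\<phi>' r) (S r) r) (at r within {ts..t})"
        "(\<phi>' has_real_derivative \<omega> + g (\<rho>' r) (\<phi>' r) (S r) r) (at r within {ts..t})"
        using sol rI(1) sub unfolding solution_from_def by (blast intro: DERIV_subset)+
      then show "((\<lambda>r. (\<rho>' r, \<phi>' r)) has_vector_derivative F r (\<rho>' r, \<phi>' r)) (at r within {ts..t})"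
        by (auto simp: F_def cl(3)[OF strip[OF rI(1)]] has_real_derivative_iff_has_vector_derivative
            intro!: has_vector_derivative_Pair)
      show "(z has_vector_derivative F r (z r)) (at r within {ts..t})"
        by (rule has_vector_derivative_within_subset[OF z[OF rI(2)]]) (use sub \<open>I \<subseteq> {ts..T}\<close> in blast)
      show "norm (F r u - F r v) \<le> L * norm (u - v)" for u v by (rule lip[OF rI(2)])
    qed
    then show "\<rho>' t = \<rho> t \<and> \<phi>' t = \<phi> t" by (metis \<rho>_def \<phi>_def fst_conv snd_conv)
  qed
qed

text \<open>If \<open>I\<close> misses a time \<open>T0\<close>, it is bounded. The flow frozen
  outside the larger strip \<open>{a..b}\<close> agrees with the solution on \<open>I\<close> and,
  by continuity, stays in that strip slightly beyond \<open>Sup I\<close>; there it solves the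
  original system and contradicts maximality. The gap between the two strips is what makes room for
  this extension.\<close>

lemma maximal_solution_global:
  assumes maximal: "maximal_solution_from \<R> \<omega> f g S ts I \<rho> \<phi>" and "0 < ts"
    and "0 < a" "a < a'" "a' \<le> b'" "b' < b" "b < \<R>"
    and strip: "\<And>t. t \<in> I \<Longrightarrow> \<rho> t \<in> {a'..b'}"
  shows "I = {ts..}"
proof (rule ccontr)
  assume "I \<noteq> {ts..}"
  have sol: "solution_from \<R> \<omega> f g S ts I \<rho> \<phi>"
    and no_ext: "\<And>J \<rho>' \<phi>'. I \<subset> J \<Longrightarrow> solution_from \<R> \<omega> f g S ts J \<rho>' \<phi>' \<Longrightarrow>
      \<not> (\<forall>t\<in>I. \<rho>' t = \<rho> t \<and> \<phi>' t = \<phi> t)"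
    using maximal unfolding maximal_solution_from_def by blast+
  then have I: "is_interval I" "ts \<in> I" "I \<subseteq> {ts..}" unfolding solution_from_def by blast+
  obtain T0 where T0: "T0 \<ge> ts" "T0 \<notin> I" using \<open>I \<noteq> {ts..}\<close> I(3) by auto
  have "t \<le> T0" if "t \<in> I" for t
    using I T0 that unfolding is_interval_1 by (metis linorder_le_cases)
  then have IT: "I \<subseteq> {ts..T0 + 1}" using I(3) by force
  define \<tau> where "\<tau> = Sup I"
  have bdd: "bdd_above I" using IT by (meson bdd_above_Icc bdd_above_mono)
  have \<tau>: "t \<le> \<tau>" if "t \<in> I" for t using that bdd by (simp add: \<tau>_def cSup_upper)
  have "\<tau> \<le> T0" unfolding \<tau>_def by (rule cSup_least) (use I(2) \<open>\<And>t. t \<in> I \<Longrightarrow> t \<le> T0\<close> in auto)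
  have "a \<le> b" "ts \<le> T0 + 1" using assms T0 by auto
  obtain \<rho>' \<phi>' where cont: "continuous_on {ts..T0 + 1} \<rho>'"
    and sol': "\<And>J. J \<subseteq> {ts..T0 + 1} \<Longrightarrow> is_interval J \<Longrightarrow> ts \<in> J \<Longrightarrow>
      (\<And>t. t \<in> J \<Longrightarrow> \<rho>' t \<in> {a..b}) \<Longrightarrow> solution_from \<R> \<omega> f g S ts J \<rho>' \<phi>'"
    and uniq: "\<And>I \<rho>'' \<phi>'' t. solution_from \<R> \<omega> f g S ts I \<rho>'' \<phi>'' \<Longrightarrow> I \<subseteq> {ts..T0 + 1} \<Longrightarrow>
      (\<And>t. t \<in> I \<Longrightarrow> \<rho>'' t \<in> {a..b}) \<Longrightarrow> \<rho>'' ts = \<rho> ts \<Longrightarrow> \<phi>'' ts = \<phi> ts \<Longrightarrow> t \<in> I \<Longrightarrow>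
      \<rho>'' t = \<rho>' t \<and> \<phi>'' t = \<phi>' t"
    by (rule clamped_flow[OF \<open>0 < a\<close> \<open>a \<le> b\<close> \<open>b < \<R>\<close> \<open>0 < ts\<close> \<open>ts \<le> T0 + 1\<close>,
          of "\<rho> ts" "\<phi> ts"]) blast
  have agree: "\<rho> t = \<rho>' t \<and> \<phi> t = \<phi>' t" if "t \<in> I" for t
    by (rule uniq[OF sol IT _ refl refl that]) (use strip assms in force)
  have "\<tau> \<in> {ts..T0 + 1}" using \<tau>[OF I(2)] \<open>\<tau> \<le> T0\<close> by simp
  \<comment> \<open>The supremum may lie outside \<open>I\<close>; closedness carries the inner
    strip over to it.\<close>
  have "closed {t \<in> {ts..T0 + 1}. \<rho>' t \<in> {a'..b'}}"
    using continuous_closed_preimage[OF cont, of "{a'..b'}"]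
    by (simp add: vimage_def Int_def Collect_conj_eq[symmetric])
  moreover have "I \<subseteq> {t \<in> {ts..T0 + 1}. \<rho>' t \<in> {a'..b'}}"
    using IT strip agree by force
  ultimately have "\<tau> \<in> {t \<in> {ts..T0 + 1}. \<rho>' t \<in> {a'..b'}}"
    using closed_subset_contains_Sup[of "{t \<in> {ts..T0 + 1}. \<rho>' t \<in> {a'..b'}}" I] bdd I(2)
    unfolding \<tau>_def by blast
  then have "min (\<rho>' \<tau> - a) (b - \<rho>' \<tau>) > 0" using assms by auto
  then obtain e where "e > 0" and e: "\<And>t. t \<in> {ts..T0 + 1} \<Longrightarrow> dist t \<tau> < e \<Longrightarrow>
      dist (\<rho>' t) (\<rho>' \<tau>) < min (\<rho>' \<tau> - a) (b - \<rho>' \<tau>)"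
    using cont \<open>\<tau> \<in> {ts..T0 + 1}\<close> unfolding continuous_on_iff by blast
  define e' where "e' = min (e / 2) 1"
  have e': "e' > 0" "e' < e" "e' \<le> 1" using \<open>e > 0\<close> by (auto simp: e'_def)
  have "solution_from \<R> \<omega> f g S ts {ts..\<tau> + e'} \<rho>' \<phi>'"
  proof (rule sol')
    show "{ts..\<tau> + e'} \<subseteq> {ts..T0 + 1}" using \<open>\<tau> \<le> T0\<close> e' by auto
    show "ts \<in> {ts..\<tau> + e'}" using \<tau>[OF I(2)] e' by simp
    fix t assume t: "t \<in> {ts..\<tau> + e'}"
    show "\<rho>' t \<in> {a..b}"
    proof (cases "t < \<tau>")
      case True
      then obtain i where "i \<in> I" "t < i" unfolding \<tau>_def using less_cSupE I(2) by blast
      then have "t \<in> I" using I(1,2) t unfolding is_interval_1 by (metis atLeastAtMost_iff less_imp_le)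
      then show ?thesis using strip agree assms by force
    next
      case False
      then have "dist (\<rho>' t) (\<rho>' \<tau>) < min (\<rho>' \<tau> - a) (b - \<rho>' \<tau>)"
        using t e' \<open>\<tau> \<le> T0\<close> by (intro e) (auto simp: dist_real_def)
      then show ?thesis by (auto simp: dist_real_def)
    qed
  qed (simp add: is_interval_cc)
  moreover have "I \<subset> {ts..\<tau> + e'}"
  proof
    show "I \<subseteq> {ts..\<tau> + e'}" using \<tau> I(3) e' by force
    have "\<tau> + e' \<in> {ts..\<tau> + e'}" "\<tau> + e' \<notin> I" using \<tau>[OF I(2)] \<tau> e' by force+
    then show "I \<noteq> {ts..\<tau> + e'}" by blast
  qed
  ultimately show False using no_ext agree by metis
qed

end

section \<open>Stability and instability\<close>

locale averaged_system = resonant_system +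
  fixes n m :: nat and u v :: "nat \<Rightarrow> real \<Rightarrow> real \<Rightarrow> real \<Rightarrow> real"
    and \<Lambda> \<Omega> :: "nat \<Rightarrow> real \<Rightarrow> real \<Rightarrow> real"
  assumes averaged: "averaged_coefficients \<R> q \<kappa> \<nu> s fk gk u v \<Lambda> \<Omega>"
    and n: "n \<in> {1..q}" and m: "m \<in> {1..q}"
    and \<Lambda>_zero: "\<And>k x y. 1 \<le> k \<Longrightarrow> k < n \<Longrightarrow> x \<in> {0<..\<R>} \<Longrightarrow> \<Lambda> k x y = 0"
    and \<Omega>_zero: "\<And>k x y. 1 \<le> k \<Longrightarrow> k < m \<Longrightarrow> x \<in> {0<..\<R>} \<Longrightarrow> \<Omega> k x y = 0"
begin

lemma \<Lambda>_smooth: "k \<ge> 1 \<Longrightarrow> smooth_periodic2 \<R> (\<Lambda> k)"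
  and \<Omega>_smooth: "k \<ge> 1 \<Longrightarrow> smooth_periodic2 \<R> (\<Omega> k)"
  using averaged unfolding averaged_coefficients_def by blast+

lemma near_identity_radial:
  assumes "0 < a" "b < \<R>" "\<eta> > 0"
  obtains T where "T \<ge> 1"
    and "\<And>ts I \<rho> \<phi>. solution_from \<R> \<omega> f g S ts I \<rho> \<phi> \<Longrightarrow> \<exists>y D. \<forall>t\<in>I. t \<ge> T \<longrightarrow> \<rho> t \<in> {a..b} \<longrightarrow>
        \<bar>y t - \<rho> t\<bar> \<le> \<eta> \<and> (y has_real_derivative D t) (at t within I)
      \<and> \<bar>D t - t powr (- (real n / real q)) * \<Lambda> n (\<rho> t) (\<phi> t - c * S t)\<bar>
          \<le> \<eta> * t powr (- (real n / real q))"
proof (rule near_identity[of n a b \<eta> "\<lambda>k R \<Psi> S. if k = 0 then R else u k R \<Psi> S" 1 0 "\<Lambda> n"])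
  fix k x y z assume "k \<le> n" and x: "x \<in> {0<..<\<R>}"
  have "formal_derivative q s (resonant_F \<kappa> \<nu> fk) (resonant_G \<kappa> \<nu> s gk)
      (\<lambda>k R \<Psi> S. if k = 0 then R else u k R \<Psi> S) x y z
    = taylor_composition \<Lambda> x y (fps_tail (\<lambda>k. u k x y z)) (fps_tail (\<lambda>k. v k x y z))"
    using averaged x unfolding averaged_coefficients_def Let_def by blast
  then show "fps_nth (formal_derivative q s (resonant_F \<kappa> \<nu> fk) (resonant_G \<kappa> \<nu> s gk)
      (\<lambda>k R \<Psi> S. if k = 0 then R else u k R \<Psi> S) x y z) k = (if k = n then \<Lambda> n x y else 0)"
    using fps_nth_taylor_composition[of n \<R> \<Lambda> x k y] \<Lambda>_zero x n \<open>k \<le> n\<close> by simp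
next
  show "smooth_periodic3 \<R> (2 * pi) (2 * pi * of_int \<nu>)
      ((\<lambda>k R \<Psi> S. if k = 0 then R else u k R \<Psi> S) k)" if "1 \<le> k" for k
    using averaged that unfolding averaged_coefficients_def by simp
qed (use assms n that in auto)

lemma near_identity_angular:
  assumes "0 < a" "b < \<R>" "\<eta> > 0"
  obtains T where "T \<ge> 1"
    and "\<And>ts I \<rho> \<phi>. solution_from \<R> \<omega> f g S ts I \<rho> \<phi> \<Longrightarrow> \<exists>y D. \<forall>t\<in>I. t \<ge> T \<longrightarrow> \<rho> t \<in> {a..b} \<longrightarrow>
        \<bar>y t - (\<phi> t - c * S t)\<bar> \<le> \<eta> \<and> (y has_real_derivative D t) (at t within I)
      \<and> \<bar>D t - t powr (- (real m / real q)) * \<Omega> m (\<rho> t) (\<phi> t - c * S t)\<bar>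
          \<le> \<eta> * t powr (- (real m / real q))"
proof (rule near_identity[of m a b \<eta> "\<lambda>k R \<Psi> S. if k = 0 then \<Psi> else v k R \<Psi> S" 0 1 "\<Omega> m"])
  fix k x y z assume "k \<le> m" and x: "x \<in> {0<..<\<R>}"
  have "formal_derivative q s (resonant_F \<kappa> \<nu> fk) (resonant_G \<kappa> \<nu> s gk)
      (\<lambda>k R \<Psi> S. if k = 0 then \<Psi> else v k R \<Psi> S) x y z
    = taylor_composition \<Omega> x y (fps_tail (\<lambda>k. u k x y z)) (fps_tail (\<lambda>k. v k x y z))"
    using averaged x unfolding averaged_coefficients_def Let_def by blast
  then show "fps_nth (formal_derivative q s (resonant_F \<kappa> \<nu> fk) (resonant_G \<kappa> \<nu> s gk)
      (\<lambda>k R \<Psi> S. if k = 0 then \<Psi> else v k R \<Psi> S) x y z) k = (if k = m then \<Omega> m x y else 0)"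
    using fps_nth_taylor_composition[of m \<R> \<Omega> x k y] \<Omega>_zero x m \<open>k \<le> m\<close> by simp
next
  show "smooth_periodic3 \<R> (2 * pi) (2 * pi * of_int \<nu>)
      ((\<lambda>k R \<Psi> S. if k = 0 then \<Psi> else v k R \<Psi> S) k)" if "1 \<le> k" for k
    using averaged that unfolding averaged_coefficients_def by simp
qed (use assms m that in auto)

lemma solution_from_interval:
  assumes "solution_from \<R> \<omega> f g S ts I \<rho> \<phi>" "t \<in> I"
  shows "ts \<le> t" "{ts..t} \<subseteq> I" "continuous_on I \<rho>"
proof -
  show "ts \<le> t" "{ts..t} \<subseteq> I"
    using assms unfolding solution_from_def is_interval_1 by auto
  show "continuous_on I \<rho>"
    using assms unfolding solution_from_def by (meson DERIV_continuous continuous_on_eq_continuous_within)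
qed

section \<open>Barriers around an attracting radius\<close>

text \<open>The barriers are \<open>y = \<rho>s \<plusminus> \<epsilon> / 2\<close>. Initially
  \<open>y\<close> is within \<open>\<epsilon> / 4 + \<epsilon> / 8\<close> of \<rho>s, hence
  between them. On a barrier \<rho> is at distance at least \<open>3 * \<epsilon> / 8\<close>, so
  the inward drift constant is at least \<open>3 * \<gamma> * \<epsilon> / 8\<close> and beats
  \<open>\<eta> \<le> \<gamma> * \<epsilon> / 8\<close>. Between them \<rho> stays within
  \<open>\<epsilon> / 2 + \<epsilon> / 8\<close>, short of \<epsilon>.\<close>

lemma attracting_strip:
  assumes "d > 0" and sub: "{\<rho>s - d..\<rho>s + d} \<subseteq> {0<..<\<R>}" and "\<gamma> > 0"
    and \<Lambda>: "\<And>x y. x \<in> {\<rho>s - d..\<rho>s + d} \<Longrightarrow> \<gamma> * (x - \<rho>s)\<^sup>2 \<le> - 1 * \<Lambda> n x y * (x - \<rho>s)"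
    and "0 < \<epsilon>" "\<epsilon> \<le> d"
  obtains T where "T \<ge> 1"
    and "\<And>ts I \<rho> \<phi> t. ts \<ge> T \<Longrightarrow> solution_from \<R> \<omega> f g S ts I \<rho> \<phi> \<Longrightarrow> \<bar>\<rho> ts - \<rho>s\<bar> \<le> \<epsilon> / 4 \<Longrightarrow> t \<in> I \<Longrightarrow>
      \<bar>\<rho> t - \<rho>s\<bar> < \<epsilon>"
proof -
  define \<eta> where "\<eta> = min (\<epsilon> / 8) (\<gamma> * \<epsilon> / 8)"
  have \<eta>: "\<eta> > 0" "\<eta> \<le> \<epsilon> / 8" "\<eta> \<le> \<gamma> * \<epsilon> / 8" using \<open>\<epsilon> > 0\<close> \<open>\<gamma> > 0\<close> by (auto simp: \<eta>_def)
  have ab: "0 < \<rho>s - d" "\<rho>s + d < \<R>" 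
    using subsetD[OF sub, of "\<rho>s - d"] subsetD[OF sub, of "\<rho>s + d"] \<open>d > 0\<close> by auto
  obtain T where "T \<ge> 1" and T: "\<And>ts I \<rho> \<phi>. solution_from \<R> \<omega> f g S ts I \<rho> \<phi> \<Longrightarrow> \<exists>y D. \<forall>t\<in>I. t \<ge> T \<longrightarrow>
        \<rho> t \<in> {\<rho>s - d..\<rho>s + d} \<longrightarrow> \<bar>y t - \<rho> t\<bar> \<le> \<eta> \<and> (y has_real_derivative D t) (at t within I)
      \<and> \<bar>D t - t powr (- (real n / real q)) * \<Lambda> n (\<rho> t) (\<phi> t - c * S t)\<bar>
          \<le> \<eta> * t powr (- (real n / real q))"
    using near_identity_radial[OF ab \<eta>(1)] by blast
  show ?thesis
  proof (rule that[OF \<open>T \<ge> 1\<close>], rule ccontr)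
    fix ts I \<rho> \<phi> t
    assume "ts \<ge> T" and sol: "solution_from \<R> \<omega> f g S ts I \<rho> \<phi>"
      and init: "\<bar>\<rho> ts - \<rho>s\<bar> \<le> \<epsilon> / 4" and "t \<in> I" and "\<not> \<bar>\<rho> t - \<rho>s\<bar> < \<epsilon>"
    note I = solution_from_interval[OF sol \<open>t \<in> I\<close>]
    \<comment> \<open>The estimates require \<rho> to be in the strip. Stopping at the first time
      with distance \<epsilon> guarantees this, and the barriers then exclude that time
      itself.\<close>
    have "continuous_on {ts..t} (\<lambda>r. \<bar>\<rho> r - \<rho>s\<bar>)"
      by (intro continuous_intros continuous_on_subset[OF I(3,2)])
    moreover have "\<bar>\<rho> ts - \<rho>s\<bar> < \<epsilon>" "\<epsilon> \<le> \<bar>\<rho> t - \<rho>s\<bar>"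
      using init \<open>\<epsilon> > 0\<close> \<open>\<not> \<bar>\<rho> t - \<rho>s\<bar> < \<epsilon>\<close> by auto
    ultimately obtain t1 where t1: "t1 \<in> {ts<..t}" "\<bar>\<rho> t1 - \<rho>s\<bar> = \<epsilon>"
      and before: "\<And>r. r \<in> {ts..<t1} \<Longrightarrow> \<bar>\<rho> r - \<rho>s\<bar> < \<epsilon>"
      by (rule first_hit[OF _ I(1)]) blast
    have strip: "\<bar>\<rho> r - \<rho>s\<bar> \<le> \<epsilon>" if "r \<in> {ts..t1}" for r
      using before[of r] t1(2) that by (cases "r = t1") auto
    obtain y D where yD: "\<forall>t\<in>I. t \<ge> T \<longrightarrow> \<rho> t \<in> {\<rho>s - d..\<rho>s + d} \<longrightarrow>
        \<bar>y t - \<rho> t\<bar> \<le> \<eta> \<and> (y has_real_derivative D t) (at t within I)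
      \<and> \<bar>D t - t powr (- (real n / real q)) * \<Lambda> n (\<rho> t) (\<phi> t - c * S t)\<bar>
          \<le> \<eta> * t powr (- (real n / real q))"
      using T[OF sol] by (elim exE)
    have sub': "{ts..t1} \<subseteq> I" using I(2) t1(1) by auto
    have loc: "\<bar>y r - \<rho> r\<bar> \<le> \<eta>" "(y has_real_derivative D r) (at r within {ts..t1})"
      "\<bar>D r - r powr (- (real n / real q)) * \<Lambda> n (\<rho> r) (\<phi> r - c * S r)\<bar>
          \<le> \<eta> * r powr (- (real n / real q))"
      and \<Lambda>r: "\<gamma> * (\<rho> r - \<rho>s)\<^sup>2 \<le> - 1 * \<Lambda> n (\<rho> r) (\<phi> r - c * S r) * (\<rho> r - \<rho>s)"
      and pos: "r powr (- (real n / real q)) > 0"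
      if r: "r \<in> {ts..t1}" for r
    proof -
      have "\<rho> r \<in> {\<rho>s - d..\<rho>s + d}" using strip[OF r] \<open>\<epsilon> \<le> d\<close> by auto
      moreover have "r \<in> I" "r \<ge> T" using r sub' \<open>ts \<ge> T\<close> by auto
      ultimately show "\<bar>y r - \<rho> r\<bar> \<le> \<eta>" "(y has_real_derivative D r) (at r within {ts..t1})"
        "\<bar>D r - r powr (- (real n / real q)) * \<Lambda> n (\<rho> r) (\<phi> r - c * S r)\<bar>
          \<le> \<eta> * r powr (- (real n / real q))"
        using yD DERIV_subset[OF _ sub'] by blast+
      show "\<gamma> * (\<rho> r - \<rho>s)\<^sup>2 \<le> - 1 * \<Lambda> n (\<rho> r) (\<phi> r - c * S r) * (\<rho> r - \<rho>s)"
        by (rule \<Lambda>) fact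
      show "r powr (- (real n / real q)) > 0" using \<open>r \<ge> T\<close> \<open>T \<ge> 1\<close> by simp
    qed
    have "ts \<in> {ts..t1}" "t1 \<in> {ts..t1}" "ts \<le> t1" using t1 by auto
    have upper: "y t1 < \<rho>s + \<epsilon> / 2"
    proof (rule barrier_real[OF \<open>ts \<le> t1\<close> _ loc(2)])
      show "y ts < \<rho>s + \<epsilon> / 2" using loc(1)[OF \<open>ts \<in> {ts..t1}\<close>] init \<eta> \<open>\<epsilon> > 0\<close> by linarith
      fix r assume r: "r \<in> {ts..t1}" and "y r = \<rho>s + \<epsilon> / 2"
      then have x: "\<rho> r - \<rho>s \<ge> 3 * \<epsilon> / 8" using loc(1)[OF r] \<eta> by linarith
      have "\<gamma> * (\<rho> r - \<rho>s) * (\<rho> r - \<rho>s) \<le> - \<Lambda> n (\<rho> r) (\<phi> r - c * S r) * (\<rho> r - \<rho>s)"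
        using \<Lambda>r[OF r] by (simp add: power2_eq_square algebra_simps)
      then have "\<gamma> * (\<rho> r - \<rho>s) \<le> - \<Lambda> n (\<rho> r) (\<phi> r - c * S r)"
        by (rule mult_right_le_imp_le) (use x \<open>\<epsilon> > 0\<close> in linarith)
      moreover have "\<gamma> * (3 * \<epsilon> / 8) \<le> \<gamma> * (\<rho> r - \<rho>s)" using x \<open>\<gamma> > 0\<close> by (intro mult_left_mono) auto
      ultimately have "\<Lambda> n (\<rho> r) (\<phi> r - c * S r) + \<eta> < 0"
        using \<eta> mult_pos_pos[OF \<open>\<gamma> > 0\<close> \<open>\<epsilon> > 0\<close>] by linarith
      then have "r powr (- (real n / real q)) * (\<Lambda> n (\<rho> r) (\<phi> r - c * S r) + \<eta>) < 0"
        using pos[OF r] by (rule mult_pos_neg[rotated])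
      then show "D r < 0" using loc(3)[OF r] by (simp add: algebra_simps abs_le_iff)
    qed
    have lower: "- y t1 < - \<rho>s + \<epsilon> / 2"
    proof (rule barrier_real[OF \<open>ts \<le> t1\<close> _ DERIV_minus[OF loc(2)]])
      show "- y ts < - \<rho>s + \<epsilon> / 2" using loc(1)[OF \<open>ts \<in> {ts..t1}\<close>] init \<eta> \<open>\<epsilon> > 0\<close> by linarith
      fix r assume r: "r \<in> {ts..t1}" and "- y r = - \<rho>s + \<epsilon> / 2"
      then have x: "\<rho>s - \<rho> r \<ge> 3 * \<epsilon> / 8" using loc(1)[OF r] \<eta> by linarith
      have "\<gamma> * (\<rho>s - \<rho> r) * (\<rho>s - \<rho> r) \<le> \<Lambda> n (\<rho> r) (\<phi> r - c * S r) * (\<rho>s - \<rho> r)"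
        using \<Lambda>r[OF r] by (simp add: power2_eq_square algebra_simps)
      then have "\<gamma> * (\<rho>s - \<rho> r) \<le> \<Lambda> n (\<rho> r) (\<phi> r - c * S r)"
        by (rule mult_right_le_imp_le) (use x \<open>\<epsilon> > 0\<close> in linarith)
      moreover have "\<gamma> * (3 * \<epsilon> / 8) \<le> \<gamma> * (\<rho>s - \<rho> r)" using x \<open>\<gamma> > 0\<close> by (intro mult_left_mono) auto
      ultimately have "0 < \<Lambda> n (\<rho> r) (\<phi> r - c * S r) - \<eta>"
        using \<eta> mult_pos_pos[OF \<open>\<gamma> > 0\<close> \<open>\<epsilon> > 0\<close>] by linarith
      then have "0 < r powr (- (real n / real q)) * (\<Lambda> n (\<rho> r) (\<phi> r - c * S r) - \<eta>)"
        using pos[OF r] by (intro mult_pos_pos)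
      then show "- D r < 0" using loc(3)[OF r] by (simp add: algebra_simps abs_le_iff)
    qed
    show False
      using upper lower loc(1)[OF \<open>t1 \<in> {ts..t1}\<close>] t1(2) \<eta> \<open>\<epsilon> > 0\<close> by linarith
  qed
qed

end

section \<open>Logarithmic growth: drift of the phase and escape\<close>

text \<open>\<open>1 / t\<close> is the slowest rate that occurs, attained when the leading order
  equals \<open>q\<close>. Bounding all rates below by it gives one logarithmic estimate for both
  equations.\<close>

lemma log_growth:
  fixes y D :: "real \<Rightarrow> real"
  assumes "0 < a" "a \<le> b"
    and der: "\<And>t. t \<in> {a..b} \<Longrightarrow> (y has_real_derivative D t) (at t within {a..b})"
    and lower: "\<And>t. t \<in> {a..b} \<Longrightarrow> k / t \<le> D t"
  shows "y a + k * (ln b - ln a) \<le> y b"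
proof -
  have "y a - k * ln a \<le> y b - k * ln b"
  proof (rule has_real_derivative_nonneg_imp_le[OF \<open>a \<le> b\<close>])
    fix t assume t: "t \<in> {a..b}"
    show "((\<lambda>t. y t - k * ln t) has_real_derivative D t - k / t) (at t within {a..b})"
      using t \<open>0 < a\<close> by (auto intro!: derivative_eq_intros der[OF t])
    show "0 \<le> D t - k / t" using lower[OF t] by simp
  qed
  then show ?thesis by (simp add: algebra_simps)
qed

lemma powr_neg_frac_ge:
  assumes "t \<ge> 1" "j \<le> q" "q \<ge> (1 :: nat)"
  shows "1 / t \<le> t powr (- (real j / real q))"
proof -
  have "1 / t = t powr (- 1)" using assms by (simp add: powr_minus_divide)
  also have "\<dots> \<le> t powr (- (real j / real q))"
    using assms by (intro powr_mono) auto
  finally show ?thesis .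
qed

context averaged_system
begin

text \<open>\<sigma> is the sign of \<open>\<Omega> m\<close>, so only growth of
  \<open>\<sigma> * y\<close> is at stake. The solution may start before the threshold
  \<open>T\<close> belonging to \<eta>; since a limit is claimed, it is enough to argue from
  \<open>max ts T\<close> on.\<close>

lemma angular_drift:
  assumes "0 < a" "b < \<R>" "\<gamma> > 0" and \<sigma>: "\<sigma> = 1 \<or> \<sigma> = - 1"
    and \<Omega>: "\<And>x y. x \<in> {a..b} \<Longrightarrow> \<gamma> \<le> \<sigma> * \<Omega> m x y"
    and sol: "solution_from \<R> \<omega> f g S ts {ts..} \<rho> \<phi>"
    and strip: "\<And>t. t \<ge> ts \<Longrightarrow> \<rho> t \<in> {a..b}"
  shows "filterlim (\<lambda>t. \<bar>\<phi> t - c * S t\<bar>) at_top at_top"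
proof -
  \<comment> \<open>The bound \<open>\<gamma> / 2\<close> leaves half of the drift; the bound 1
    becomes the constant subtracted when \<open>y\<close> is replaced by the slow phase.\<close>
  define \<eta> where "\<eta> = min 1 (\<gamma> / 2)"
  have \<eta>: "\<eta> > 0" "\<eta> \<le> 1" "\<eta> \<le> \<gamma> / 2" using \<open>\<gamma> > 0\<close> by (auto simp: \<eta>_def)
  obtain T where "T \<ge> 1" and T: "\<And>ts I \<rho> \<phi>. solution_from \<R> \<omega> f g S ts I \<rho> \<phi> \<Longrightarrow> \<exists>y D. \<forall>t\<in>I. t \<ge> T \<longrightarrow>
        \<rho> t \<in> {a..b} \<longrightarrow> \<bar>y t - (\<phi> t - c * S t)\<bar> \<le> \<eta> \<and> (y has_real_derivative D t) (at t within I)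
      \<and> \<bar>D t - t powr (- (real m / real q)) * \<Omega> m (\<rho> t) (\<phi> t - c * S t)\<bar>
          \<le> \<eta> * t powr (- (real m / real q))"
    using near_identity_angular[OF assms(1,2) \<eta>(1)] by blast
  obtain y D where yD: "\<forall>t\<in>{ts..}. t \<ge> T \<longrightarrow> \<rho> t \<in> {a..b} \<longrightarrow>
        \<bar>y t - (\<phi> t - c * S t)\<bar> \<le> \<eta> \<and> (y has_real_derivative D t) (at t within {ts..})
      \<and> \<bar>D t - t powr (- (real m / real q)) * \<Omega> m (\<rho> t) (\<phi> t - c * S t)\<bar>
          \<le> \<eta> * t powr (- (real m / real q))"
    using T[OF sol] by (elim exE)
  define T1 where "T1 = max ts T"
  have T1: "T1 \<ge> 1" "T1 \<ge> ts" "T1 \<ge> T" using \<open>T \<ge> 1\<close> by (auto simp: T1_def)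
  have loc: "\<bar>y t - (\<phi> t - c * S t)\<bar> \<le> \<eta>" "(y has_real_derivative D t) (at t within {ts..})"
    "\<bar>D t - t powr (- (real m / real q)) * \<Omega> m (\<rho> t) (\<phi> t - c * S t)\<bar>
      \<le> \<eta> * t powr (- (real m / real q))" if "t \<ge> T1" for t
  proof -
    have "t \<in> {ts..}" "t \<ge> T" "t \<ge> ts" using that T1 by auto
    then show "\<bar>y t - (\<phi> t - c * S t)\<bar> \<le> \<eta>" "(y has_real_derivative D t) (at t within {ts..})"
      "\<bar>D t - t powr (- (real m / real q)) * \<Omega> m (\<rho> t) (\<phi> t - c * S t)\<bar>
        \<le> \<eta> * t powr (- (real m / real q))"
      using yD strip[of t] by blast+
  qed
  have growth: "\<sigma> * y T1 + \<gamma> / 2 * (ln t - ln T1) \<le> \<sigma> * y t" if "t \<ge> T1" for t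
  proof (rule log_growth[OF _ that])
    show "0 < T1" using T1 by simp
    fix r assume r: "r \<in> {T1..t}"
    then have "r \<ge> T1" "r \<ge> ts" "r \<ge> 1" using T1 by auto
    show "((\<lambda>t. \<sigma> * y t) has_real_derivative \<sigma> * D r) (at r within {T1..t})"
      by (rule DERIV_cmult, rule DERIV_subset[OF loc(2)[OF \<open>r \<ge> T1\<close>]]) (use T1 in auto)
    let ?P = "r powr (- (real m / real q))"
    have P: "1 / r \<le> ?P" using powr_neg_frac_ge[OF \<open>r \<ge> 1\<close>, of m q] m by auto
    have "\<gamma> / 2 / r \<le> \<gamma> / 2 * ?P" using mult_left_mono[OF P, of "\<gamma> / 2"] \<open>\<gamma> > 0\<close> by simp
    also have "\<dots> = ?P * (\<gamma> / 2)" by simp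
    also have "\<dots> \<le> ?P * (\<gamma> - \<eta>)" using \<eta> by (intro mult_left_mono) auto
    also have "\<dots> \<le> ?P * (\<sigma> * \<Omega> m (\<rho> r) (\<phi> r - c * S r) - \<eta>)"
      by (intro mult_left_mono diff_right_mono \<Omega> strip \<open>r \<ge> ts\<close>) auto
    also have "\<dots> \<le> \<sigma> * D r"
      using loc(3)[OF \<open>r \<ge> T1\<close>] \<sigma> by (auto simp: algebra_simps abs_le_iff)
    finally show "\<gamma> / 2 / r \<le> \<sigma> * D r" .
  qed
  have "filterlim (\<lambda>t. (\<sigma> * y T1 - \<gamma> / 2 * ln T1 - 1) + \<gamma> / 2 * ln t) at_top at_top"
    using \<open>\<gamma> > 0\<close>
    by (intro filterlim_tendsto_add_at_top[OF tendsto_const]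
        filterlim_tendsto_pos_mult_at_top[OF tendsto_const _ ln_at_top]) auto
  then show ?thesis
  proof (rule filterlim_at_top_mono)
    show "\<forall>\<^sub>F t in at_top. (\<sigma> * y T1 - \<gamma> / 2 * ln T1 - 1) + \<gamma> / 2 * ln t \<le> \<bar>\<phi> t - c * S t\<bar>"
      using eventually_ge_at_top[of T1]
    proof eventually_elim
      case (elim t)
      define \<psi> where "\<psi> = \<phi> t - c * S t"
      have "\<bar>y t - \<psi>\<bar> \<le> 1" using loc(1)[OF elim] \<eta>(2) unfolding \<psi>_def by (rule order_trans)
      have "(\<sigma> * y T1 - \<gamma> / 2 * ln T1 - 1) + \<gamma> / 2 * ln t \<le> \<sigma> * y t - 1"
        using growth[OF elim] unfolding right_diff_distrib by linarith
      also have "\<dots> \<le> \<bar>\<psi>\<bar>" using \<sigma> \<open>\<bar>y t - \<psi>\<bar> \<le> 1\<close> by auto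
      finally show ?case by (simp only: \<psi>_def)
    qed
  qed
qed

text \<open>The solution starts at \<open>\<rho>s + \<delta>\<close>, so \<open>y\<close> starts at
  or above \<open>\<rho>s + 3 * \<delta> / 4\<close>. While
  \<open>y \<ge> \<rho>s + \<delta> / 2\<close>, \<rho> exceeds \<rho>s by at least
  \<open>\<delta> / 4\<close>, and the outward drift constant is at least
  \<open>\<gamma> * \<delta> / 4 - \<eta> \<ge> k\<close>. That level is therefore never crossed
  downwards, and \<open>y\<close> grows logarithmically until the strip is left. As \<eta> depends
  on \<delta>, so does \<open>ts\<close>.\<close>

lemma repelling_strip:
  assumes "d > 0" and sub: "{\<rho>s - d..\<rho>s + d} \<subseteq> {0<..<\<R>}" and "\<gamma> > 0"
    and \<Lambda>: "\<And>x y. x \<in> {\<rho>s - d..\<rho>s + d} \<Longrightarrow> \<gamma> * (x - \<rho>s)\<^sup>2 \<le> 1 * \<Lambda> n x y * (x - \<rho>s)"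
    and "0 < \<delta>" "\<delta> < d"
  obtains ts I \<rho> \<phi> te where "ts \<ge> 1" "solution_from \<R> \<omega> f g S ts I \<rho> \<phi>" "\<bar>\<rho> ts - \<rho>s\<bar> \<le> \<delta>"
    "te \<in> I" "te > ts" "\<bar>\<rho> te - \<rho>s\<bar> \<ge> d"
proof -
  define \<eta> where "\<eta> = min (\<delta> / 4) (\<gamma> * \<delta> / 8)"
  have \<eta>: "\<eta> > 0" "\<eta> \<le> \<delta> / 4" "\<eta> \<le> \<gamma> * \<delta> / 8" using \<open>\<delta> > 0\<close> \<open>\<gamma> > 0\<close> by (auto simp: \<eta>_def)
  have ab: "0 < \<rho>s - d" "\<rho>s + d < \<R>"
    using subsetD[OF sub, of "\<rho>s - d"] subsetD[OF sub, of "\<rho>s + d"] \<open>d > 0\<close> by auto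
  obtain ts where "ts \<ge> 1" and T: "\<And>ts' I \<rho> \<phi>. solution_from \<R> \<omega> f g S ts' I \<rho> \<phi> \<Longrightarrow>
      \<exists>y D. \<forall>t\<in>I. t \<ge> ts \<longrightarrow> \<rho> t \<in> {\<rho>s - d..\<rho>s + d} \<longrightarrow>
        \<bar>y t - \<rho> t\<bar> \<le> \<eta> \<and> (y has_real_derivative D t) (at t within I)
      \<and> \<bar>D t - t powr (- (real n / real q)) * \<Lambda> n (\<rho> t) (\<phi> t - c * S t)\<bar>
          \<le> \<eta> * t powr (- (real n / real q))"
    using near_identity_radial[OF ab \<eta>(1)] by blast
  define k where "k = \<gamma> * \<delta> / 8"
  have "k > 0" using \<open>\<gamma> > 0\<close> \<open>\<delta> > 0\<close> by (simp add: k_def)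
  \<comment> \<open>Chosen so that \<open>k * (ln T' - ln ts) = 2 * d\<close>: without an exit by
    then, \<open>y\<close> would rise by \<open>2 * d\<close>, more than the strip allows.\<close>
  define T' where "T' = ts * exp (2 * d / k)"
  have "ts > 0" using \<open>ts \<ge> 1\<close> by simp
  have "ts \<le> T'" using \<open>ts > 0\<close> \<open>k > 0\<close> \<open>d > 0\<close> by (simp add: T'_def)
  have "\<rho>s - d \<le> \<rho>s + d" using \<open>d > 0\<close> by simp
  obtain \<rho> \<phi> where init: "\<rho> ts = \<rho>s + \<delta>" and cont: "continuous_on {ts..T'} \<rho>"
    and sol: "\<And>J. J \<subseteq> {ts..T'} \<Longrightarrow> is_interval J \<Longrightarrow> ts \<in> J \<Longrightarrow>
      (\<And>t. t \<in> J \<Longrightarrow> \<rho> t \<in> {\<rho>s - d..\<rho>s + d}) \<Longrightarrow> solution_from \<R> \<omega> f g S ts J \<rho> \<phi>"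
    by (rule clamped_flow[OF ab(1) \<open>\<rho>s - d \<le> \<rho>s + d\<close> ab(2) \<open>ts > 0\<close> \<open>ts \<le> T'\<close>, of "\<rho>s + \<delta>" 0]) blast
  have "\<exists>t\<in>{ts..T'}. d \<le> \<bar>\<rho> t - \<rho>s\<bar>"
  proof (rule ccontr)
    assume "\<not> (\<exists>t\<in>{ts..T'}. d \<le> \<bar>\<rho> t - \<rho>s\<bar>)"
    then have small: "\<bar>\<rho> t - \<rho>s\<bar> < d" if "t \<in> {ts..T'}" for t using that by force
    then have strip: "\<rho> t \<in> {\<rho>s - d..\<rho>s + d}" if "t \<in> {ts..T'}" for t
      using small[OF that] by auto
    have "solution_from \<R> \<omega> f g S ts {ts..T'} \<rho> \<phi>"
      by (rule sol) (use strip \<open>ts \<le> T'\<close> in \<open>simp_all add: is_interval_cc\<close>)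
    from T[OF this] obtain y D where yD: "\<forall>t\<in>{ts..T'}. t \<ge> ts \<longrightarrow> \<rho> t \<in> {\<rho>s - d..\<rho>s + d} \<longrightarrow>
        \<bar>y t - \<rho> t\<bar> \<le> \<eta> \<and> (y has_real_derivative D t) (at t within {ts..T'})
      \<and> \<bar>D t - t powr (- (real n / real q)) * \<Lambda> n (\<rho> t) (\<phi> t - c * S t)\<bar>
          \<le> \<eta> * t powr (- (real n / real q))"
      by (elim exE)
    have loc: "\<bar>y t - \<rho> t\<bar> \<le> \<eta>" "(y has_real_derivative D t) (at t within {ts..T'})"
      "\<bar>D t - t powr (- (real n / real q)) * \<Lambda> n (\<rho> t) (\<phi> t - c * S t)\<bar>
          \<le> \<eta> * t powr (- (real n / real q))" if "t \<in> {ts..T'}" for t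
    proof -
      have "t \<ge> ts" using that by simp
      then show "\<bar>y t - \<rho> t\<bar> \<le> \<eta>" "(y has_real_derivative D t) (at t within {ts..T'})"
        "\<bar>D t - t powr (- (real n / real q)) * \<Lambda> n (\<rho> t) (\<phi> t - c * S t)\<bar>
          \<le> \<eta> * t powr (- (real n / real q))"
        using yD that strip[OF that] by blast+
    qed
    have push: "t powr (- (real n / real q)) * k \<le> D t"
      if t: "t \<in> {ts..T'}" and y: "\<rho>s + \<delta> / 2 \<le> y t" for t
    proof -
      have x: "\<rho> t - \<rho>s \<ge> \<delta> / 4" using loc(1)[OF t] y \<eta>(2) by linarith
      have "\<gamma> * (\<rho> t - \<rho>s) * (\<rho> t - \<rho>s) \<le> \<Lambda> n (\<rho> t) (\<phi> t - c * S t) * (\<rho> t - \<rho>s)"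
        using \<Lambda>[OF strip[OF t]] by (simp add: power2_eq_square mult.assoc)
      then have "\<gamma> * (\<rho> t - \<rho>s) \<le> \<Lambda> n (\<rho> t) (\<phi> t - c * S t)"
        by (rule mult_right_le_imp_le) (use x \<open>\<delta> > 0\<close> in linarith)
      moreover have "\<gamma> * (\<delta> / 4) \<le> \<gamma> * (\<rho> t - \<rho>s)" using x \<open>\<gamma> > 0\<close> by (intro mult_left_mono) auto
      ultimately have "k \<le> \<Lambda> n (\<rho> t) (\<phi> t - c * S t) - \<eta>"
        using \<eta>(3) unfolding k_def by linarith
      then have "t powr (- (real n / real q)) * k
          \<le> t powr (- (real n / real q)) * (\<Lambda> n (\<rho> t) (\<phi> t - c * S t) - \<eta>)"
        by (rule mult_left_mono) simp
      also have "\<dots> \<le> D t" using loc(3)[OF t] by (simp add: algebra_simps abs_le_iff)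
      finally show ?thesis .
    qed
    have y0: "y ts \<ge> \<rho>s + 3 * \<delta> / 4"
      using loc(1)[of ts] \<open>ts \<le> T'\<close> init \<eta>(2) by auto
    have above: "\<rho>s + \<delta> / 2 \<le> y t" if t: "t \<in> {ts..T'}" for t
    proof -
      have sub: "{ts..t} \<subseteq> {ts..T'}" and "ts \<le> t" using t by auto
      have "- y t < - (\<rho>s + \<delta> / 2)"
      proof (rule barrier_real[OF \<open>ts \<le> t\<close>])
        show "- y ts < - (\<rho>s + \<delta> / 2)" using y0 \<open>\<delta> > 0\<close> by simp
        fix r assume "r \<in> {ts..t}"
        then have r: "r \<in> {ts..T'}" using sub by blast
        show "((\<lambda>t. - y t) has_real_derivative - D r) (at r within {ts..t})"
          by (rule DERIV_minus[OF DERIV_subset[OF loc(2)[OF r] sub]])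
        assume "- y r = - (\<rho>s + \<delta> / 2)"
        then have "r powr (- (real n / real q)) * k \<le> D r" by (intro push[OF r]) simp
        moreover have "r powr (- (real n / real q)) * k > 0" using r \<open>ts > 0\<close> \<open>k > 0\<close> by simp
        ultimately show "- D r < 0" by linarith
      qed
      then show ?thesis by simp
    qed
    have "y ts + k * (ln T' - ln ts) \<le> y T'"
    proof (rule log_growth[OF \<open>ts > 0\<close> \<open>ts \<le> T'\<close> loc(2)])
      fix t assume t: "t \<in> {ts..T'}"
      then have "1 / t \<le> t powr (- (real n / real q))"
        using powr_neg_frac_ge[of t n q] n \<open>ts \<ge> 1\<close> by auto
      then have "k / t \<le> t powr (- (real n / real q)) * k"
        using mult_right_mono[of "1 / t" _ k] \<open>k > 0\<close> by simp
      then show "k / t \<le> D t" using push[OF t above[OF t]] by linarith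
    qed auto
    moreover have "k * (ln T' - ln ts) = 2 * d"
      using \<open>ts > 0\<close> \<open>k > 0\<close> by (simp add: T'_def ln_mult)
    ultimately have "\<rho>s + 3 * \<delta> / 4 + 2 * d \<le> y T'" using y0 by simp
    then show False
      using loc(1)[of T'] small[of T'] \<open>ts \<le> T'\<close> \<eta>(2) \<open>\<delta> < d\<close> \<open>\<delta> > 0\<close> by auto
  qed
  then obtain t0 where t0: "t0 \<in> {ts..T'}" "d \<le> \<bar>\<rho> t0 - \<rho>s\<bar>" by blast
  then have "ts \<le> t0" by simp
  have h: "continuous_on {ts..t0} (\<lambda>t. \<bar>\<rho> t - \<rho>s\<bar>)"
    by (intro continuous_intros continuous_on_subset[OF cont]) (use t0 in auto)
  have h0: "\<bar>\<rho> ts - \<rho>s\<bar> < d" using init \<open>\<delta> > 0\<close> \<open>\<delta> < d\<close> by simp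
  obtain te where te: "te \<in> {ts<..t0}" "\<bar>\<rho> te - \<rho>s\<bar> = d"
    and before: "\<And>r. r \<in> {ts..<te} \<Longrightarrow> \<bar>\<rho> r - \<rho>s\<bar> < d"
    by (rule first_hit[OF h \<open>ts \<le> t0\<close> h0 t0(2)]) blast
  have "solution_from \<R> \<omega> f g S ts {ts..te} \<rho> \<phi>"
  proof (rule sol)
    fix t assume "t \<in> {ts..te}"
    then have "\<bar>\<rho> t - \<rho>s\<bar> \<le> d" using before[of t] te(2) by (cases "t = te") auto
    then show "\<rho> t \<in> {\<rho>s - d..\<rho>s + d}" by auto
  qed (use te t0 in \<open>auto simp: is_interval_cc\<close>)
  then show ?thesis
    using that[of ts "{ts..te}" \<rho> \<phi> te] \<open>ts \<ge> 1\<close> init \<open>\<delta> > 0\<close> te by simp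
qed

lemma stability:
  assumes \<rho>s: "\<rho>s \<in> {0<..<\<R>}" and \<Lambda>0: "\<And>\<psi>. \<Lambda> n \<rho>s \<psi> = 0"
    and l: "\<And>\<psi>. deriv (\<lambda>\<rho>. \<Lambda> n \<rho> \<psi>) \<rho>s < 0" and \<Omega>: "\<And>\<psi>. \<Omega> m \<rho>s \<psi> \<noteq> 0" and "\<epsilon> > 0"
  obtains \<delta> T where "\<delta> \<in> {0<..<\<epsilon>}" "T > 0"
    and "\<And>ts I \<rho> \<phi> t. ts \<ge> T \<Longrightarrow> solution_from \<R> \<omega> f g S ts I \<rho> \<phi> \<Longrightarrow> \<bar>\<rho> ts - \<rho>s\<bar> \<le> \<delta> \<Longrightarrow> t \<in> I \<Longrightarrow>
      \<bar>\<rho> t - \<rho>s\<bar> < \<epsilon>"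
    and "\<And>ts I \<rho> \<phi>. ts \<ge> T \<Longrightarrow> maximal_solution_from \<R> \<omega> f g S ts I \<rho> \<phi> \<Longrightarrow> \<bar>\<rho> ts - \<rho>s\<bar> \<le> \<delta> \<Longrightarrow>
      I = {ts..} \<and> filterlim (\<lambda>t. \<bar>\<phi> t - c * S t\<bar>) at_top at_top"
proof -
  have "n \<ge> 1" "m \<ge> 1" using n m by auto
  obtain \<gamma> d where "\<gamma> > 0" "d > 0" and sub: "{\<rho>s - d..\<rho>s + d} \<subseteq> {0<..<\<R>}"
    and \<Lambda>: "\<And>x y. x \<in> {\<rho>s - d..\<rho>s + d} \<Longrightarrow> \<gamma> * (x - \<rho>s)\<^sup>2 \<le> - 1 * \<Lambda> n x y * (x - \<rho>s)"
    by (rule smooth_periodic2_linear_bound[OF \<Lambda>_smooth[OF \<open>n \<ge> 1\<close>] \<rho>s \<Lambda>0, of "- 1"])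
      (use l in auto)
  have sm: "smooth_on (\<lambda>(x, y). \<Omega> m x y) ({0<..\<R>} \<times> UNIV)"
    and per: "\<And>x y. x \<in> {0<..<\<R>} \<Longrightarrow> \<Omega> m x (y + 2 * pi) = \<Omega> m x y"
    using \<Omega>_smooth[OF \<open>m \<ge> 1\<close>] by (auto simp: smooth_periodic2_def)
  have \<Omega>_cont: "continuous_on ({0<..<\<R>} \<times> UNIV) (\<lambda>(x, y). \<Omega> m x y)"
    by (rule continuous_on_subset[OF smooth_on_continuous[OF sm]]) auto
  \<comment> \<open>A continuous function without zeros on the connected line has constant
    sign.\<close>
  obtain \<sigma> :: real where \<sigma>: "\<sigma> = 1 \<or> \<sigma> = - 1" and \<Omega>_pos: "\<And>y. \<sigma> * \<Omega> m \<rho>s y > 0"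
  proof -
    have "continuous_on UNIV (\<lambda>y :: real. (\<rho>s, y))" by (intro continuous_intros)
    moreover have "(\<lambda>y :: real. (\<rho>s, y)) ` UNIV \<subseteq> {0<..<\<R>} \<times> UNIV" using \<rho>s by auto
    ultimately have cont: "continuous_on UNIV (\<Omega> m \<rho>s)"
      using continuous_on_compose2[OF \<Omega>_cont] by fastforce
    have "connected (\<Omega> m \<rho>s ` UNIV)" by (rule connected_continuous_image[OF cont connected_UNIV])
    then have "is_interval (\<Omega> m \<rho>s ` UNIV)" by (simp add: is_interval_connected_1)
    moreover have "0 \<notin> \<Omega> m \<rho>s ` UNIV" using \<Omega> by (metis imageE)
    ultimately have "(\<forall>y. \<Omega> m \<rho>s y > 0) \<or> (\<forall>y. \<Omega> m \<rho>s y < 0)"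
      unfolding is_interval_1 by (metis linorder_less_linear order_less_imp_le rangeI)
    then show ?thesis using that[of 1] that[of "- 1"] by auto
  qed
  have "continuous_on ({0<..<\<R>} \<times> UNIV) (\<lambda>(x, y). \<sigma> * \<Omega> m x y)"
    using continuous_on_mult_left[OF \<Omega>_cont] by (simp add: case_prod_unfold)
  then obtain \<gamma>' d' where "\<gamma>' > 0" "d' > 0" and \<gamma>': "\<And>x y. x \<in> {\<rho>s - d'..\<rho>s + d'} \<Longrightarrow> \<gamma>' \<le> \<sigma> * \<Omega> m x y"
    by (rule periodic_lower_bound[of \<R> "\<lambda>x y. \<sigma> * \<Omega> m x y" "2 * pi"])
      (use per \<rho>s \<Omega>_pos in auto)
  \<comment> \<open>The barrier runs at a radius that serves all claims: \<epsilon> for the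
    stability estimate, \<open>d'\<close> for the sign of \<open>\<Omega> m\<close>, and
    \<open>d / 2\<close> for the gap that continuation to all times needs. A large \<epsilon> thus
    causes no difficulty for the drift.\<close>
  define e where "e = min \<epsilon> (min (d / 2) d')"
  have e: "e > 0" "e \<le> \<epsilon>" "e < d" "e \<le> d" "e \<le> d'"
    using \<open>\<epsilon> > 0\<close> \<open>d > 0\<close> \<open>d' > 0\<close> by (auto simp: e_def min_def)
  have ab: "0 < \<rho>s - d" "\<rho>s + d < \<R>"
    using subsetD[OF sub, of "\<rho>s - d"] subsetD[OF sub, of "\<rho>s + d"] \<open>d > 0\<close> by auto
  obtain T where "T \<ge> 1" and T: "\<And>ts I \<rho> \<phi> t. ts \<ge> T \<Longrightarrow> solution_from \<R> \<omega> f g S ts I \<rho> \<phi> \<Longrightarrow>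
      \<bar>\<rho> ts - \<rho>s\<bar> \<le> e / 4 \<Longrightarrow> t \<in> I \<Longrightarrow> \<bar>\<rho> t - \<rho>s\<bar> < e"
  proof (rule attracting_strip[OF \<open>d > 0\<close> sub \<open>\<gamma> > 0\<close> \<Lambda> e(1,4)])
    fix T :: real
    assume "T \<ge> 1" and strip: "\<And>ts I \<rho> \<phi> t. ts \<ge> T \<Longrightarrow> solution_from \<R> \<omega> f g S ts I \<rho> \<phi> \<Longrightarrow>
      \<bar>\<rho> ts - \<rho>s\<bar> \<le> e / 4 \<Longrightarrow> t \<in> I \<Longrightarrow> \<bar>\<rho> t - \<rho>s\<bar> < e"
    show thesis
    proof (rule that[OF \<open>T \<ge> 1\<close>])
      fix ts I \<rho> \<phi> t
      assume "ts \<ge> T" "solution_from \<R> \<omega> f g S ts I \<rho> \<phi>" "\<bar>\<rho> ts - \<rho>s\<bar> \<le> e / 4" "t \<in> I"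
      then show "\<bar>\<rho> t - \<rho>s\<bar> < e" by (rule strip)
    qed
  qed
  show ?thesis
  proof (rule that[of "e / 4" T])
    show "e / 4 \<in> {0<..<\<epsilon>}" using e by auto
    show "T > 0" using \<open>T \<ge> 1\<close> by simp
    show "\<bar>\<rho> t - \<rho>s\<bar> < \<epsilon>"
      if "ts \<ge> T" "solution_from \<R> \<omega> f g S ts I \<rho> \<phi>" "\<bar>\<rho> ts - \<rho>s\<bar> \<le> e / 4" "t \<in> I" for ts I \<rho> \<phi> t
      using T[OF that] e(2) by simp
    fix ts I \<rho> \<phi> assume "ts \<ge> T" and maximal: "maximal_solution_from \<R> \<omega> f g S ts I \<rho> \<phi>"
      and init: "\<bar>\<rho> ts - \<rho>s\<bar> \<le> e / 4"
    then have sol: "solution_from \<R> \<omega> f g S ts I \<rho> \<phi>" by (simp add: maximal_solution_from_def)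
    have strip: "\<rho> t \<in> {\<rho>s - e..\<rho>s + e}" if "t \<in> I" for t
      using T[OF \<open>ts \<ge> T\<close> sol init that] by auto
    have I: "I = {ts..}"
      by (rule maximal_solution_global[OF maximal, of "\<rho>s - d" "\<rho>s - e" "\<rho>s + e" "\<rho>s + d"])
        (use \<open>ts \<ge> T\<close> \<open>T \<ge> 1\<close> ab e strip in auto)
    moreover have "filterlim (\<lambda>t. \<bar>\<phi> t - c * S t\<bar>) at_top at_top"
    proof (rule angular_drift[of "\<rho>s - e" "\<rho>s + e" \<gamma>' \<sigma> ts \<rho>])
      show "\<gamma>' \<le> \<sigma> * \<Omega> m x y" if "x \<in> {\<rho>s - e..\<rho>s + e}" for x y
        using that e(5) by (intro \<gamma>') auto
    qed (use ab e \<sigma> \<open>\<gamma>' > 0\<close> sol strip I in auto)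
    ultimately show "I = {ts..} \<and> filterlim (\<lambda>t. \<bar>\<phi> t - c * S t\<bar>) at_top at_top" by blast
  qed
qed

end

theorem theorem3:
  fixes \<omega> \<R> \<rho>s :: real and q n m :: nat and \<kappa> \<nu> :: int
    and f g :: "real \<Rightarrow> real \<Rightarrow> real \<Rightarrow> real \<Rightarrow> real"
    and fk gk u v :: "nat \<Rightarrow> real \<Rightarrow> real \<Rightarrow> real \<Rightarrow> real"
    and S :: "real \<Rightarrow> real" and s :: "nat \<Rightarrow> real"
    and \<Lambda> \<Omega> :: "nat \<Rightarrow> real \<Rightarrow> real \<Rightarrow> real"
    and l :: "real \<Rightarrow> real"
  assumes "\<omega> > 0" and "\<R> > 0" and "q \<ge> 1"
    and "smooth_periodic_rhs \<R> f" and "smooth_periodic_rhs \<R> g"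
    and "smooth_on S {0<..}"
    and "s 0 > 0" and "deriv S \<sim>[at_top] (\<lambda>_. s 0)"
    and "coprime \<kappa> \<nu>" and "of_int \<kappa> * s 0 = of_int \<nu> * \<omega>"
    and "\<And>\<rho> \<phi>. \<rho> \<in> {0<..\<R>} \<Longrightarrow> ((\<lambda>t. f \<rho> \<phi> (S t) t) \<longlongrightarrow> 0) at_top"
    and "\<And>\<rho> \<phi>. \<rho> \<in> {0<..\<R>} \<Longrightarrow> ((\<lambda>t. g \<rho> \<phi> (S t) t) \<longlongrightarrow> 0) at_top"
    and "\<And>k. k \<ge> 1 \<Longrightarrow> smooth_periodic3 \<R> (2 * pi) (2 * pi) (fk k)"
    and "\<And>k. k \<ge> 1 \<Longrightarrow> smooth_periodic3 \<R> (2 * pi) (2 * pi) (gk k)"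
    and "asymptotic_expansion \<R> q f fk" and "asymptotic_expansion \<R> q g gk"
    and "\<And>N. (\<lambda>t. deriv S t - (\<Sum>k = 0..N. t powr (- (real k / real q)) * s k))
              \<in> O[at_top](\<lambda>t. t powr (- (real (N + 1) / real q)))"
    and "averaged_coefficients \<R> q \<kappa> \<nu> s fk gk u v \<Lambda> \<Omega>"
    and "n \<in> {1..q}" and "m \<in> {1..q}"
    and "\<forall>k\<in>{1..<n}. \<forall>\<rho>\<in>{0<..\<R>}. \<forall>\<psi>. \<Lambda> k \<rho> \<psi> = 0"
    and "\<exists>\<rho>\<in>{0<..\<R>}. \<exists>\<psi>. \<Lambda> n \<rho> \<psi> \<noteq> 0"
    and "\<forall>k\<in>{1..<m}. \<forall>\<rho>\<in>{0<..\<R>}. \<forall>\<psi>. \<Omega> k \<rho> \<psi> = 0"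
    and "\<exists>\<rho>\<in>{0<..\<R>}. \<exists>\<psi>. \<Omega> m \<rho> \<psi> \<noteq> 0"
    and "\<rho>s \<in> {0<..<\<R>}"
    and "\<forall>\<psi>. \<Lambda> n \<rho>s \<psi> = 0"
    and "l = (\<lambda>\<psi>. deriv (\<lambda>\<rho>. \<Lambda> n \<rho> \<psi>) \<rho>s)"
    and "\<exists>\<psi>. l \<psi> \<noteq> 0"
    and "\<forall>\<psi>. \<Omega> m \<rho>s \<psi> \<noteq> 0"
  shows
    "((\<forall>\<psi>. l \<psi> < 0) \<longrightarrow>
       (\<forall>\<epsilon>>0. \<exists>\<delta>\<in>{0<..<\<epsilon>}. \<exists>t\<epsilon>>0. \<forall>ts\<ge>t\<epsilon>. \<forall>I \<rho> \<phi>.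
          solution_from \<R> \<omega> f g S ts I \<rho> \<phi> \<and> \<bar>\<rho> ts - \<rho>s\<bar> \<le> \<delta> \<longrightarrow>
            (\<forall>t\<in>I. t > ts \<longrightarrow> \<bar>\<rho> t - \<rho>s\<bar> < \<epsilon>) \<and>
            (maximal_solution_from \<R> \<omega> f g S ts I \<rho> \<phi> \<longrightarrow>
               I = {ts..} \<and>
               filterlim (\<lambda>t. \<bar>\<phi> t - of_int \<kappa> / of_int \<nu> * S t\<bar>) at_top at_top)))
     \<and>
     ((\<forall>\<psi>. l \<psi> > 0) \<longrightarrow>
       (\<exists>\<epsilon>>0. \<exists>t0>0. \<forall>\<delta>\<in>{0<..<\<epsilon>}. \<exists>ts\<ge>t0. \<exists>I \<rho> \<phi>.
          solution_from \<R> \<omega> f g S ts I \<rho> \<phi> \<and> \<bar>\<rho> ts - \<rho>s\<bar> \<le> \<delta> \<and>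
          (\<exists>te\<in>I. te > ts \<and> \<bar>\<rho> te - \<rho>s\<bar> \<ge> \<epsilon>)))"
proof -
  have smooth: "smooth_periodic3 \<R> (2 * pi) (2 * pi) (fk k)" "smooth_periodic3 \<R> (2 * pi) (2 * pi) (gk k)"
    if "k \<ge> 1" for k
    using assms that by blast+
  have expansion: "(\<lambda>t. deriv S t - (\<Sum>k = 0..N. t powr (- (real k / real q)) * s k))
      \<in> O[at_top](\<lambda>t. t powr (- (real (N + 1) / real q)))" for N
    by fact
  have "\<nu> \<noteq> 0"
  proof
    assume "\<nu> = 0"
    with \<open>of_int \<kappa> * s 0 = of_int \<nu> * \<omega>\<close> \<open>s 0 > 0\<close> have "\<kappa> = 0" by simp
    with \<open>\<nu> = 0\<close> \<open>coprime \<kappa> \<nu>\<close> show False by simp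
  qed
  have zeros: "\<Lambda> k x y = 0" if "1 \<le> k" "k < n" "x \<in> {0<..\<R>}" for k x y
    using \<open>\<forall>k\<in>{1..<n}. \<forall>\<rho>\<in>{0<..\<R>}. \<forall>\<psi>. \<Lambda> k \<rho> \<psi> = 0\<close> that by simp
  have zeros': "\<Omega> k x y = 0" if "1 \<le> k" "k < m" "x \<in> {0<..\<R>}" for k x y
    using \<open>\<forall>k\<in>{1..<m}. \<forall>\<rho>\<in>{0<..\<R>}. \<forall>\<psi>. \<Omega> k \<rho> \<psi> = 0\<close> that by simp
  interpret averaged_system \<omega> \<R> q \<kappa> \<nu> f g fk gk S s n m u v \<Lambda> \<Omega>
    by unfold_locales (use assms \<open>\<nu> \<noteq> 0\<close> smooth expansion zeros zeros' in blast)+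
  note \<Lambda>0 = \<open>\<forall>\<psi>. \<Lambda> n \<rho>s \<psi> = 0\<close>[rule_format]
  show ?thesis
  proof (intro conjI impI allI)
    fix \<epsilon> :: real assume neg: "\<forall>\<psi>. l \<psi> < 0" and "\<epsilon> > 0"
    then have l: "deriv (\<lambda>\<rho>. \<Lambda> n \<rho> \<psi>) \<rho>s < 0" for \<psi>
      using \<open>l = (\<lambda>\<psi>. deriv (\<lambda>\<rho>. \<Lambda> n \<rho> \<psi>) \<rho>s)\<close> by simp
    obtain \<delta> T where "\<delta> \<in> {0<..<\<epsilon>}" "T > 0"
      and stable: "\<And>ts I \<rho> \<phi> t. ts \<ge> T \<Longrightarrow> solution_from \<R> \<omega> f g S ts I \<rho> \<phi> \<Longrightarrow> \<bar>\<rho> ts - \<rho>s\<bar> \<le> \<delta> \<Longrightarrow>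
        t \<in> I \<Longrightarrow> \<bar>\<rho> t - \<rho>s\<bar> < \<epsilon>"
      and drift: "\<And>ts I \<rho> \<phi>. ts \<ge> T \<Longrightarrow> maximal_solution_from \<R> \<omega> f g S ts I \<rho> \<phi> \<Longrightarrow>
        \<bar>\<rho> ts - \<rho>s\<bar> \<le> \<delta> \<Longrightarrow>
        I = {ts..} \<and> filterlim (\<lambda>t. \<bar>\<phi> t - of_int \<kappa> / of_int \<nu> * S t\<bar>) at_top at_top"
      by (rule stability[OF \<open>\<rho>s \<in> {0<..<\<R>}\<close> \<Lambda>0 l
            \<open>\<forall>\<psi>. \<Omega> m \<rho>s \<psi> \<noteq> 0\<close>[rule_format] \<open>\<epsilon> > 0\<close>]) blast
    show "\<exists>\<delta>\<in>{0<..<\<epsilon>}. \<exists>t\<epsilon>>0. \<forall>ts\<ge>t\<epsilon>. \<forall>I \<rho> \<phi>.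
        solution_from \<R> \<omega> f g S ts I \<rho> \<phi> \<and> \<bar>\<rho> ts - \<rho>s\<bar> \<le> \<delta> \<longrightarrow>
          (\<forall>t\<in>I. t > ts \<longrightarrow> \<bar>\<rho> t - \<rho>s\<bar> < \<epsilon>) \<and>
          (maximal_solution_from \<R> \<omega> f g S ts I \<rho> \<phi> \<longrightarrow>
             I = {ts..} \<and>
             filterlim (\<lambda>t. \<bar>\<phi> t - of_int \<kappa> / of_int \<nu> * S t\<bar>) at_top at_top)"
      by (intro bexI[of _ \<delta>] exI[of _ T] conjI allI impI ballI)
        (use \<open>T > 0\<close> \<open>\<delta> \<in> {0<..<\<epsilon>}\<close> stable drift in blast)+
  next
    assume pos: "\<forall>\<psi>. l \<psi> > 0"
    have l: "1 * deriv (\<lambda>\<rho>. \<Lambda> n \<rho> \<psi>) \<rho>s > 0" for \<psi>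
      using pos \<open>l = (\<lambda>\<psi>. deriv (\<lambda>\<rho>. \<Lambda> n \<rho> \<psi>) \<rho>s)\<close> by simp
    have "n \<ge> 1" using n by simp
    obtain \<gamma> d where "\<gamma> > 0" "d > 0" and sub: "{\<rho>s - d..\<rho>s + d} \<subseteq> {0<..<\<R>}"
      and \<Lambda>: "\<And>x y. x \<in> {\<rho>s - d..\<rho>s + d} \<Longrightarrow> \<gamma> * (x - \<rho>s)\<^sup>2 \<le> 1 * \<Lambda> n x y * (x - \<rho>s)"
      by (rule smooth_periodic2_linear_bound[OF \<Lambda>_smooth[OF \<open>n \<ge> 1\<close>] \<open>\<rho>s \<in> {0<..<\<R>}\<close> \<Lambda>0 l]) blast
    have escapes: "\<exists>ts\<ge>1. \<exists>I \<rho> \<phi>. solution_from \<R> \<omega> f g S ts I \<rho> \<phi> \<and> \<bar>\<rho> ts - \<rho>s\<bar> \<le> \<delta> \<and>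
        (\<exists>te\<in>I. te > ts \<and> \<bar>\<rho> te - \<rho>s\<bar> \<ge> d)" if "\<delta> \<in> {0<..<d}" for \<delta>
    proof -
      have "0 < \<delta>" "\<delta> < d" using that by auto
      obtain ts I \<rho> \<phi> te where "ts \<ge> 1" and sol: "solution_from \<R> \<omega> f g S ts I \<rho> \<phi>"
        and init: "\<bar>\<rho> ts - \<rho>s\<bar> \<le> \<delta>" and te: "te \<in> I" "te > ts" "\<bar>\<rho> te - \<rho>s\<bar> \<ge> d"
        using repelling_strip[OF \<open>d > 0\<close> sub \<open>\<gamma> > 0\<close> \<Lambda> \<open>0 < \<delta>\<close> \<open>\<delta> < d\<close>] .
      have escape: "ts \<ge> 1 \<and> solution_from \<R> \<omega> f g S ts I \<rho> \<phi> \<and> \<bar>\<rho> ts - \<rho>s\<bar> \<le> \<delta> \<and>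
          (\<exists>te\<in>I. te > ts \<and> \<bar>\<rho> te - \<rho>s\<bar> \<ge> d)"
        using \<open>ts \<ge> 1\<close> sol init te by blast
      show ?thesis
        by (rule exI[of _ ts], rule conjI, rule conjunct1[OF escape], rule exI[of _ I],
            rule exI[of _ \<rho>], rule exI[of _ \<phi>], rule conjunct2[OF escape])
    qed
    \<comment> \<open>The width \<open>d\<close> depends only on \<open>\<Lambda> n\<close>, hence
      not on \<delta>. Since \<open>ts\<close> may be chosen after \<delta>, the fixed value 1
      serves for \<open>t0\<close>.\<close>
    show "\<exists>\<epsilon>>0. \<exists>t0>0. \<forall>\<delta>\<in>{0<..<\<epsilon>}. \<exists>ts\<ge>t0. \<exists>I \<rho> \<phi>.
        solution_from \<R> \<omega> f g S ts I \<rho> \<phi> \<and> \<bar>\<rho> ts - \<rho>s\<bar> \<le> \<delta> \<and>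
        (\<exists>te\<in>I. te > ts \<and> \<bar>\<rho> te - \<rho>s\<bar> \<ge> \<epsilon>)"
      by (rule exI[of _ d], rule conjI, rule \<open>d > 0\<close>, rule exI[of _ 1], rule conjI, rule zero_less_one,
          rule ballI, rule escapes)
  qed
qed

end
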